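(* Let $(M^{2k+1},g,\xi,\eta,\varphi)$ be an almost contact metric manifold. The following conditions are equivalent: 1) The Nijenhuis tensor $N$ is skew-symmetric (i.e. $N(X,Y,Z)=g(N(X,Y),Z)$ is a $3$-form) and $\xi$ is a Killing vector field. 2) There exists an almost contact linear connection $\nabla$ with totally skew-symmetric torsion tensor $T$. Moreover, this connection is unique and determined by $$g(\nabla_XY,Z)=g(\nabla^g_XY,Z)+\frac12T(X,Y,Z),$$ where $\nabla^g$ is the Levi-Civita connection and the torsion $T$ is defined by $$T=\eta\wedge d\eta+d^\varphi F+N-\eta\wedge(\xi\lrcorner N).$$
   Context: An almost contact metric manifold is a Riemannian manifold $(M^{2k+1},g)$ with a $1$-form $\eta$, a $(1,1)$-tensor $\varphi$ and a vector field $\xi$ dual to $\eta$ with respect to $g$ such that $\eta(\xi)=1$, $\varphi^2=-\mathrm{Id}+\eta\otimes\xi$, $g(\varphi X,\varphi Y)=g(X,Y)-\eta(X)\eta(Y)$, $\varphi(\xi)=0$. The fundamental form is $F(X,Y)=g(X,\varphi(Y))$ and the Nijenhuis tensor is $$N(X,Y)=[\varphi X,\varphi Y]+\varphi^2[X,Y]-\varphi[\varphi X,Y]-\varphi[X,\varphi Y]+d\eta(X,Y)\,\xi,\qquad N(X,Y,Z)=g(N(X,Y),Z),$$ with $d\eta(X,Y)=X\eta(Y)-Y\eta(X)-\eta([X,Y])$. Further, $d^\varphi F(X,Y,Z)=-dF(\varphi X,\varphi Y,\varphi Z)$. A linear connection $\nabla$ is an almost contact connection if $\nabla g=\nabla\eta=\nabla\varphi=0$.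 Its torsion is totally skew-symmetric if $T(X,Y,Z)=g(\nabla_XY-\nabla_YX-[X,Y],Z)$ is a $3$-form. *)

theory Defs
  imports "HOL-Analysis.Analysis" "HOL-Library.Function_Algebras"
begin

section \<open>Smooth manifolds\<close>

text \<open>Smoothness on an open subset of a Euclidean space: all iterated directional
  derivatives exist, are Frechet differentiable and continuous.\<close>

fun times_differentiable_on ::
    "nat \<Rightarrow> 'e::euclidean_space set \<Rightarrow> ('e \<Rightarrow> 'f::real_normed_vector) \<Rightarrow> bool" where
  "times_differentiable_on 0 S f \<longleftrightarrow> continuous_on S f"
| "times_differentiable_on (Suc n) S f \<longleftrightarrow>
     (\<forall>x\<in>S. f differentiable (at x)) \<and>
     (\<forall>v. times_differentiable_on n S (\<lambda>x. frechet_derivative f (at x) v))"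

definition smooth_on ::
    "'e::euclidean_space set \<Rightarrow> ('e \<Rightarrow> 'f::real_normed_vector) \<Rightarrow> bool" where
  "smooth_on S f \<longleftrightarrow> (\<forall>n. times_differentiable_on n S f)"

text \<open>A chart is a pair of its domain and its coordinate map. The manifold is the whole
  type \<open>'a\<close>; its dimension is \<open>DIM('e)\<close>. An atlas is not required to be
  maximal, since the smooth functions of an atlas and of its maximal extension coincide.\<close>

type_synonym ('a, 'e) chart = "'a set \<times> ('a \<Rightarrow> 'e)"

definition smooth_atlas ::
    "('a::topological_space, 'e::euclidean_space) chart set \<Rightarrow> bool" where
  "smooth_atlas A \<longleftrightarrow>
     (\<Union>(U, x)\<in>A. U) = UNIV \<and>
     (\<forall>(U, x)\<in>A. open U \<and> open (x ` U) \<and> homeomorphism U (x ` U) x (inv_into U x)) \<and>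
     (\<forall>(U, x)\<in>A. \<forall>(V, y)\<in>A. smooth_on (x ` (U \<inter> V)) (y \<circ> inv_into U x))"

definition smooth_functions ::
    "('a::topological_space, 'e::euclidean_space) chart set \<Rightarrow> ('a \<Rightarrow> real) set" where
  "smooth_functions A = {f. \<forall>(U, x)\<in>A. smooth_on (x ` U) (f \<circ> inv_into U x)}"

text \<open>Vector fields are the derivations of the algebra of smooth functions. So that equality
  of vector fields is equality in HOL, they are set to 0 on non-smooth functions.
  The operations on functions and on vector fields are the pointwise ones.\<close>

type_synonym 'a vfield = "('a \<Rightarrow> real) \<Rightarrow> ('a \<Rightarrow> real)"

definition vector_fields ::
    "('a::topological_space, 'e::euclidean_space) chart set \<Rightarrow> 'a vfield set" where
  "vector_fields A = {X.
     (\<forall>f\<in>smooth_functions A. X f \<in> smooth_functions A) \<and>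
     (\<forall>f\<in>smooth_functions A. \<forall>h\<in>smooth_functions A. X (f + h) = X f + X h) \<and>
     (\<forall>c. \<forall>f\<in>smooth_functions A. X (\<lambda>p. c * f p) = (\<lambda>p. c * X f p)) \<and>
     (\<forall>f\<in>smooth_functions A. \<forall>h\<in>smooth_functions A. X (f * h) = f * X h + h * X f) \<and>
     (\<forall>f. f \<notin> smooth_functions A \<longrightarrow> X f = 0)}"

definition fsmult :: "('a \<Rightarrow> real) \<Rightarrow> 'a vfield \<Rightarrow> 'a vfield" where
  "fsmult f X = (\<lambda>h. f * X h)"

definition bracket :: "'a vfield \<Rightarrow> 'a vfield \<Rightarrow> 'a vfield" where
  "bracket X Y = (\<lambda>f. X (Y f) - Y (X f))"


section \<open>Tensor fields\<close>

text \<open>Tensor fields are maps on vector fields that are multilinear over the smooth functions.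
  Only their values on vector fields matter.\<close>

type_synonym 'a form1 = "'a vfield \<Rightarrow> 'a \<Rightarrow> real"
type_synonym 'a form2 = "'a vfield \<Rightarrow> 'a vfield \<Rightarrow> 'a \<Rightarrow> real"
type_synonym 'a form3 = "'a vfield \<Rightarrow> 'a vfield \<Rightarrow> 'a vfield \<Rightarrow> 'a \<Rightarrow> real"

definition one_form ::
    "('a::topological_space, 'e::euclidean_space) chart set \<Rightarrow> 'a form1 \<Rightarrow> bool" where
  "one_form A \<omega> \<longleftrightarrow>
     (\<forall>X\<in>vector_fields A. \<omega> X \<in> smooth_functions A) \<and>
     (\<forall>X\<in>vector_fields A. \<forall>Y\<in>vector_fields A. \<omega> (X + Y) = \<omega> X + \<omega> Y) \<and>
     (\<forall>f\<in>smooth_functions A. \<forall>X\<in>vector_fields A. \<omega> (fsmult f X) = f * \<omega> X)"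

definition endomorphism_field ::
    "('a::topological_space, 'e::euclidean_space) chart set \<Rightarrow> ('a vfield \<Rightarrow> 'a vfield) \<Rightarrow> bool" where
  "endomorphism_field A \<phi> \<longleftrightarrow>
     (\<forall>X\<in>vector_fields A. \<phi> X \<in> vector_fields A) \<and>
     (\<forall>X\<in>vector_fields A. \<forall>Y\<in>vector_fields A. \<phi> (X + Y) = \<phi> X + \<phi> Y) \<and>
     (\<forall>f\<in>smooth_functions A. \<forall>X\<in>vector_fields A. \<phi> (fsmult f X) = fsmult f (\<phi> X))"

definition three_form ::
    "('a::topological_space, 'e::euclidean_space) chart set \<Rightarrow> 'a form3 \<Rightarrow> bool" where
  "three_form A \<omega> \<longleftrightarrow>
     (\<forall>X\<in>vector_fields A. \<forall>Y\<in>vector_fields A.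
        one_form A (\<lambda>Z. \<omega> Z X Y) \<and> one_form A (\<lambda>Z. \<omega> X Z Y) \<and> one_form A (\<lambda>Z. \<omega> X Y Z)) \<and>
     (\<forall>X\<in>vector_fields A. \<forall>Y\<in>vector_fields A. \<forall>Z\<in>vector_fields A.
        \<omega> Y X Z = - \<omega> X Y Z \<and> \<omega> X Z Y = - \<omega> X Y Z)"

text \<open>The last condition is positive definiteness of the inner product at \<open>p\<close>: the value of
  \<open>X\<close> at \<open>p\<close> is nonzero iff \<open>X\<close> does not annihilate all smooth functions at \<open>p\<close>.\<close>

definition riemannian_metric ::
    "('a::topological_space, 'e::euclidean_space) chart set \<Rightarrow> 'a form2 \<Rightarrow> bool" where
  "riemannian_metric A g \<longleftrightarrow>
     (\<forall>Y\<in>vector_fields A. one_form A (\<lambda>X. g X Y)) \<and>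
     (\<forall>X\<in>vector_fields A. \<forall>Y\<in>vector_fields A. g X Y = g Y X) \<and>
     (\<forall>X\<in>vector_fields A. \<forall>p. (\<exists>f\<in>smooth_functions A. X f p \<noteq> 0) \<longrightarrow> g X X p > 0)"

text \<open>Exterior derivative and wedge product are normalised without factorials, matching
  \<open>d\<eta>(X,Y) = X \<eta>(Y) - Y \<eta>(X) - \<eta>([X,Y])\<close>.\<close>

definition d_one_form :: "'a form1 \<Rightarrow> 'a form2" where
  "d_one_form \<eta> X Y = X (\<eta> Y) - Y (\<eta> X) - \<eta> (bracket X Y)"

definition d_two_form :: "'a form2 \<Rightarrow> 'a form3" where
  "d_two_form \<omega> X Y Z =
     X (\<omega> Y Z) - Y (\<omega> X Z) + Z (\<omega> X Y)
     - \<omega> (bracket X Y) Z + \<omega> (bracket X Z) Y - \<omega> (bracket Y Z) X"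

definition wedge_one_two :: "'a form1 \<Rightarrow> 'a form2 \<Rightarrow> 'a form3" where
  "wedge_one_two \<alpha> \<beta> X Y Z = \<alpha> X * \<beta> Y Z + \<alpha> Y * \<beta> Z X + \<alpha> Z * \<beta> X Y"

definition interior_product :: "'a vfield \<Rightarrow> 'a form3 \<Rightarrow> 'a form2" where
  "interior_product \<xi> \<omega> X Y = \<omega> \<xi> X Y"

definition killing_field ::
    "('a::topological_space, 'e::euclidean_space) chart set \<Rightarrow> 'a form2 \<Rightarrow> 'a vfield \<Rightarrow> bool" where
  "killing_field A g \<xi> \<longleftrightarrow>
     \<xi> \<in> vector_fields A \<and>
     (\<forall>X\<in>vector_fields A. \<forall>Y\<in>vector_fields A.
        \<xi> (g X Y) - g (bracket \<xi> X) Y - g X (bracket \<xi> Y) = 0)"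


section \<open>Linear connections\<close>

text \<open>By convention a connection is 0 outside the vector fields, so that unique existence can be
  expressed by \<open>\<exists>!\<close> and \<open>THE\<close>.\<close>

type_synonym 'a connection = "'a vfield \<Rightarrow> 'a vfield \<Rightarrow> 'a vfield"

definition linear_connection ::
    "('a::topological_space, 'e::euclidean_space) chart set \<Rightarrow> 'a connection \<Rightarrow> bool" where
  "linear_connection A D \<longleftrightarrow>
     (\<forall>X\<in>vector_fields A. \<forall>Y\<in>vector_fields A. D X Y \<in> vector_fields A) \<and>
     (\<forall>X\<in>vector_fields A. \<forall>X'\<in>vector_fields A. \<forall>Y\<in>vector_fields A.
        D (X + X') Y = D X Y + D X' Y) \<and>
     (\<forall>f\<in>smooth_functions A. \<forall>X\<in>vector_fields A. \<forall>Y\<in>vector_fields A.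
        D (fsmult f X) Y = fsmult f (D X Y)) \<and>
     (\<forall>X\<in>vector_fields A. \<forall>Y\<in>vector_fields A. \<forall>Y'\<in>vector_fields A.
        D X (Y + Y') = D X Y + D X Y') \<and>
     (\<forall>f\<in>smooth_functions A. \<forall>X\<in>vector_fields A. \<forall>Y\<in>vector_fields A.
        D X (fsmult f Y) = fsmult (X f) Y + fsmult f (D X Y)) \<and>
     (\<forall>X Y. X \<notin> vector_fields A \<or> Y \<notin> vector_fields A \<longrightarrow> D X Y = 0)"

definition torsion :: "'a connection \<Rightarrow> 'a vfield \<Rightarrow> 'a vfield \<Rightarrow> 'a vfield" where
  "torsion D X Y = D X Y - D Y X - bracket X Y"

definition torsion3 :: "'a form2 \<Rightarrow> 'a connection \<Rightarrow> 'a form3" where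
  "torsion3 g D X Y Z = g (torsion D X Y) Z"

definition parallel_metric ::
    "('a::topological_space, 'e::euclidean_space) chart set \<Rightarrow> 'a connection \<Rightarrow> 'a form2 \<Rightarrow> bool" where
  "parallel_metric A D g \<longleftrightarrow>
     (\<forall>X\<in>vector_fields A. \<forall>Y\<in>vector_fields A. \<forall>Z\<in>vector_fields A.
        X (g Y Z) - g (D X Y) Z - g Y (D X Z) = 0)"

definition parallel_one_form ::
    "('a::topological_space, 'e::euclidean_space) chart set \<Rightarrow> 'a connection \<Rightarrow> 'a form1 \<Rightarrow> bool" where
  "parallel_one_form A D \<eta> \<longleftrightarrow>
     (\<forall>X\<in>vector_fields A. \<forall>Y\<in>vector_fields A. X (\<eta> Y) - \<eta> (D X Y) = 0)"

definition parallel_endomorphism ::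
    "('a::topological_space, 'e::euclidean_space) chart set \<Rightarrow> 'a connection
      \<Rightarrow> ('a vfield \<Rightarrow> 'a vfield) \<Rightarrow> bool" where
  "parallel_endomorphism A D \<phi> \<longleftrightarrow>
     (\<forall>X\<in>vector_fields A. \<forall>Y\<in>vector_fields A. D X (\<phi> Y) - \<phi> (D X Y) = 0)"

definition levi_civita ::
    "('a::topological_space, 'e::euclidean_space) chart set \<Rightarrow> 'a form2 \<Rightarrow> 'a connection" where
  "levi_civita A g = (THE D. linear_connection A D \<and> parallel_metric A D g \<and>
     (\<forall>X\<in>vector_fields A. \<forall>Y\<in>vector_fields A. torsion D X Y = 0))"


section \<open>Almost contact metric structures\<close>

definition almost_contact_metric ::
    "('a::topological_space, 'e::euclidean_space) chart set \<Rightarrow> 'a form2 \<Rightarrow> 'a vfield \<Rightarrow> 'a form1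
      \<Rightarrow> ('a vfield \<Rightarrow> 'a vfield) \<Rightarrow> bool" where
  "almost_contact_metric A g \<xi> \<eta> \<phi> \<longleftrightarrow>
     riemannian_metric A g \<and> \<xi> \<in> vector_fields A \<and> one_form A \<eta> \<and> endomorphism_field A \<phi> \<and>
     (\<forall>X\<in>vector_fields A. \<eta> X = g \<xi> X) \<and>
     \<eta> \<xi> = 1 \<and>
     (\<forall>X\<in>vector_fields A. \<phi> (\<phi> X) = - X + fsmult (\<eta> X) \<xi>) \<and>
     (\<forall>X\<in>vector_fields A. \<forall>Y\<in>vector_fields A. g (\<phi> X) (\<phi> Y) = g X Y - \<eta> X * \<eta> Y) \<and>
     \<phi> \<xi> = 0"

definition fundamental_form :: "'a form2 \<Rightarrow> ('a vfield \<Rightarrow> 'a vfield) \<Rightarrow> 'a form2" where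
  "fundamental_form g \<phi> X Y = g X (\<phi> Y)"

definition d_phi_F :: "'a form2 \<Rightarrow> ('a vfield \<Rightarrow> 'a vfield) \<Rightarrow> 'a form3" where
  "d_phi_F g \<phi> X Y Z = - d_two_form (fundamental_form g \<phi>) (\<phi> X) (\<phi> Y) (\<phi> Z)"

definition nijenhuis ::
    "'a vfield \<Rightarrow> 'a form1 \<Rightarrow> ('a vfield \<Rightarrow> 'a vfield) \<Rightarrow> 'a vfield \<Rightarrow> 'a vfield \<Rightarrow> 'a vfield" where
  "nijenhuis \<xi> \<eta> \<phi> X Y =
     bracket (\<phi> X) (\<phi> Y) + \<phi> (\<phi> (bracket X Y)) - \<phi> (bracket (\<phi> X) Y) - \<phi> (bracket X (\<phi> Y))
     + fsmult (d_one_form \<eta> X Y) \<xi>"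

definition nijenhuis3 ::
    "'a form2 \<Rightarrow> 'a vfield \<Rightarrow> 'a form1 \<Rightarrow> ('a vfield \<Rightarrow> 'a vfield) \<Rightarrow> 'a form3" where
  "nijenhuis3 g \<xi> \<eta> \<phi> X Y Z = g (nijenhuis \<xi> \<eta> \<phi> X Y) Z"

definition almost_contact_connection ::
    "('a::topological_space, 'e::euclidean_space) chart set \<Rightarrow> 'a form2 \<Rightarrow> 'a form1
      \<Rightarrow> ('a vfield \<Rightarrow> 'a vfield) \<Rightarrow> 'a connection \<Rightarrow> bool" where
  "almost_contact_connection A g \<eta> \<phi> D \<longleftrightarrow>
     linear_connection A D \<and> parallel_metric A D g \<and> parallel_one_form A D \<eta> \<and>
     parallel_endomorphism A D \<phi>"

definition canonical_torsion ::
    "'a form2 \<Rightarrow> 'a vfield \<Rightarrow> 'a form1 \<Rightarrow> ('a vfield \<Rightarrow> 'a vfield) \<Rightarrow> 'a form3" where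
  "canonical_torsion g \<xi> \<eta> \<phi> X Y Z =
     wedge_one_two \<eta> (d_one_form \<eta>) X Y Z + d_phi_F g \<phi> X Y Z + nijenhuis3 g \<xi> \<eta> \<phi> X Y Z
     - wedge_one_two \<eta> (interior_product \<xi> (nijenhuis3 g \<xi> \<eta> \<phi>)) X Y Z"

end

theory Submission
  imports Defs
begin

text \<open>A metric connection \<open>D\<close> is determined by its lowered torsion \<open>T\<close> through the Koszul formula, and
  every 3-form \<open>T\<close> occurs, by the Riesz isomorphism between 1-forms and vector fields; on vector
  fields given as derivations, the latter rests on Hadamard's lemma. Let \<open>P(X,Y,Z) = g((D\<^sub>X\<phi>)Y,Z)\<close>.
  If \<open>D\<eta> = 0\<close>, then \<open>D\<xi> = 0\<close>, and replacing brackets by \<open>D\<^sub>XY - D\<^sub>YX - T(X,Y)\<close> gives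
  \<open>d\<eta>(X,Y) = T(X,Y,\<xi>)\<close> and
  \<open>N(X,Y,Z) = T(X,Y,Z) - T(\<phi>X,\<phi>Y,Z) - T(\<phi>X,Y,\<phi>Z) - T(X,\<phi>Y,\<phi>Z)\<close> plus terms in \<open>P\<close>, and similarly
  for \<open>dF\<close>. If \<open>P = 0\<close>, these show that \<open>N\<close> is a 3-form, that \<open>\<xi>\<close> is Killing, and that \<open>T\<close> has the
  stated form. Conversely let \<open>D\<close> be the metric connection whose torsion is the stated 3-form. As \<open>\<xi>\<close> is
  Killing, \<open>T(\<xi>,X,Y) = d\<eta>(X,Y)\<close>, so \<open>D\<eta> = 0\<close>; comparing \<open>T\<close> with the formulas above leaves a linear
  identity for \<open>P\<close>. It yields first \<open>P(\<xi>,X,Y) = 0\<close>, then \<open>P(Z,X,Y) = P(X,Y,Z) + P(Y,Z,X)\<close>, whose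
  cyclic permutations force \<open>P = 0\<close>.\<close>

section \<open>Calculus in Euclidean spaces\<close>

text \<open>Derivations act only on functions of the whole manifold, so everything local has to be
  expressed by global objects. Bump functions stand in for restriction to an open set: they make
  derivations and 1-forms local, turn chart coordinates into global functions and fields, and let a
  derivation be applied to Hadamard's expansion. A frame still exists only near a point. The
  equations for the Riesz field are therefore solved near each point, where the Gram matrix of the
  frame is invertible, and nondegeneracy makes the solutions agree on overlaps. The tensor
  \<open>P\<close> is kept in the formulas for \<open>N\<close> and \<open>dF\<close> so that one
  computation serves both implications. The shape of the torsion formula is a matter of
  cancellation: \<open>d_phi_F\<close> removes the terms of \<open>N\<close> in which \<phi> enters
  two arguments of \<open>T\<close>, and the two wedge products together remove the terms containing
  \<xi> that this leaves. What remains is \<open>T\<close> plus terms in \<open>P\<close>. The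
  combination itself does not mention \<open>D\<close>, which gives uniqueness.\<close>

lemma times_differentiable_on_imp_continuous_on:
  "times_differentiable_on n S f \<Longrightarrow> continuous_on S f"
  by (cases n) (auto simp: continuous_at_imp_continuous_on differentiable_imp_continuous_within)

text \<open>The definition passes from a function to its derivative, so lowering the order needs an
  induction: it lowers the order of the directional derivatives and ends with the continuity of a
  differentiable function.\<close>

lemma times_differentiable_on_SucD:
  "times_differentiable_on (Suc n) S f \<Longrightarrow> times_differentiable_on n S f"
proof (induction n arbitrary: f)
  case 0
  then show ?case
    by (simp add: continuous_at_imp_continuous_on differentiable_imp_continuous_within)
next
  case (Suc n)
  then show ?case
    by (metis times_differentiable_on.simps(2))
qed

text \<open>\<open>frechet_derivative\<close> is a choice from the predicate
  \<open>has_derivative\<close>. Functions that agree near \<open>x\<close> have the same predicate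
  there, so the choices coincide even where no derivative exists.\<close>

lemma frechet_derivative_eq:
  assumes "open S" "x \<in> S" "\<And>y. y \<in> S \<Longrightarrow> f y = h y"
  shows "frechet_derivative f (at x) = frechet_derivative h (at x)"
proof -
  have "(f has_derivative D) (at x) \<longleftrightarrow> (h has_derivative D) (at x)" for D
    using assms
    by (metis (full_types) has_derivative_transform_within_open)
  then show ?thesis
    by (simp add: frechet_derivative_def)
qed

lemma times_differentiable_on_cong:
  assumes "open S" "\<And>x. x \<in> S \<Longrightarrow> f x = h x" "times_differentiable_on n S f"
  shows "times_differentiable_on n S h"
  using assms(2,3)
proof (induction n arbitrary: f h)
  case 0
  then show ?case by (metis continuous_on_cong times_differentiable_on.simps(1))
next
  case (Suc n)
  have "h differentiable (at x)" if "x \<in> S" for x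
    using Suc.prems that assms(1) unfolding differentiable_def
    by (metis has_derivative_transform_within_open times_differentiable_on.simps(2) differentiable_def)
  moreover have "times_differentiable_on n S (\<lambda>x. frechet_derivative h (at x) v)" for v
  proof (rule Suc.IH)
    show "times_differentiable_on n S (\<lambda>x. frechet_derivative f (at x) v)"
      using Suc.prems by simp
  qed (use Suc.prems assms(1) frechet_derivative_eq in metis)
  ultimately show ?case by simp
qed

lemma times_differentiable_on_subset:
  "times_differentiable_on n S f \<Longrightarrow> T \<subseteq> S \<Longrightarrow> times_differentiable_on n T f"
  by (induction n arbitrary: f) (auto intro: continuous_on_subset)

lemma times_differentiable_on_local:
  assumes "\<And>x. x \<in> S \<Longrightarrow> \<exists>T. open T \<and> x \<in> T \<and> times_differentiable_on n T f"
  shows "times_differentiable_on n S f"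
  using assms
proof (induction n arbitrary: f)
  case 0
  have "isCont f x" if "x \<in> S" for x
    using 0[OF that] continuous_on_eq_continuous_at by auto
  then show ?case by (simp add: continuous_at_imp_continuous_on)
next
  case (Suc n)
  have "\<exists>T. open T \<and> x \<in> T \<and> times_differentiable_on n T (\<lambda>y. frechet_derivative f (at y) v)"
    if "x \<in> S" for x v
    using Suc.prems[OF that] by auto
  then have "times_differentiable_on n S (\<lambda>x. frechet_derivative f (at x) v)" for v
    by (rule Suc.IH)
  moreover have "f differentiable (at x)" if "x \<in> S" for x
    using Suc.prems[OF that] by auto
  ultimately show ?case by simp
qed

text \<open>Lets an explicit formula \<open>f'\<close> take the place of
  \<open>frechet_derivative\<close> in the closure proofs. The two agree on the open set
  \<open>S\<close>, hence so do their higher derivatives.\<close>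

lemma times_differentiable_on_SucI:
  assumes "open S"
    and "\<And>x. x \<in> S \<Longrightarrow> (f has_derivative f' x) (at x)"
    and "\<And>v. times_differentiable_on n S (\<lambda>x. f' x v)"
  shows "times_differentiable_on (Suc n) S f"
proof -
  have "times_differentiable_on n S (\<lambda>x. frechet_derivative f (at x) v)" for v
  proof (rule times_differentiable_on_cong[OF assms(1) _ assms(3)])
    fix x assume "x \<in> S"
    then show "f' x v = frechet_derivative f (at x) v"
      using assms(2) frechet_derivative_at by metis
  qed
  then show ?thesis
    using assms(2) by (auto simp: differentiable_def)
qed

lemma times_differentiable_on_SucE:
  assumes "times_differentiable_on (Suc n) S f" "x \<in> S"
  shows "(f has_derivative frechet_derivative f (at x)) (at x)"
  using assms by (simp add: frechet_derivative_works)

lemma times_differentiable_on_const: "times_differentiable_on n S (\<lambda>x. c)"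
proof (induction n arbitrary: c)
  case (Suc n)
  then show ?case by (simp add: frechet_derivative_const)
qed simp

lemma times_differentiable_on_bounded_linear_compose:
  assumes "open S" "bounded_linear L" "times_differentiable_on n S f"
  shows "times_differentiable_on n S (\<lambda>x. L (f x))"
  using assms(3)
proof (induction n arbitrary: f)
  case 0
  then show ?case
    using assms(2) by (simp add: bounded_linear.continuous_on)
next
  case (Suc n)
  show ?case
  proof (rule times_differentiable_on_SucI[OF assms(1)])
    fix x assume "x \<in> S"
    then show "((\<lambda>x. L (f x)) has_derivative (\<lambda>v. L (frechet_derivative f (at x) v))) (at x)"
      using Suc.prems assms(2) bounded_linear.has_derivative times_differentiable_on_SucE by blast
  next
    fix v show "times_differentiable_on n S (\<lambda>x. L (frechet_derivative f (at x) v))"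
      using Suc by auto
  qed
qed

lemma times_differentiable_on_id: "open S \<Longrightarrow> times_differentiable_on n S (\<lambda>x. x)"
proof (cases n)
  case (Suc m)
  assume "open S"
  then show ?thesis unfolding Suc
    by (intro times_differentiable_on_SucI[where f' = "\<lambda>x v. v"])
      (auto intro: times_differentiable_on_const)
qed simp

lemma times_differentiable_on_add:
  assumes "open S" "times_differentiable_on n S f" "times_differentiable_on n S h"
  shows "times_differentiable_on n S (\<lambda>x. f x + h x)"
  using assms(2,3)
proof (induction n arbitrary: f h)
  case 0
  then show ?case by (simp add: continuous_on_add)
next
  case (Suc n)
  show ?case
  proof (rule times_differentiable_on_SucI[OF assms(1)])
    fix x assume "x \<in> S"
    then show "((\<lambda>x. f x + h x) has_derivative
        (\<lambda>v. frechet_derivative f (at x) v + frechet_derivative h (at x) v)) (at x)"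
      using Suc.prems has_derivative_add times_differentiable_on_SucE by blast
  next
    fix v show "times_differentiable_on n S
        (\<lambda>x. frechet_derivative f (at x) v + frechet_derivative h (at x) v)"
      using Suc by auto
  qed
qed

lemma times_differentiable_on_sum:
  assumes "open S" "\<And>i. i \<in> I \<Longrightarrow> times_differentiable_on n S (f i)"
  shows "times_differentiable_on n S (\<lambda>x. \<Sum>i\<in>I. f i x)"
  using assms(2)
  by (induction I rule: infinite_finite_induct)
    (auto simp: times_differentiable_on_const intro: times_differentiable_on_add[OF assms(1)])

lemma times_differentiable_on_scaleR:
  assumes "open S" "times_differentiable_on n S f" "times_differentiable_on n S h"
  shows "times_differentiable_on n S (\<lambda>x. f x *\<^sub>R h x)"
  using assms(2,3)
proof (induction n arbitrary: f h)
  case 0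
  then show ?case by (simp add: continuous_on_scaleR)
next
  case (Suc n)
  show ?case
  proof (rule times_differentiable_on_SucI[OF assms(1)])
    fix x assume "x \<in> S"
    then show "((\<lambda>x. f x *\<^sub>R h x) has_derivative
        (\<lambda>v. f x *\<^sub>R frechet_derivative h (at x) v + frechet_derivative f (at x) v *\<^sub>R h x)) (at x)"
      by (intro has_derivative_scaleR times_differentiable_on_SucE[OF Suc.prems(1)]
          times_differentiable_on_SucE[OF Suc.prems(2)])
  next
    fix v
    show "times_differentiable_on n S
        (\<lambda>x. f x *\<^sub>R frechet_derivative h (at x) v + frechet_derivative f (at x) v *\<^sub>R h x)"
      using Suc.prems Suc.IH
      by (intro times_differentiable_on_add[OF assms(1)])
        (metis times_differentiable_on.simps(2) times_differentiable_on_SucD)+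
  qed
qed

lemma times_differentiable_on_compose:
  fixes f :: "'e::euclidean_space \<Rightarrow> 'f::euclidean_space"
  assumes "open S" "open T" "f ` S \<subseteq> T"
    and "times_differentiable_on n S f" "times_differentiable_on n T h"
  shows "times_differentiable_on n S (\<lambda>x. h (f x))"
  using assms(4,5)
proof (induction n arbitrary: h)
  case 0
  then show ?case using assms(3)
    by (auto intro: continuous_on_compose2)
next
  case (Suc n)
  let ?f' = "\<lambda>x. frechet_derivative f (at x)" and ?h' = "\<lambda>x. frechet_derivative h (at x)"
  have f': "(f has_derivative ?f' x) (at x)" if "x \<in> S" for x
    using Suc.prems that times_differentiable_on_SucE by blast
  have h': "(h has_derivative ?h' (f x)) (at (f x))" if "x \<in> S" for x
    using Suc.prems that assms(3) times_differentiable_on_SucE by blast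
  show ?case
  proof (rule times_differentiable_on_SucI[OF assms(1)])
    fix x assume x: "x \<in> S"
    have "((\<lambda>x. h (f x)) has_derivative (\<lambda>v. ?h' (f x) (?f' x v))) (at x)"
      using diff_chain_at[OF f' h', OF x x] by (simp add: o_def)
    \<comment> \<open>In the chain rule the direction \<open>?f' x v\<close> varies with
      \<open>x\<close>, whereas the induction hypothesis can be applied to derivatives of
      \<open>h\<close> in a fixed direction. The expansion in \<open>Basis\<close> separates the
      two.\<close>
    moreover have "?h' (f x) (?f' x v) = (\<Sum>b\<in>Basis. (?f' x v \<bullet> b) *\<^sub>R ?h' (f x) b)" for v
    proof -
      interpret linear "?h' (f x)"
        using h'[OF x] has_derivative_linear by blast
      have "?h' (f x) (\<Sum>b\<in>Basis. (?f' x v \<bullet> b) *\<^sub>R b) = (\<Sum>b\<in>Basis. (?f' x v \<bullet> b) *\<^sub>R ?h' (f x) b)"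
        by (simp add: sum scale)
      then show ?thesis by (simp add: euclidean_representation)
    qed
    ultimately show "((\<lambda>x. h (f x)) has_derivative
        (\<lambda>v. \<Sum>b\<in>Basis. (?f' x v \<bullet> b) *\<^sub>R ?h' (f x) b)) (at x)"
      by simp
  next
    fix v
    have "times_differentiable_on n S (\<lambda>x. ?h' (f x) b)" for b
      using Suc.prems by (intro Suc.IH) (auto dest: times_differentiable_on_SucD simp del: times_differentiable_on.simps(2) intro: times_differentiable_on.simps(2)[THEN iffD1, THEN conjunct2, rule_format])
    then show "times_differentiable_on n S (\<lambda>x. \<Sum>b\<in>Basis. (?f' x v \<bullet> b) *\<^sub>R ?h' (f x) b)"
      using Suc.prems
      by (intro times_differentiable_on_sum times_differentiable_on_scaleR assms(1)
          times_differentiable_on_bounded_linear_compose[OF assms(1) bounded_linear_inner_left]) auto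
  qed
qed

text \<open>Each differentiation under the integral brings out a factor \<open>t\<close>, so the
  weight \<open>t ^ m\<close> with arbitrary \<open>m\<close> is what closes the induction. The ball
  contains the segments from its centre, on which \<open>f\<close> is evaluated.\<close>

lemma times_differentiable_on_integral:
  fixes f :: "'e::euclidean_space \<Rightarrow> real"
  assumes "times_differentiable_on n (ball a r) f"
  shows "times_differentiable_on n (ball a r)
    (\<lambda>x. integral {0..1} (\<lambda>t. t ^ m * f (a + t *\<^sub>R (x - a))))"
  using assms
proof (induction n arbitrary: f m)
  have seg: "a + t *\<^sub>R (x - a) \<in> ball a r" if "x \<in> ball a r" "t \<in> cbox 0 1" for x t
  proof -
    have "norm (t *\<^sub>R (x - a)) \<le> 1 * norm (x - a)"
      using that unfolding norm_scaleR by (intro mult_right_mono) auto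
    then show ?thesis using that
      by (auto simp: dist_norm norm_minus_commute)
  qed
  have cont: "continuous_on (ball a r \<times> cbox 0 1) (\<lambda>(x, t). t ^ k * h (a + t *\<^sub>R (x - a)))"
    if "continuous_on (ball a r) h" for h :: "'e \<Rightarrow> real" and k :: nat
    unfolding split_def
    by (intro continuous_intros continuous_on_compose2[OF that]) (use seg in auto)
  {
    case 0
    then show ?case
      using integral_continuous_on_param[OF cont] by simp
  next
    case (Suc n)
    \<comment> \<open>The Leibniz rule asks for joint continuity of the derivative as a bounded
      linear map. In finite dimension this reduces to continuity of its value on each fixed
      vector.\<close>
    define f' where "f' x t = Blinfun (\<lambda>v. t ^ Suc m * frechet_derivative f (at (a + t *\<^sub>R (x - a))) v)"
      for x and t :: real
    have D: "(f has_derivative frechet_derivative f (at y)) (at y)" if "y \<in> ball a r" for y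
      using Suc.prems that times_differentiable_on_SucE by blast
    have f': "blinfun_apply (f' x t) v = t ^ Suc m * frechet_derivative f (at (a + t *\<^sub>R (x - a))) v"
      if "x \<in> ball a r" "t \<in> cbox 0 1" for x t v
      unfolding f'_def
      by (subst bounded_linear_Blinfun_apply)
        (auto intro!: bounded_linear_const_mult has_derivative_bounded_linear[OF D] seg[OF that])
    have contf: "continuous_on (ball a r) f"
      by (rule times_differentiable_on_imp_continuous_on[OF Suc.prems])
    have cont': "continuous_on (ball a r) (\<lambda>y. frechet_derivative f (at y) v)" for v
      using Suc.prems times_differentiable_on_imp_continuous_on times_differentiable_on.simps(2) by metis
    have contf': "continuous_on (ball a r \<times> cbox 0 1) (\<lambda>(x, t). f' x t)"
      unfolding split_def
    proof (rule continuous_on_blinfun_componentwise)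
      fix v :: 'e
      show "continuous_on (ball a r \<times> cbox 0 1) (\<lambda>z. blinfun_apply (f' (fst z) (snd z)) v)"
        by (rule continuous_on_cong[THEN iffD1, OF refl _ cont[OF cont', of "Suc m" v]])
          (auto simp: f')
    qed
    have pair: "continuous_on (cbox (0::real) 1) (Pair x)" for x :: 'e
      by (rule continuous_on_Pair[OF continuous_on_const continuous_on_id])
    have int_f': "f' x integrable_on cbox 0 1" if "x \<in> ball a r" for x
    proof (rule integrable_continuous)
      show "continuous_on (cbox 0 1) (f' x)"
        using continuous_on_compose2[OF contf' pair[of x]] that by (simp add: image_subset_iff)
    qed
    have der: "((\<lambda>x. integral (cbox 0 1) (\<lambda>t. t ^ m * f (a + t *\<^sub>R (x - a)))) has_derivative
        blinfun_apply (integral (cbox 0 1) (f' x))) (at x)" if x: "x \<in> ball a r" for x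
    proof -
      have "((\<lambda>x. integral (cbox 0 1) (\<lambda>t. t ^ m * f (a + t *\<^sub>R (x - a)))) has_derivative
        blinfun_apply (integral (cbox 0 1) (f' x))) (at x within ball a r)"
      proof (rule leibniz_rule[OF _ _ contf' x convex_ball])
        fix x t assume x: "x \<in> ball a r" and t: "t \<in> cbox (0::real) 1"
        have "((\<lambda>x. a + t *\<^sub>R (x - a)) has_derivative (\<lambda>v. t *\<^sub>R v)) (at x)"
          by (auto intro!: derivative_eq_intros)
        from diff_chain_at[OF this D[OF seg[OF x t]]]
        have "((\<lambda>x. t ^ m * f (a + t *\<^sub>R (x - a))) has_derivative
            (\<lambda>v. t ^ m * frechet_derivative f (at (a + t *\<^sub>R (x - a))) (t *\<^sub>R v))) (at x)"
          by (auto simp: o_def intro!: has_derivative_mult_right)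
        moreover have "frechet_derivative f (at (a + t *\<^sub>R (x - a))) (t *\<^sub>R v)
            = t * frechet_derivative f (at (a + t *\<^sub>R (x - a))) v" for v
          using linear_cmul[OF has_derivative_linear[OF D[OF seg[OF x t]]]] by simp
        ultimately have "((\<lambda>x. t ^ m * f (a + t *\<^sub>R (x - a))) has_derivative
            blinfun_apply (f' x t)) (at x)"
          by (auto simp: f'[OF x t] fun_eq_iff mult_ac elim!: has_derivative_eq_rhs)
        then show "((\<lambda>x. t ^ m * f (a + t *\<^sub>R (x - a))) has_derivative
            blinfun_apply (f' x t)) (at x within ball a r)"
          by (rule has_derivative_at_withinI)
      next
        fix x assume x: "x \<in> ball a r"
        show "(\<lambda>t. t ^ m * f (a + t *\<^sub>R (x - a))) integrable_on cbox 0 1"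
        proof (rule integrable_continuous)
          show "continuous_on (cbox 0 1) (\<lambda>t. t ^ m * f (a + t *\<^sub>R (x - a)))"
          proof -
            have "continuous_on (cbox 0 1) (\<lambda>t. (\<lambda>(x, t). t ^ m * f (a + t *\<^sub>R (x - a))) (x, t))"
              by (rule continuous_on_compose2[OF cont[OF contf] pair]) (use x in auto)
            then show ?thesis by simp
          qed
        qed
      qed
      then show ?thesis by (simp only: at_within_open[OF x open_ball])
    qed
    show ?case
    proof (rule times_differentiable_on_SucI)
      show "open (ball a r)" by simp
      show "((\<lambda>x. integral {0..1} (\<lambda>t. t ^ m * f (a + t *\<^sub>R (x - a)))) has_derivative
        blinfun_apply (integral (cbox 0 1) (f' x))) (at x)" if "x \<in> ball a r" for x
        using der[OF that] by simp
      fix v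
      have 1: "times_differentiable_on n (ball a r) (\<lambda>x. integral {0..1}
          (\<lambda>t. t ^ Suc m * frechet_derivative f (at (a + t *\<^sub>R (x - a))) v))"
        using Suc.prems by (intro Suc.IH) simp
      have 2: "integral {0..1} (\<lambda>t. t ^ Suc m * frechet_derivative f (at (a + t *\<^sub>R (x - a))) v)
          = blinfun_apply (integral (cbox 0 1) (f' x)) v" if x: "x \<in> ball a r" for x
      proof -
        have "integral (cbox 0 1) (\<lambda>t. blinfun_apply (f' x t) v)
            = integral (cbox 0 1) (\<lambda>t. t ^ Suc m * frechet_derivative f (at (a + t *\<^sub>R (x - a))) v)"
          by (rule integral_cong) (rule f'[OF x])
        then show ?thesis
          using blinfun_apply_integral[OF int_f'[OF x], of v] unfolding box_real(2) by argo
      qed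
      show "times_differentiable_on n (ball a r)
          (\<lambda>x. blinfun_apply (integral (cbox 0 1) (f' x)) v)"
        by (rule times_differentiable_on_cong[OF open_ball 2 1])
    qed
  }
qed


section \<open>Smoothness of reciprocals, flat functions and bump functions\<close>

text \<open>First-order information about all members suffices: directional derivatives are again
  members, so the order is raised by induction without formulas for higher derivatives.\<close>

lemma smooth_on_family:
  assumes "open S" "f \<in> F"
    and F: "\<And>f. f \<in> F \<Longrightarrow> \<exists>f'. (\<forall>x\<in>S. (f has_derivative f' x) (at x)) \<and> (\<forall>v. (\<lambda>x. f' x v) \<in> F)"
  shows "smooth_on S f"
  unfolding smooth_on_def
proof
  fix n
  show "times_differentiable_on n S f" using assms(2)
  proof (induction n arbitrary: f)
    case 0
    then show ?case
      using F has_derivative_continuous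
      by (metis continuous_at_imp_continuous_on times_differentiable_on.simps(1))
  next
    case (Suc n)
    then obtain f' where "\<forall>x\<in>S. (f has_derivative f' x) (at x)" "\<forall>v. (\<lambda>x. f' x v) \<in> F"
      using F by blast
    then show ?case
      using Suc.IH by (intro times_differentiable_on_SucI[OF assms(1)]) auto
  qed
qed

lemma smooth_on_inverse: "smooth_on (- {0}) (inverse :: real \<Rightarrow> real)"
proof -
  let ?F = "{\<lambda>t. c * inverse t ^ n | (c::real) n. True}"
  have "\<exists>f'. (\<forall>x\<in>- {0}. (f has_derivative f' x) (at x)) \<and> (\<forall>v. (\<lambda>x. f' x v) \<in> ?F)"
    if "f \<in> ?F" for f
  proof -
    obtain c n where f: "f = (\<lambda>t. c * inverse t ^ n)"
      using \<open>f \<in> ?F\<close> by blast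
    let ?f' = "\<lambda>t v. (- c * real n * v) * inverse t ^ Suc n"
    have "(f has_derivative ?f' x) (at x)" if "x \<in> - {0}" for x
    proof -
      have "((\<lambda>t. inverse t ^ n) has_field_derivative - real n * inverse x ^ Suc n) (at x)"
      proof (cases n)
        case (Suc m)
        have "real n * (- (inverse x ^ Suc (Suc 0)) * inverse x ^ (n - Suc 0)) = - real n * inverse x ^ Suc n"
          by (simp add: Suc ring_distribs)
        then show ?thesis
          using DERIV_power[OF DERIV_inverse[of x], of n] that by (simp add: Suc mult_ac)
      qed simp
      then show ?thesis
        unfolding f has_field_derivative_def
        by (rule has_derivative_eq_rhs[OF has_derivative_mult_right]) (simp add: fun_eq_iff)
    qed
    then show ?thesis
      by (intro exI[of _ ?f']) blast
  qed
  moreover have "inverse \<in> ?F"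
    by (intro CollectI exI[of _ 1] exI[of _ "1::nat"]) (simp add: fun_eq_iff)
  ultimately show ?thesis
    by (intro smooth_on_family[where F = ?F]) auto
qed

text \<open>The functions \<open>P(1/t) exp(-1/t)\<close>, \<open>P\<close> a polynomial, are closed under differentiation;
  this proves smoothness at 0 of the flat function \<open>exp(-1/t)\<close>.\<close>

definition flat :: "real poly \<Rightarrow> real \<Rightarrow> real" where
  "flat P t = (if t > 0 then poly P (inverse t) * exp (- inverse t) else 0)"

text \<open>With \<open>u = 1/t\<close>, the derivative of \<open>P(u) exp(-u)\<close> in
  \<open>t\<close> is \<open>u^2 (P(u) - P'(u)) exp(-u)\<close>, whence the factor
  \<open>[:0, 0, 1:]\<close>. At 0 the difference quotient is 0 on the left and tends to 0 on the
  right, because the exponential dominates polynomials.\<close>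

lemma flat_has_field_derivative:
  "(flat P has_field_derivative flat ([:0, 0, 1:] * (P - pderiv P)) t) (at t)"
proof -
  consider "t < 0" | "t = 0" | "t > 0" by linarith
  then show ?thesis
  proof cases
    case 1
    then have "flat ([:0, 0, 1:] * (P - pderiv P)) t = 0" by (simp add: flat_def)
    moreover have "(flat P has_field_derivative 0) (at t)"
      by (rule has_field_derivative_transform_within_open[where f = "\<lambda>_. 0" and S = "{..<0}"])
        (use 1 in \<open>auto simp: flat_def\<close>)
    ultimately show ?thesis by simp
  next
    case 3
    have "((\<lambda>t. poly P (inverse t) * exp (- inverse t)) has_field_derivative
        flat ([:0, 0, 1:] * (P - pderiv P)) t) (at t)"
      using 3
      by (auto intro!: derivative_eq_intros simp: flat_def field_simps power2_eq_square)
    then show ?thesis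
      by (rule has_field_derivative_transform_within_open[where S = "{0<..}"])
        (use 3 in \<open>auto simp: flat_def\<close>)
  next
    case 2
    have "((\<lambda>u. poly Q u * exp (- u)) \<longlongrightarrow> 0) at_top" for Q :: "real poly"
    proof -
      have "((\<lambda>u. \<Sum>i\<le>degree Q. coeff Q i * (u ^ i / exp u)) \<longlongrightarrow> (\<Sum>i\<le>degree Q. coeff Q i * 0)) at_top"
        by (intro tendsto_intros tendsto_power_div_exp_0)
      then show ?thesis
        by (simp add: poly_altdef sum_distrib_right exp_minus divide_inverse mult.assoc)
    qed
    \<comment> \<open>For \<open>t > 0\<close> the quotient \<open>flat P t / t\<close> is
      \<open>u P(u) exp(-u)\<close> with \<open>u = 1/t\<close>; the extra factor \<open>u\<close>
      is \<open>[:0, 1:]\<close>.\<close>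
    from filterlim_compose[OF this filterlim_inverse_at_top_right]
    have "((\<lambda>t. poly ([:0, 1:] * P) (inverse t) * exp (- inverse t)) \<longlongrightarrow> 0) (at_right 0)" .
    then have "((\<lambda>t. flat P t / t) \<longlongrightarrow> 0) (at_right 0)"
      by (rule Lim_transform_eventually)
        (auto simp: flat_def eventually_at_filter field_simps)
    moreover have "((\<lambda>t. flat P t / t) \<longlongrightarrow> 0) (at_left 0)"
      by (rule Lim_transform_eventually[OF tendsto_const])
        (auto simp: flat_def eventually_at_filter)
    ultimately have "((\<lambda>t. flat P t / t) \<longlongrightarrow> 0) (at 0)"
      by (simp add: filterlim_split_at)
    then show ?thesis
      by (simp add: 2 has_field_derivative_iff flat_def)
  qed
qed

lemma smooth_on_flat: "smooth_on UNIV (flat P)"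
proof (rule smooth_on_family)
  fix f assume "f \<in> range flat"
  then obtain Q where f: "f = flat Q" by blast
  let ?f' = "\<lambda>t v. flat ([:0, 0, 1:] * (Q - pderiv Q)) t * v"
  \<comment> \<open>The direction \<open>v\<close> is a scalar and can be absorbed into the
    polynomial, so the family is closed under directional derivatives.\<close>
  have "(\<lambda>t. ?f' t v) = flat (smult v ([:0, 0, 1:] * (Q - pderiv Q)))" for v
    by (auto simp: flat_def fun_eq_iff)
  then have "\<forall>v. (\<lambda>t. ?f' t v) \<in> range flat"
    by (metis rangeI)
  moreover have "\<forall>t\<in>UNIV. (f has_derivative ?f' t) (at t)"
    unfolding f using flat_has_field_derivative[of Q] unfolding has_field_derivative_def by blast
  ultimately show "\<exists>f'. (\<forall>x\<in>UNIV. (f has_derivative f' x) (at x)) \<and> (\<forall>v. (\<lambda>x. f' x v) \<in> range flat)"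
    by (intro exI[of _ ?f'] conjI)
qed auto

lemma smooth_on_subset: "smooth_on S f \<Longrightarrow> T \<subseteq> S \<Longrightarrow> smooth_on T f"
  by (auto simp: smooth_on_def intro: times_differentiable_on_subset)

lemma smooth_on_cong:
  "open S \<Longrightarrow> (\<And>x. x \<in> S \<Longrightarrow> f x = h x) \<Longrightarrow> smooth_on S f \<Longrightarrow> smooth_on S h"
  unfolding smooth_on_def by (blast intro: times_differentiable_on_cong)

lemma smooth_on_local:
  assumes "\<And>x. x \<in> S \<Longrightarrow> \<exists>T. open T \<and> x \<in> T \<and> smooth_on T f"
  shows "smooth_on S f"
  unfolding smooth_on_def
  by (intro allI times_differentiable_on_local) (use assms smooth_on_def in blast)

lemma smooth_on_const: "smooth_on S (\<lambda>x. c)"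
  by (simp add: smooth_on_def times_differentiable_on_const)

lemma smooth_on_id: "open S \<Longrightarrow> smooth_on S (\<lambda>x. x)"
  by (simp add: smooth_on_def times_differentiable_on_id)

lemma smooth_on_add:
  "open S \<Longrightarrow> smooth_on S f \<Longrightarrow> smooth_on S h \<Longrightarrow> smooth_on S (\<lambda>x. f x + h x)"
  by (simp add: smooth_on_def times_differentiable_on_add)

lemma smooth_on_sum:
  "open S \<Longrightarrow> (\<And>i. i \<in> I \<Longrightarrow> smooth_on S (f i)) \<Longrightarrow> smooth_on S (\<lambda>x. \<Sum>i\<in>I. f i x)"
  by (simp add: smooth_on_def times_differentiable_on_sum)

lemma smooth_on_mult:
  fixes f h :: "'e::euclidean_space \<Rightarrow> real"
  shows "open S \<Longrightarrow> smooth_on S f \<Longrightarrow> smooth_on S h \<Longrightarrow> smooth_on S (\<lambda>x. f x * h x)"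
  using times_differentiable_on_scaleR[of S _ f h] by (simp add: smooth_on_def)

lemma smooth_on_bounded_linear_compose:
  "open S \<Longrightarrow> bounded_linear L \<Longrightarrow> smooth_on S f \<Longrightarrow> smooth_on S (\<lambda>x. L (f x))"
  by (simp add: smooth_on_def times_differentiable_on_bounded_linear_compose)

lemma smooth_on_compose:
  fixes f :: "'e::euclidean_space \<Rightarrow> 'f::euclidean_space"
  shows "open S \<Longrightarrow> open T \<Longrightarrow> f ` S \<subseteq> T \<Longrightarrow> smooth_on S f \<Longrightarrow> smooth_on T h
    \<Longrightarrow> smooth_on S (\<lambda>x. h (f x))"
  unfolding smooth_on_def by (blast intro: times_differentiable_on_compose)

lemma smooth_on_frechet_derivative:
  "smooth_on S f \<Longrightarrow> smooth_on S (\<lambda>x. frechet_derivative f (at x) v)"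
  unfolding smooth_on_def by (metis times_differentiable_on.simps(2))

lemma smooth_on_has_derivative:
  "smooth_on S f \<Longrightarrow> x \<in> S \<Longrightarrow> (f has_derivative frechet_derivative f (at x)) (at x)"
  unfolding smooth_on_def using times_differentiable_on_SucE by blast

lemma smooth_on_divide:
  fixes f h :: "'e::euclidean_space \<Rightarrow> real"
  assumes "open S" "smooth_on S f" "smooth_on S h" "\<And>x. x \<in> S \<Longrightarrow> h x \<noteq> 0"
  shows "smooth_on S (\<lambda>x. f x / h x)"
  unfolding divide_inverse
  by (intro smooth_on_mult smooth_on_compose[OF assms(1) _ _ assms(3) smooth_on_inverse] assms)
    (use assms(4) in auto)

text \<open>\<open>u\<close> is positive exactly on the open ball of radius \<open>r\<close>, and
  \<open>v\<close> exactly outside the closed ball of radius \<open>r / 2\<close>. These sets cover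
  the space, so \<open>u / (u + v)\<close> is defined everywhere; it is 1 where \<open>v\<close>
  vanishes and 0 where \<open>u\<close> does. The squared distance \<open>\<rho>\<close> is taken
  because it is smooth at \<open>a\<close> as well.\<close>

lemma smooth_bump_euclidean:
  fixes a :: "'e::euclidean_space"
  assumes "r > 0"
  shows "\<exists>\<psi> :: 'e \<Rightarrow> real. smooth_on UNIV \<psi> \<and> (\<forall>y\<in>cball a (r / 2). \<psi> y = 1) \<and>
    (\<forall>y. y \<notin> ball a r \<longrightarrow> \<psi> y = 0) \<and> (\<forall>y. 0 \<le> \<psi> y) \<and> (\<forall>y. \<psi> y \<le> 1)"
proof -
  define \<rho> where "\<rho> y = (y - a) \<bullet> (y - a)" for y
  have sub: "smooth_on UNIV (\<lambda>y. y - a)"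
    using smooth_on_add[OF open_UNIV smooth_on_id smooth_on_const[of _ "- a"]] by simp
  have "smooth_on UNIV (\<lambda>y. \<Sum>b\<in>Basis. ((y - a) \<bullet> b) * ((y - a) \<bullet> b))"
    by (intro smooth_on_sum smooth_on_mult
        smooth_on_bounded_linear_compose[OF _ bounded_linear_inner_left sub]) auto
  then have \<rho>: "smooth_on UNIV \<rho>"
    unfolding \<rho>_def by (subst euclidean_inner)
  have neg: "smooth_on UNIV (\<lambda>y. - \<rho> y)"
    by (intro smooth_on_bounded_linear_compose[OF _ _ \<rho>] bounded_linear_minus bounded_linear_ident) simp
  define u v where "u y = flat 1 (r\<^sup>2 - \<rho> y)" and "v y = flat 1 (\<rho> y - (r / 2)\<^sup>2)" for y
  have "smooth_on UNIV u"
    unfolding u_def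
    using smooth_on_compose[OF _ _ _ smooth_on_add[OF _ smooth_on_const neg] smooth_on_flat] by simp
  moreover have v: "smooth_on UNIV v"
    unfolding v_def
    using smooth_on_compose[OF _ _ _ smooth_on_add[OF _ \<rho> smooth_on_const[of _ "- ((r / 2)\<^sup>2)"]] smooth_on_flat]
    by simp
  moreover have pos: "u y + v y > 0" for y
  proof -
    have "(r / 2)\<^sup>2 < r\<^sup>2" using assms by (simp add: power_divide)
    then consider "\<rho> y < r\<^sup>2" | "\<rho> y > (r / 2)\<^sup>2" by linarith
    then show ?thesis
      by cases (auto simp: u_def v_def flat_def add_pos_nonneg add_nonneg_pos)
  qed
  ultimately have "smooth_on UNIV (\<lambda>y. u y / (u y + v y))"
    by (intro smooth_on_divide smooth_on_add) (auto simp: less_imp_neq[symmetric])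
  moreover have "u y / (u y + v y) = 1" if "y \<in> cball a (r / 2)" for y
  proof -
    have "\<rho> y \<le> (r / 2)\<^sup>2"
      using that assms unfolding \<rho>_def
      by (metis dist_norm dist_commute mem_cball norm_ge_zero power2_norm_eq_inner power_mono)
    then have "v y = 0" by (simp add: v_def flat_def)
    then show ?thesis using pos[of y] by simp
  qed
  moreover have "u y / (u y + v y) = 0" if "y \<notin> ball a r" for y
  proof -
    have "r\<^sup>2 \<le> \<rho> y"
      using that assms unfolding \<rho>_def
      by (metis dist_norm dist_commute mem_ball linorder_not_le less_imp_le power2_norm_eq_inner power_mono)
    then show ?thesis by (simp add: u_def flat_def)
  qed
  moreover have "0 \<le> u y" "0 \<le> v y" for y
    by (simp_all add: u_def v_def flat_def)
  moreover have "u y / (u y + v y) \<ge> 0" "u y / (u y + v y) \<le> 1" for y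
    using \<open>0 \<le> u y\<close> \<open>0 \<le> v y\<close> pos[of y] by auto
  ultimately show ?thesis
    by (intro exI[of _ "\<lambda>y. u y / (u y + v y)"]) blast
qed

text \<open>\<open>f y - f a\<close> is the integral of the derivative of \<open>f\<close> along the
  segment from \<open>a\<close> to \<open>y\<close>. Expanding the direction \<open>y - a\<close> in
  \<open>Basis\<close> makes the coefficient of each coordinate an average of a partial derivative;
  for \<open>y = a\<close> the average is over a constant.\<close>

lemma hadamard:
  fixes f :: "'e::euclidean_space \<Rightarrow> real"
  assumes "smooth_on (ball a r) f" "r > 0"
  shows "\<exists>G :: 'e \<Rightarrow> 'e \<Rightarrow> real. \<forall>b. smooth_on (ball a r) (G b) \<and>
    G b a = frechet_derivative f (at a) b \<and>
    (\<forall>y\<in>ball a r. f y = f a + (\<Sum>b\<in>Basis. ((y - a) \<bullet> b) * G b y))"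
proof -
  define G where "G b y = integral {0..1} (\<lambda>t. frechet_derivative f (at (a + t *\<^sub>R (y - a))) b)" for b y
  have "smooth_on (ball a r) (G b)" for b
    using times_differentiable_on_integral[of _ a r "\<lambda>x. frechet_derivative f (at x) b" 0] smooth_on_frechet_derivative[OF assms(1)]
    by (simp add: smooth_on_def G_def[abs_def])
  moreover have "G b a = frechet_derivative f (at a) b" for b
    by (simp add: G_def)
  moreover have "f y = f a + (\<Sum>b\<in>Basis. ((y - a) \<bullet> b) * G b y)" if y: "y \<in> ball a r" for y
  proof -
    let ?c = "\<lambda>t::real. a + t *\<^sub>R (y - a)"
    have seg: "?c t \<in> ball a r" if "t \<in> {0..1}" for t
    proof -
      have "norm (t *\<^sub>R (y - a)) \<le> 1 * norm (y - a)"
        using that unfolding norm_scaleR by (intro mult_right_mono) auto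
      then show ?thesis using y
        by (auto simp: dist_norm norm_minus_commute)
    qed
    have D: "(f has_derivative frechet_derivative f (at (?c t))) (at (?c t))" if "t \<in> {0..1}" for t
      using smooth_on_has_derivative[OF assms(1) seg[OF that]] .
    have expand: "frechet_derivative f (at (?c t)) (y - a)
        = (\<Sum>b\<in>Basis. ((y - a) \<bullet> b) * frechet_derivative f (at (?c t)) b)" if "t \<in> {0..1}" for t
    proof -
      interpret linear "frechet_derivative f (at (?c t))"
        using D[OF that] has_derivative_linear by blast
      have "frechet_derivative f (at (?c t)) (\<Sum>b\<in>Basis. ((y - a) \<bullet> b) *\<^sub>R b)
          = (\<Sum>b\<in>Basis. ((y - a) \<bullet> b) * frechet_derivative f (at (?c t)) b)"
        by (simp add: sum scale)
      then show ?thesis by (simp add: euclidean_representation)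
    qed
    have "((\<lambda>t. frechet_derivative f (at (?c t)) (y - a)) has_integral f (?c 1) - f (?c 0)) {0..1}"
    proof (rule fundamental_theorem_of_calculus)
      fix t :: real assume t: "t \<in> {0..1}"
      have "((\<lambda>t. ?c t) has_derivative (\<lambda>s. s *\<^sub>R (y - a))) (at t)"
        by (auto intro!: derivative_eq_intros)
      from diff_chain_at[OF this D[OF t]]
      have "((\<lambda>t. f (?c t)) has_derivative (\<lambda>s. frechet_derivative f (at (?c t)) (s *\<^sub>R (y - a)))) (at t)"
        by (simp add: o_def)
      moreover have "frechet_derivative f (at (?c t)) (s *\<^sub>R (y - a))
          = s *\<^sub>R frechet_derivative f (at (?c t)) (y - a)" for s
        using linear_cmul[OF has_derivative_linear[OF D[OF t]]] .
      ultimately show "((\<lambda>t. f (?c t)) has_vector_derivative frechet_derivative f (at (?c t)) (y - a))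
          (at t within {0..1})"
        by (simp add: has_vector_derivative_def has_derivative_at_withinI)
    qed simp
    then have "f y - f a = integral {0..1} (\<lambda>t. frechet_derivative f (at (?c t)) (y - a))"
      by (simp add: integral_unique)
    also have "\<dots> = integral {0..1} (\<lambda>t. \<Sum>b\<in>Basis. ((y - a) \<bullet> b) * frechet_derivative f (at (?c t)) b)"
      by (intro integral_cong expand)
    also have "\<dots> = (\<Sum>b\<in>Basis. ((y - a) \<bullet> b) * G b y)"
    proof -
      have "(\<lambda>t. frechet_derivative f (at (?c t)) b) integrable_on {0..1}" for b
      proof (rule integrable_continuous_real)
        have "continuous_on (ball a r) (\<lambda>x. frechet_derivative f (at x) b)"
          using smooth_on_frechet_derivative[OF assms(1), of b]
            times_differentiable_on_imp_continuous_on[of 0 "ball a r"]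
          unfolding smooth_on_def by blast
        then show "continuous_on {0..1} (\<lambda>t. frechet_derivative f (at (?c t)) b)"
          by (rule continuous_on_compose2) (use seg in \<open>auto intro!: continuous_intros\<close>)
      qed
      then show ?thesis
        by (simp add: integral_sum G_def integrable_on_mult_right)
    qed
    finally show ?thesis by simp
  qed
  ultimately show ?thesis by (intro exI[of _ G]) blast
qed

section \<open>Smooth functions and vector fields on a manifold\<close>

lemma sum_fun_apply: "(\<Sum>i\<in>I. f i) q = (\<Sum>i\<in>I. f i q)"
  by (induction I rule: infinite_finite_induct) auto

locale manifold =
  fixes A :: "('a::t2_space, 'e::euclidean_space) chart set"
  assumes atlas: "smooth_atlas A"
begin

abbreviation "C \<equiv> smooth_functions A"
abbreviation "V \<equiv> vector_fields A"

lemma chart_open: "(U, x) \<in> A \<Longrightarrow> open U" "(U, x) \<in> A \<Longrightarrow> open (x ` U)"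
  and chart_homeo: "(U, x) \<in> A \<Longrightarrow> homeomorphism U (x ` U) x (inv_into U x)"
  and chart_transition: "(U, x) \<in> A \<Longrightarrow> (W, y) \<in> A \<Longrightarrow> smooth_on (x ` (U \<inter> W)) (y \<circ> inv_into U x)"
  using atlas unfolding smooth_atlas_def by auto

lemma chart_exists: obtains U x where "(U, x) \<in> A" "p \<in> U"
proof -
  have "p \<in> (\<Union>(U, x)\<in>A. U)" using atlas unfolding smooth_atlas_def by auto
  then show ?thesis using that by auto
qed

lemma chart_inv: "(U, x) \<in> A \<Longrightarrow> q \<in> U \<Longrightarrow> inv_into U x (x q) = q"
  using chart_homeo unfolding homeomorphism_def by blast

lemma chart_continuous: "(U, x) \<in> A \<Longrightarrow> continuous_on U x"
  and chart_inv_continuous: "(U, x) \<in> A \<Longrightarrow> continuous_on (x ` U) (inv_into U x)"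
  using chart_homeo unfolding homeomorphism_def by blast+

lemma chart_image_open:
  assumes "(U, x) \<in> A" "open W" shows "open (x ` (U \<inter> W))"
proof -
  have "openin (top_of_set (x ` U)) (x ` (U \<inter> W))"
    by (rule homeomorphism_imp_open_map[OF chart_homeo[OF assms(1)]])
      (simp add: assms(2) openin_open_Int)
  then show ?thesis
    using chart_open(2)[OF assms(1)] openin_open_trans by blast
qed

lemma chart_preimage_open:
  assumes "(U, x) \<in> A" "open T" shows "open {q \<in> U. x q \<in> T}"
proof -
  have "open (U \<inter> x -` T)"
    by (rule continuous_open_preimage[OF chart_continuous[OF assms(1)] chart_open(1)[OF assms(1)] assms(2)])
  then show ?thesis by (simp add: Int_def vimage_def)
qed

lemma smooth_functionsI:
  "(\<And>U x. (U, x) \<in> A \<Longrightarrow> smooth_on (x ` U) (\<lambda>y. f (inv_into U x y))) \<Longrightarrow> f \<in> C"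
  by (auto simp: smooth_functions_def o_def)

lemma smooth_functionsD:
  "f \<in> C \<Longrightarrow> (U, x) \<in> A \<Longrightarrow> smooth_on (x ` U) (\<lambda>y. f (inv_into U x y))"
  by (auto simp: smooth_functions_def o_def)

lemma smooth_const: "(\<lambda>q. c) \<in> C"
  by (intro smooth_functionsI smooth_on_const)

lemma smooth_zero [simp]: "0 \<in> C" and smooth_one [simp]: "1 \<in> C"
  using smooth_const[of 0] smooth_const[of 1] by (simp_all add: zero_fun_def one_fun_def)

lemma smooth_add [simp]: "f \<in> C \<Longrightarrow> h \<in> C \<Longrightarrow> f + h \<in> C"
  by (rule smooth_functionsI, simp, rule smooth_on_add) (simp_all add: smooth_functionsD chart_open)

lemma smooth_mult [simp]: "f \<in> C \<Longrightarrow> h \<in> C \<Longrightarrow> f * h \<in> C"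
  by (rule smooth_functionsI, simp, rule smooth_on_mult) (simp_all add: smooth_functionsD chart_open)

lemma smooth_uminus [simp]:
  assumes "f \<in> C" shows "- f \<in> C"
proof -
  have "- f = (\<lambda>q. -1) * f" by (simp add: fun_eq_iff)
  then show ?thesis using assms smooth_const by (metis smooth_mult)
qed

lemma smooth_diff [simp]: "f \<in> C \<Longrightarrow> h \<in> C \<Longrightarrow> f - h \<in> C"
  using smooth_add[of f "- h"] by simp

lemma smooth_sum: "(\<And>i. i \<in> I \<Longrightarrow> f i \<in> C) \<Longrightarrow> (\<Sum>i\<in>I. f i) \<in> C"
  by (induction I rule: infinite_finite_induct) auto

lemma smooth_divide:
  assumes "f \<in> C" "h \<in> C" "\<And>q. h q \<noteq> 0" shows "(\<lambda>q. f q / h q) \<in> C"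
  by (rule smooth_functionsI, rule smooth_on_divide) (simp_all add: assms smooth_functionsD chart_open)

lemma smooth_continuous:
  assumes "f \<in> C" shows "isCont f p"
proof -
  obtain U x where U: "(U, x) \<in> A" "p \<in> U" using chart_exists by blast
  have "continuous_on (x ` U) (\<lambda>y. f (inv_into U x y))"
    using smooth_functionsD[OF assms U(1)] times_differentiable_on_imp_continuous_on
    unfolding smooth_on_def by blast
  then have "continuous_on U (\<lambda>q. f (inv_into U x (x q)))"
    by (rule continuous_on_compose2[OF _ chart_continuous[OF U(1)]]) simp
  then have "continuous_on U f"
    by (rule continuous_on_eq) (simp add: chart_inv[OF U(1)])
  then show ?thesis
    using U chart_open continuous_on_eq_continuous_at by blast
qed

text \<open>Serves to recognise as smooth the functions that a glued vector field produces.\<close>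

lemma smooth_local:
  assumes "\<And>p. \<exists>h\<in>C. \<forall>\<^sub>F q in nhds p. f q = h q"
  shows "f \<in> C"
proof (intro smooth_functionsI smooth_on_local)
  fix U x y assume U: "(U, x) \<in> A" and y: "y \<in> x ` U"
  then obtain p where p: "p \<in> U" "y = x p" by blast
  obtain h W where h: "h \<in> C" "open W" "p \<in> W" "\<And>q. q \<in> W \<Longrightarrow> f q = h q"
    using assms[of p] unfolding eventually_nhds by blast
  have o: "open (x ` (U \<inter> W))" using chart_image_open[OF U h(2)] .
  have "smooth_on (x ` (U \<inter> W)) (\<lambda>y. h (inv_into U x y))"
    by (rule smooth_on_subset[OF smooth_functionsD[OF h(1) U]]) auto
  then have "smooth_on (x ` (U \<inter> W)) (\<lambda>y. f (inv_into U x y))"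
    by (rule smooth_on_cong[OF o, rotated]) (auto simp: chart_inv[OF U] h(4))
  then show "\<exists>T. open T \<and> y \<in> T \<and> smooth_on T (\<lambda>y. f (inv_into U x y))"
    using o p h(3) by blast
qed

section \<open>Extension by zero, cutoffs and bump functions on the manifold\<close>

text \<open>Near a point of \<open>K\<close> the transition map carries the expression
  \<open>h\<close> into any other chart; off \<open>K\<close> the function is 0 on an open set. For
  the second case \<open>K\<close> has to be closed in the whole space, not only in
  \<open>U\<close>.\<close>

lemma smooth_extend:
  assumes U: "(U, x) \<in> A" and T: "open T" and h: "smooth_on T h"
    and K: "closed K" "K \<subseteq> {q \<in> U. x q \<in> T}"
    and f: "\<And>q. q \<in> U \<Longrightarrow> x q \<in> T \<Longrightarrow> f q = h (x q)" "\<And>q. q \<notin> K \<Longrightarrow> f q = 0"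
  shows "f \<in> C"
proof (intro smooth_functionsI smooth_on_local)
  fix W y z assume W: "(W, y) \<in> A" and z: "z \<in> y ` W"
  then obtain q where q: "q \<in> W" "z = y q" by blast
  show "\<exists>T. open T \<and> z \<in> T \<and> smooth_on T (\<lambda>z. f (inv_into W y z))"
  proof (cases "q \<in> K")
    case True
    define N where "N = y ` (W \<inter> {q \<in> U. x q \<in> T})"
    have N: "open N" unfolding N_def
      by (intro chart_image_open[OF W] chart_preimage_open[OF U T])
    have "smooth_on N (x \<circ> inv_into W y)"
      by (rule smooth_on_subset[OF chart_transition[OF W U]]) (auto simp: N_def)
    then have "smooth_on N (\<lambda>z. h ((x \<circ> inv_into W y) z))"
      by (rule smooth_on_compose[OF N T _ _ h, rotated]) (auto simp: N_def chart_inv[OF W])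
    then have "smooth_on N (\<lambda>z. f (inv_into W y z))"
      by (rule smooth_on_cong[OF N, rotated]) (auto simp: N_def chart_inv[OF W] f)
    then show ?thesis
      using N True K q by (intro exI[of _ N]) (auto simp: N_def)
  next
    case False
    have N: "open (y ` (W \<inter> - K))"
      using K by (intro chart_image_open[OF W]) auto
    have "smooth_on (y ` (W \<inter> - K)) (\<lambda>z. f (inv_into W y z))"
      by (rule smooth_on_cong[OF N _ smooth_on_const[of _ 0]]) (auto simp: chart_inv[OF W] f)
    then show ?thesis
      using N False q by blast
  qed
qed

text \<open>A compact set is closed because the manifold is Hausdorff. A set closed only relative to
  \<open>U\<close> could accumulate at the boundary of \<open>U\<close>, where extension by 0 may
  break smoothness.\<close>

lemma chart_compact_image:
  assumes "(U, x) \<in> A" "cball a r \<subseteq> x ` U"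
  shows "closed (inv_into U x ` cball a r)"
  by (intro compact_imp_closed compact_continuous_image compact_cball
      continuous_on_subset[OF chart_inv_continuous[OF assms(1)]] assms)

text \<open>\<open>h\<close> may be uncontrolled near the boundary of its ball:
  \<open>\<psi>\<close> already vanishes outside radius \<open>R / 2\<close>, and the closed ball of
  that radius is compact inside the open ball of radius \<open>R\<close>.\<close>

lemma smooth_cutoff:
  assumes U: "(U, x) \<in> A" and p: "p \<in> U" and R: "0 < R" "ball (x p) R \<subseteq> x ` U"
    and \<psi>: "smooth_on UNIV \<psi>" "\<And>y. y \<notin> ball (x p) (R / 2) \<Longrightarrow> \<psi> y = 0"
    and h: "smooth_on (ball (x p) R) h"
  shows "(\<lambda>q. if q \<in> U \<and> x q \<in> ball (x p) R then \<psi> (x q) * h (x q) else 0) \<in> C"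
proof (rule smooth_extend[OF U open_ball])
  show "smooth_on (ball (x p) R) (\<lambda>y. \<psi> y * h y)"
    by (intro smooth_on_mult h smooth_on_subset[OF \<psi>(1)]) auto
  have cb: "cball (x p) (R / 2) \<subseteq> ball (x p) R" using R by (simp add: cball_subset_ball_iff)
  then show "closed (inv_into U x ` cball (x p) (R / 2))"
    using R by (intro chart_compact_image[OF U]) auto
  show "inv_into U x ` cball (x p) (R / 2) \<subseteq> {q \<in> U. x q \<in> ball (x p) R}"
    using cb R by (auto simp: inv_into_into f_inv_into_f subset_iff)
  fix q
  show "(if q \<in> U \<and> x q \<in> ball (x p) R then \<psi> (x q) * h (x q) else 0) = 0"
    if "q \<notin> inv_into U x ` cball (x p) (R / 2)"
  proof -
    have "x q \<notin> ball (x p) (R / 2)" if "q \<in> U"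
      using \<open>q \<notin> _\<close> chart_inv[OF U that] by (metis ball_subset_cball image_eqI subsetD)
    then show ?thesis using \<psi>(2) by auto
  qed
qed simp

lemma chart_ball_exists:
  assumes "p \<in> W" "open W"
  obtains U x R where "(U, x) \<in> A" "p \<in> U" "0 < R" "ball (x p) R \<subseteq> x ` (U \<inter> W)"
proof -
  obtain U x where U: "(U, x) \<in> A" "p \<in> U" using chart_exists by blast
  have "open (x ` (U \<inter> W))" using chart_image_open[OF U(1) assms(2)] .
  moreover have "x p \<in> x ` (U \<inter> W)" using U assms by blast
  ultimately show ?thesis
    using that[OF U] open_contains_ball by blast
qed

lemma eventually_chart_ball:
  assumes "(U, x) \<in> A" "p \<in> U" "0 < r"
  shows "\<forall>\<^sub>F q in nhds p. q \<in> U \<and> x q \<in> ball (x p) r"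
  unfolding eventually_nhds
  using chart_preimage_open[OF assms(1) open_ball[of "x p" r]] assms
  by (intro exI[of _ "{q \<in> U. x q \<in> ball (x p) r}"]) auto

lemma bump_exists:
  assumes "p \<in> W" "open W"
  shows "\<exists>\<beta>\<in>C. (\<forall>\<^sub>F q in nhds p. \<beta> q = 1) \<and> (\<forall>q. q \<notin> W \<longrightarrow> \<beta> q = 0) \<and> (\<forall>q. 0 \<le> \<beta> q \<and> \<beta> q \<le> 1)"
proof -
  obtain U x R where U: "(U, x) \<in> A" "p \<in> U" and R: "0 < R" "ball (x p) R \<subseteq> x ` (U \<inter> W)"
    using chart_ball_exists[OF assms] .
  obtain \<psi> :: "'e \<Rightarrow> real" where \<psi>: "smooth_on UNIV \<psi>" "\<And>y. y \<in> cball (x p) (R / 2 / 2) \<Longrightarrow> \<psi> y = 1"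
    "\<And>y. y \<notin> ball (x p) (R / 2) \<Longrightarrow> \<psi> y = 0" "\<And>y. 0 \<le> \<psi> y" "\<And>y. \<psi> y \<le> 1"
    using smooth_bump_euclidean[OF half_gt_zero[OF R(1)], of "x p"] by blast
  define \<beta> where "\<beta> q = (if q \<in> U \<and> x q \<in> ball (x p) R then \<psi> (x q) * 1 else 0)" for q
  have "\<beta> \<in> C"
    unfolding \<beta>_def using R
    by (intro smooth_cutoff[OF U] \<psi> smooth_on_const) auto
  moreover have "\<forall>\<^sub>F q in nhds p. \<beta> q = 1"
    using eventually_chart_ball[OF U, of "R / 2 / 2"] R
    by (auto elim!: eventually_mono simp: \<beta>_def \<psi>(2))
  moreover have "\<beta> q = 0" if "q \<notin> W" for q
  proof -
    have "x q \<notin> ball (x p) R" if "q \<in> U"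
      using R(2) \<open>q \<notin> W\<close> that chart_inv[OF U(1)] by (metis IntD1 IntD2 imageE subsetD)
    then show ?thesis by (auto simp: \<beta>_def)
  qed
  ultimately show ?thesis
    using \<psi>(4,5) by (intro bexI[of _ \<beta>]) (auto simp: \<beta>_def)
qed

text \<open>The denominator \<open>d = h * h + (1 - \<beta>)\<close> is positive everywhere:
  \<open>\<beta>\<close> is at most 1, and it vanishes where \<open>h\<close> does. Near
  \<open>p\<close>, where \<open>\<beta>\<close> is 1, the quotient \<open>h / d\<close> is the
  reciprocal of \<open>h\<close>.\<close>

lemma local_reciprocal:
  assumes "h \<in> C" "h p \<noteq> 0"
  obtains k where "k \<in> C" "\<forall>\<^sub>F q in nhds p. k q * h q = 1"
proof -
  have "open {q. h q \<noteq> 0}"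
    using assms(1) smooth_continuous
    by (intro open_Collect_neq continuous_at_imp_continuous_on continuous_on_const) auto
  with assms(2) obtain \<beta> where \<beta>: "\<beta> \<in> C" "\<forall>\<^sub>F q in nhds p. \<beta> q = 1"
    "\<And>q. h q = 0 \<Longrightarrow> \<beta> q = 0" "\<And>q. \<beta> q \<le> 1"
    using bump_exists[of p "{q. h q \<noteq> 0}"] by auto
  define d where "d = h * h + (1 - \<beta>)"
  have "d \<in> C" using assms(1) \<beta>(1) by (simp add: d_def)
  moreover have "d q \<noteq> 0" for q
  proof (cases "h q = 0")
    case False
    then have "0 < h q * h q" using zero_less_mult_iff by force
    then show ?thesis using \<beta>(4)[of q] by (simp add: d_def)
  qed (simp add: d_def \<beta>(3))
  ultimately have k: "(\<lambda>q. h q / d q) \<in> C"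
    by (intro smooth_divide assms(1))
  have "\<forall>\<^sub>F q in nhds p. h q \<noteq> 0"
    using eventually_nhds_in_open[OF \<open>open {q. h q \<noteq> 0}\<close>, of p] assms(2) by simp
  then have "\<forall>\<^sub>F q in nhds p. h q / d q * h q = 1"
    using \<beta>(2) by eventually_elim (simp add: d_def)
  with k show ?thesis by (rule that)
qed

section \<open>Vector fields as derivations, and their locality\<close>

lemma vf_smooth [simp]: "X \<in> V \<Longrightarrow> f \<in> C \<Longrightarrow> X f \<in> C"
  and vf_add [simp]: "X \<in> V \<Longrightarrow> f \<in> C \<Longrightarrow> h \<in> C \<Longrightarrow> X (f + h) = X f + X h"
  and vf_scale: "X \<in> V \<Longrightarrow> f \<in> C \<Longrightarrow> X (\<lambda>p. c * f p) = (\<lambda>p. c * X f p)"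
  and vf_mult [simp]: "X \<in> V \<Longrightarrow> f \<in> C \<Longrightarrow> h \<in> C \<Longrightarrow> X (f * h) = f * X h + h * X f"
  and vf_nonsmooth: "X \<in> V \<Longrightarrow> f \<notin> C \<Longrightarrow> X f = 0"
  by (auto simp: vector_fields_def)

lemma vector_fieldsI:
  assumes "\<And>f. f \<in> C \<Longrightarrow> X f \<in> C"
    and "\<And>f h. f \<in> C \<Longrightarrow> h \<in> C \<Longrightarrow> X (f + h) = X f + X h"
    and "\<And>c f. f \<in> C \<Longrightarrow> X (\<lambda>p. c * f p) = (\<lambda>p. c * X f p)"
    and "\<And>f h. f \<in> C \<Longrightarrow> h \<in> C \<Longrightarrow> X (f * h) = f * X h + h * X f"
    and "\<And>f. f \<notin> C \<Longrightarrow> X f = 0"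
  shows "X \<in> V"
  unfolding vector_fields_def by (intro CollectI conjI ballI allI impI assms)

lemma vf_zero [simp]: "X \<in> V \<Longrightarrow> X 0 = 0"
  using vf_add[of X 0 0] by simp

lemma vf_one [simp]: "X \<in> V \<Longrightarrow> X 1 = 0"
  using vf_mult[of X 1 1] by simp

lemma vf_const: "X \<in> V \<Longrightarrow> X (\<lambda>q. c) = 0"
  using vf_scale[of X 1 c] by (simp add: zero_fun_def)

lemma vf_uminus [simp]: "X \<in> V \<Longrightarrow> f \<in> C \<Longrightarrow> X (- f) = - X f"
  using vf_scale[of X f "-1"] by (simp add: fun_Compl_def)

lemma vf_diff [simp]: "X \<in> V \<Longrightarrow> f \<in> C \<Longrightarrow> h \<in> C \<Longrightarrow> X (f - h) = X f - X h"
  using vf_add[of X f "- h"] vf_uminus[of X h] smooth_uminus[of h] by (simp only: diff_conv_add_uminus)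

lemma vf_sum: "X \<in> V \<Longrightarrow> (\<And>i. i \<in> I \<Longrightarrow> f i \<in> C) \<Longrightarrow> X (\<Sum>i\<in>I. f i) = (\<Sum>i\<in>I. X (f i))"
  by (induction I rule: infinite_finite_induct) (auto simp: smooth_sum)

lemma zero_vf [simp]: "0 \<in> V"
  by (rule vector_fieldsI) (auto simp: fun_eq_iff)

lemma add_vf [simp]: "X \<in> V \<Longrightarrow> Y \<in> V \<Longrightarrow> X + Y \<in> V"
  by (rule vector_fieldsI) (auto simp: vf_scale vf_nonsmooth algebra_simps fun_eq_iff)

lemma fsmult_vf [simp]: "f \<in> C \<Longrightarrow> X \<in> V \<Longrightarrow> fsmult f X \<in> V"
  by (rule vector_fieldsI) (auto simp: fsmult_def vf_scale vf_nonsmooth algebra_simps fun_eq_iff)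

lemma uminus_eq_fsmult: "- X = fsmult (- 1) X"
  by (simp add: fsmult_def fun_eq_iff)

lemma uminus_vf [simp]: "X \<in> V \<Longrightarrow> - X \<in> V"
  by (simp add: uminus_eq_fsmult)

lemma diff_vf [simp]: "X \<in> V \<Longrightarrow> Y \<in> V \<Longrightarrow> X - Y \<in> V"
  using add_vf[of X "- Y"] by simp

lemma sum_vf: "(\<And>i. i \<in> I \<Longrightarrow> X i \<in> V) \<Longrightarrow> (\<Sum>i\<in>I. X i) \<in> V"
  by (induction I rule: infinite_finite_induct) auto

lemma bracket_vf [simp]:
  assumes X: "X \<in> V" and Y: "Y \<in> V" shows "bracket X Y \<in> V"
proof (rule vector_fieldsI, unfold bracket_def)
  note XY = assms vf_smooth[OF X] vf_smooth[OF Y]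
  fix f assume f: "f \<in> C"
  show "X (Y f) - Y (X f) \<in> C" by (intro smooth_diff XY f)
  show "X (Y (\<lambda>p. c * f p)) - Y (X (\<lambda>p. c * f p)) = (\<lambda>p. c * (X (Y f) - Y (X f)) p)" for c
    by (simp only: vf_scale XY f) (simp add: fun_eq_iff algebra_simps)
  fix h assume h: "h \<in> C"
  show "X (Y (f + h)) - Y (X (f + h)) = X (Y f) - Y (X f) + (X (Y h) - Y (X h))"
    by (simp only: vf_add XY f h) (simp add: fun_eq_iff)
  show "X (Y (f * h)) - Y (X (f * h)) = f * (X (Y h) - Y (X h)) + h * (X (Y f) - Y (X f))"
    by (simp only: vf_add vf_mult smooth_mult XY f h) (rule ext, simp add: algebra_simps)
next
  fix f assume f: "f \<notin> C"
  show "X (Y f) - Y (X f) = 0"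
    by (simp only: vf_nonsmooth[OF X f] vf_nonsmooth[OF Y f] vf_zero[OF X] vf_zero[OF Y] diff_self)
qed

text \<open>A bump function times \<open>f - h\<close> is identically 0. The Leibniz rule at
  \<open>p\<close> then leaves only \<open>X (f - h) p\<close>, since \<open>\<beta> p = 1\<close>
  and \<open>f p = h p\<close>.\<close>

lemma vf_local:
  assumes X: "X \<in> V" and f: "f \<in> C" and h: "h \<in> C" and eq: "\<forall>\<^sub>F q in nhds p. f q = h q"
  shows "X f p = X h p"
proof -
  obtain W where W: "open W" "p \<in> W" "\<And>q. q \<in> W \<Longrightarrow> f q = h q"
    using eq unfolding eventually_nhds by blast
  obtain \<beta> where \<beta>: "\<beta> \<in> C" "\<forall>\<^sub>F q in nhds p. \<beta> q = 1" "\<And>q. q \<notin> W \<Longrightarrow> \<beta> q = 0"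
    using bump_exists[OF W(2,1)] by blast
  have "\<beta> * (f - h) = 0"
    using W(3) \<beta>(3) by (auto simp: fun_eq_iff)
  then have "X (\<beta> * (f - h)) p = 0" using X by simp
  then show ?thesis
    using W \<beta> X f h eventually_nhds_x_imp_x[OF \<beta>(2)] by simp
qed

text \<open>A bump function times \<open>X\<close> is the zero field, and linearity over smooth
  functions moves the bump function out of \<open>\<omega>\<close>. On functions that are not smooth
  \<open>X\<close> is 0 by convention, so the equality of fields really holds in HOL.\<close>

lemma one_form_local:
  assumes \<omega>: "one_form A \<omega>" and X: "X \<in> V"
    and eq: "\<forall>\<^sub>F q in nhds p. \<forall>f\<in>C. X f q = 0"
  shows "\<omega> X p = 0"
proof -
  obtain W where W: "open W" "p \<in> W" "\<And>q f. q \<in> W \<Longrightarrow> f \<in> C \<Longrightarrow> X f q = 0"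
    using eq unfolding eventually_nhds by blast
  obtain \<beta> where \<beta>: "\<beta> \<in> C" "\<forall>\<^sub>F q in nhds p. \<beta> q = 1" "\<And>q. q \<notin> W \<Longrightarrow> \<beta> q = 0"
    using bump_exists[OF W(2,1)] by blast
  have "(fsmult \<beta> X) f q = 0" for f q
    using W(3) \<beta>(3) vf_nonsmooth[OF X, of f] by (cases "f \<in> C"; cases "q \<in> W") (auto simp: fsmult_def)
  then have "fsmult \<beta> X = fsmult 0 X" by (simp add: fsmult_def fun_eq_iff)
  then have "\<beta> * \<omega> X = 0 * \<omega> X"
    using \<omega> X \<beta>(1) unfolding one_form_def by (metis smooth_zero)
  then have "\<beta> p * \<omega> X p = 0" by (simp add: fun_eq_iff)
  then show ?thesis using eventually_nhds_x_imp_x[OF \<beta>(2)] by simp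
qed

section \<open>Local coordinate frames\<close>

lemma coordinate_field:
  assumes U: "(U, x) \<in> A" and p: "p \<in> U" and R: "0 < R" "ball (x p) R \<subseteq> x ` U"
    and \<psi>: "smooth_on UNIV \<psi>" "\<And>y. y \<notin> ball (x p) (R / 2) \<Longrightarrow> \<psi> y = 0"
  shows "(\<lambda>f. if f \<in> C then (\<lambda>q. if q \<in> U \<and> x q \<in> ball (x p) R
      then \<psi> (x q) * frechet_derivative (\<lambda>y. f (inv_into U x y)) (at (x q)) b else 0) else 0) \<in> V"
    (is "?E \<in> V")
proof (rule vector_fieldsI)
  let ?D = "\<lambda>f q. frechet_derivative (\<lambda>y. f (inv_into U x y)) (at (x q))"
  have D: "((\<lambda>y. f (inv_into U x y)) has_derivative ?D f q) (at (x q))" if "f \<in> C" "q \<in> U" for f q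
    by (rule smooth_on_has_derivative[OF smooth_functionsD[OF that(1) U]]) (use that in blast)
  show "?E f \<in> C" if "f \<in> C" for f
    using that
    by (subst if_P[OF that], intro smooth_cutoff[OF U p R \<psi>] smooth_on_frechet_derivative
        smooth_on_subset[OF smooth_functionsD[OF that U]] R) auto
  fix f h assume f: "f \<in> C" and h: "h \<in> C"
  have "?D (f + h) q b = ?D f q b + ?D h q b" if "q \<in> U" for q
    using fun_cong[OF frechet_derivative_at[OF has_derivative_add[OF D[OF f that] D[OF h that]]], of b]
    by simp
  then show "?E (f + h) = ?E f + ?E h"
    using f h by (auto simp: fun_eq_iff algebra_simps)
  have "?D (f * h) q b = f q * ?D h q b + h q * ?D f q b" if "q \<in> U" for q
    using fun_cong[OF frechet_derivative_at[OF has_derivative_mult[OF D[OF f that] D[OF h that]]], of b]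
    by (simp add: chart_inv[OF U that] mult.commute)
  then show "?E (f * h) = f * ?E h + h * ?E f"
    using f h by (auto simp: fun_eq_iff algebra_simps)
next
  let ?D = "\<lambda>f q. frechet_derivative (\<lambda>y. f (inv_into U x y)) (at (x q))"
  fix c :: real and f assume f: "f \<in> C"
  have D: "((\<lambda>y. f (inv_into U x y)) has_derivative ?D f q) (at (x q))" if "q \<in> U" for q
    by (rule smooth_on_has_derivative[OF smooth_functionsD[OF f U]]) (use that in blast)
  have "(\<lambda>p. c * f p) \<in> C"
    using smooth_mult[OF smooth_const[of c] f] by (simp add: times_fun_def)
  moreover have "?D (\<lambda>p. c * f p) q b = c * ?D f q b" if "q \<in> U" for q
    by (simp flip: frechet_derivative_at[OF has_derivative_mult_right[OF D[OF that]]])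
  ultimately show "?E (\<lambda>p. c * f p) = (\<lambda>p. c * ?E f p)"
    using f by (auto simp: fun_eq_iff algebra_simps)
qed simp

text \<open>\<open>E\<close> consists of the coordinate derivations and \<open>\<xi>\<close> of the
  coordinate functions, both cut off. Hadamard's lemma at \<open>q\<close> writes \<open>f\<close>
  near \<open>q\<close> as a constant plus a sum of products
  \<open>(\<xi> b - \<xi> b q) * H b\<close>; a derivation kills the constant, and the Leibniz rule
  at \<open>q\<close> leaves \<open>Z (\<xi> b) q * H b q\<close>. The expansion is proved at every
  \<open>q\<close> near \<open>p\<close>, because the locality of 1-forms compares fields on
  neighbourhoods.\<close>

lemma local_frame:
  "\<exists>(E :: 'e \<Rightarrow> 'a vfield) (\<xi> :: 'e \<Rightarrow> 'a \<Rightarrow> real). (\<forall>b. E b \<in> V) \<and> (\<forall>b. \<xi> b \<in> C) \<and>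
    (\<forall>b\<in>Basis. \<forall>c\<in>Basis. E b (\<xi> c) p = (if b = c then 1 else 0)) \<and>
    (\<forall>\<^sub>F q in nhds p. \<forall>Z\<in>V. \<forall>f\<in>C. Z f q = (\<Sum>b\<in>Basis. Z (\<xi> b) q * E b f q))"
proof -
  obtain U x R where U: "(U, x) \<in> A" and p: "p \<in> U" and R: "0 < R" "ball (x p) R \<subseteq> x ` (U \<inter> UNIV)"
    using chart_ball_exists[OF UNIV_I open_UNIV, of p] .
  have R': "ball (x p) R \<subseteq> x ` U" using R by simp
  obtain \<psi> :: "'e \<Rightarrow> real" where \<psi>: "smooth_on UNIV \<psi>" "\<And>y. y \<in> cball (x p) (R / 2 / 2) \<Longrightarrow> \<psi> y = 1"
    "\<And>y. y \<notin> ball (x p) (R / 2) \<Longrightarrow> \<psi> y = 0"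
    using smooth_bump_euclidean[OF half_gt_zero[OF R(1)], of "x p"] by blast
  \<comment> \<open>The radius \<open>R / 4\<close> is the one within which the cutoff
    \<open>\<psi>\<close> is known to be 1, so that on \<open>N\<close> the cut-off objects are the
    true coordinates.\<close>
  define N where "N = {q \<in> U. x q \<in> ball (x p) (R / 4)}"
  have N1: "\<psi> (x q) = 1" "x q \<in> ball (x p) R" "q \<in> U" if "q \<in> N" for q
    using that \<psi>(2)[of "x q"] R by (auto simp: N_def)
  have evN: "\<forall>\<^sub>F q' in nhds q. q' \<in> N" if "q \<in> N" for q
    using eventually_nhds_in_open[OF chart_preimage_open[OF U open_ball, of "x p" "R / 4"], of q] that
    unfolding N_def by blast
  define E where "E b = (\<lambda>f. if f \<in> C then (\<lambda>q. if q \<in> U \<and> x q \<in> ball (x p) R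
      then \<psi> (x q) * frechet_derivative (\<lambda>y. f (inv_into U x y)) (at (x q)) b else 0) else 0)" for b
  define \<xi> where "\<xi> b = (\<lambda>q. if q \<in> U \<and> x q \<in> ball (x p) R then \<psi> (x q) * (x q \<bullet> b) else 0)" for b
  have E: "E b \<in> V" for b
    unfolding E_def by (rule coordinate_field[OF U p R(1) R' \<psi>(1,3)])
  have \<xi>: "\<xi> b \<in> C" for b
    unfolding \<xi>_def
    by (intro smooth_cutoff[OF U p R(1) R' \<psi>(1,3)]
        smooth_on_bounded_linear_compose[OF _ bounded_linear_inner_left] smooth_on_id) auto
  have E_N: "E b f q = frechet_derivative (\<lambda>y. f (inv_into U x y)) (at (x q)) b"
    if "f \<in> C" "q \<in> N" for b f q
    using that N1[OF that(2)] by (simp add: E_def)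
  have \<xi>_N: "\<xi> b q = x q \<bullet> b" if "q \<in> N" for b q
    using N1[OF that] by (simp add: \<xi>_def)
  have pN: "p \<in> N" using p R by (simp add: N_def)
  have Exi: "E b (\<xi> c) p = (if b = c then 1 else 0)" if "b \<in> Basis" "c \<in> Basis" for b c
  proof -
    have "((\<lambda>y. \<xi> c (inv_into U x y)) has_derivative (\<lambda>v. v \<bullet> c)) (at (x p))"
    proof (rule has_derivative_transform_within_open[OF _ open_ball])
      show "((\<lambda>y. y \<bullet> c) has_derivative (\<lambda>v. v \<bullet> c)) (at (x p))"
        by (auto intro!: derivative_eq_intros)
      show "x p \<in> ball (x p) (R / 4)" using R by simp
      fix y assume y: "y \<in> ball (x p) (R / 4)"
      then have "y \<in> ball (x p) R" using R by auto
      then obtain q where "q \<in> U" "y = x q" using R' by blast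
      then show "y \<bullet> c = \<xi> c (inv_into U x y)"
        using y by (simp add: chart_inv[OF U] \<xi>_N N_def)
    qed
    then show ?thesis
      using frechet_derivative_at that by (metis E_N \<xi> pN inner_Basis)
  qed
  have exp: "Z f q = (\<Sum>b\<in>Basis. Z (\<xi> b) q * E b f q)"
    if q: "q \<in> N" and Z: "Z \<in> V" and f: "f \<in> C" for q Z f
  proof -
    have "open (x ` (U \<inter> N))"
      using chart_image_open[OF U chart_preimage_open[OF U open_ball]] unfolding N_def by blast
    moreover have "x q \<in> x ` (U \<inter> N)" using q N1 by blast
    ultimately obtain s where s: "0 < s" "ball (x q) s \<subseteq> x ` (U \<inter> N)"
      using open_contains_ball by blast
    have s': "ball (x q) s \<subseteq> x ` U" using s by blast
    have qU: "q \<in> U" using N1 q by blast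
    have sm: "smooth_on (ball (x q) s) (\<lambda>y. f (inv_into U x y))"
      by (rule smooth_on_subset[OF smooth_functionsD[OF f U] s'])
    obtain G :: "'e \<Rightarrow> 'e \<Rightarrow> real" where G: "\<And>b. smooth_on (ball (x q) s) (G b)"
      "\<And>b. G b (x q) = frechet_derivative (\<lambda>y. f (inv_into U x y)) (at (x q)) b"
      "\<And>y. y \<in> ball (x q) s \<Longrightarrow> f (inv_into U x y) = f (inv_into U x (x q))
          + (\<Sum>b\<in>Basis. ((y - x q) \<bullet> b) * G b y)"
      using hadamard[OF sm s(1)] by blast
    obtain \<kappa> :: "'e \<Rightarrow> real" where \<kappa>: "smooth_on UNIV \<kappa>" "\<And>y. y \<in> cball (x q) (s / 2 / 2) \<Longrightarrow> \<kappa> y = 1"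
      "\<And>y. y \<notin> ball (x q) (s / 2) \<Longrightarrow> \<kappa> y = 0"
      using smooth_bump_euclidean[OF half_gt_zero[OF s(1)], of "x q"] by blast
    define H where "H b = (\<lambda>q'. if q' \<in> U \<and> x q' \<in> ball (x q) s then \<kappa> (x q') * G b (x q') else 0)" for b
    have H: "H b \<in> C" for b
      unfolding H_def by (rule smooth_cutoff[OF U qU s(1) s' \<kappa>(1,3) G(1)])
    have Hq: "H b q = E b f q" for b
      using s(1) \<kappa>(2)[of "x q"] qU by (simp add: H_def G(2) E_N[OF f q])
    \<comment> \<open>The constant subtracted from \<open>\<xi> b\<close> is its value at
      \<open>q\<close>, so the first factor of each product vanishes there. The cutoff
      \<open>\<kappa>\<close> has made \<open>H\<close> global, so that \<open>Z\<close> can be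
      applied to \<open>F\<close>.\<close>
    define F where "F = (\<lambda>_. f q) + (\<Sum>b\<in>Basis. (\<xi> b - (\<lambda>_. x q \<bullet> b)) * H b)"
    have "\<forall>\<^sub>F q' in nhds q. f q' = F q'"
      using eventually_chart_ball[OF U qU half_gt_zero[OF half_gt_zero[OF s(1)]]] evN[OF q]
    proof (eventually_elim)
      case (elim q')
      then have b: "x q' \<in> ball (x q) s" and c: "\<kappa> (x q') = 1"
        using s(1) by (auto simp: \<kappa>(2))
      show ?case
        using G(3)[OF b] elim c b
        by (simp add: chart_inv[OF U] qU F_def H_def sum_fun_apply \<xi>_N inner_diff_left)
    qed
    moreover have F: "F \<in> C"
      unfolding F_def by (intro smooth_add smooth_sum smooth_mult smooth_diff \<xi> H smooth_const)
    ultimately have "Z f q = Z F q" by (intro vf_local Z f)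
    also have "\<dots> = (\<Sum>b\<in>Basis. Z (\<xi> b) q * H b q)"
      unfolding F_def using Z \<xi> H \<xi>_N[OF q]
      by (simp add: vf_sum smooth_sum smooth_const vf_const sum_fun_apply mult.commute)
    finally show ?thesis by (simp add: Hq)
  qed
  have "\<forall>\<^sub>F q in nhds p. \<forall>Z\<in>V. \<forall>f\<in>C. Z f q = (\<Sum>b\<in>Basis. Z (\<xi> b) q * E b f q)"
    using evN[OF pN] by eventually_elim (intro ballI, rule exp)
  then show ?thesis
    using E \<xi> Exi by (intro exI[of _ E] exI[of _ \<xi>]) simp
qed

end

section \<open>The Riesz isomorphism\<close>

context manifold
begin

text \<open>Gaussian elimination: the pivot is the Schur complement of the block already solved.\<close>

lemma local_linear_system:
  fixes G :: "'i \<Rightarrow> 'i \<Rightarrow> 'a \<Rightarrow> real"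
  assumes "finite S" "\<And>b d. b \<in> S \<Longrightarrow> d \<in> S \<Longrightarrow> G b d \<in> C"
    and "\<And>u. \<exists>b\<in>S. u b \<noteq> 0 \<Longrightarrow> (\<Sum>b\<in>S. \<Sum>d\<in>S. u b * u d * G b d p) > 0"
    and "\<And>d. d \<in> S \<Longrightarrow> a d \<in> C"
  shows "\<exists>c. (\<forall>b\<in>S. c b \<in> C) \<and> (\<forall>\<^sub>F q in nhds p. \<forall>d\<in>S. (\<Sum>b\<in>S. c b q * G b d q) = a d q)"
  using assms
proof (induction S arbitrary: a rule: finite_induct)
  case (insert s S)
  have pos: "(\<Sum>b\<in>S. \<Sum>d\<in>S. u b * u d * G b d p) > 0" if "\<exists>b\<in>S. u b \<noteq> 0" for u
  proof -
    \<comment> \<open>Extension by 0 in the new index: the quadratic form of a principal block is a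
      restriction of the whole form.\<close>
    let ?u = "u(s := 0)"
    have eq: "?u b = u b" if "b \<in> S" for b using that insert.hyps by auto
    have "(\<Sum>b\<in>insert s S. \<Sum>d\<in>insert s S. ?u b * ?u d * G b d p) > 0"
      using that by (intro insert.prems(2)) (metis eq insertCI)
    also have "(\<Sum>b\<in>insert s S. \<Sum>d\<in>insert s S. ?u b * ?u d * G b d p)
        = (\<Sum>b\<in>S. \<Sum>d\<in>S. ?u b * ?u d * G b d p)"
      using insert.hyps by simp
    also have "\<dots> = (\<Sum>b\<in>S. \<Sum>d\<in>S. u b * u d * G b d p)"
      by (intro sum.cong refl) (simp only: eq)
    finally show ?thesis .
  qed
  have IH: "\<exists>c. (\<forall>b\<in>S. c b \<in> C) \<and> (\<forall>\<^sub>F q in nhds p. \<forall>d\<in>S. (\<Sum>b\<in>S. c b q * G b d q) = a d q)"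
    if "\<And>d. d \<in> S \<Longrightarrow> a d \<in> C" for a
    by (rule insert.IH[OF insert.prems(1) pos that]) auto
  obtain u where u: "\<And>b. b \<in> S \<Longrightarrow> u b \<in> C"
    "\<forall>\<^sub>F q in nhds p. \<forall>d\<in>S. (\<Sum>b\<in>S. u b q * G b d q) = G s d q"
    using IH[of "G s"] insert.prems(1) by blast
  obtain v where v: "\<And>b. b \<in> S \<Longrightarrow> v b \<in> C"
    "\<forall>\<^sub>F q in nhds p. \<forall>d\<in>S. (\<Sum>b\<in>S. v b q * G b d q) = a d q"
    using IH[of a] insert.prems(3) by blast
  define \<sigma> where "\<sigma> = G s s - (\<Sum>b\<in>S. u b * G b s)"
  have \<sigma>: "\<sigma> \<in> C"
    unfolding \<sigma>_def using insert.prems(1) u(1) by (intro smooth_diff smooth_sum smooth_mult) auto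
  have "\<sigma> p > 0"
  proof -
    \<comment> \<open>At the vector with entry 1 at \<open>s\<close> and \<open>- u\<close>
      elsewhere the quadratic form takes the value \<open>\<sigma> p\<close>; thus positivity of the
      form makes the pivot positive.\<close>
    define w where "w = (\<lambda>b. - u b p)(s := 1)"
    have w: "w b = - u b p" if "b \<in> S" for b using that insert.hyps by (auto simp: w_def)
    have ws: "w s = 1" by (simp add: w_def)
    have up: "(\<Sum>b\<in>S. u b p * G b d p) = G s d p" if "d \<in> S" for d
      using eventually_nhds_x_imp_x[OF u(2)] that by blast
    have "0 < (\<Sum>b\<in>insert s S. \<Sum>d\<in>insert s S. w b * w d * G b d p)"
      by (intro insert.prems(2)) (auto simp: ws)
    also have "\<dots> = (\<Sum>d\<in>insert s S. w d * G s d p) + (\<Sum>b\<in>S. \<Sum>d\<in>insert s S. - u b p * w d * G b d p)"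
      using insert.hyps by (simp add: ws w cong: sum.cong)
    also have "(\<Sum>b\<in>S. \<Sum>d\<in>insert s S. - u b p * w d * G b d p)
        = (\<Sum>b\<in>S. - u b p * G b s p) + (\<Sum>b\<in>S. \<Sum>d\<in>S. u b p * u d p * G b d p)"
      using insert.hyps by (simp add: ws w sum.distrib sum_subtractf sum_negf cong: sum.cong)
    also have "(\<Sum>b\<in>S. \<Sum>d\<in>S. u b p * u d p * G b d p) = (\<Sum>d\<in>S. u d p * (\<Sum>b\<in>S. u b p * G b d p))"
      by (subst sum.swap) (simp add: sum_distrib_left mult_ac)
    also have "\<dots> = (\<Sum>d\<in>S. u d p * G s d p)"
      by (simp add: up cong: sum.cong)
    also have "(\<Sum>d\<in>insert s S. w d * G s d p) = G s s p - (\<Sum>d\<in>S. u d p * G s d p)"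
      using insert.hyps by (simp add: ws w sum_negf cong: sum.cong)
    finally show ?thesis
      by (simp add: \<sigma>_def sum_fun_apply sum_negf)
  qed
  then obtain k where k: "k \<in> C" "\<forall>\<^sub>F q in nhds p. k q * \<sigma> q = 1"
    using local_reciprocal[OF \<sigma>] by (metis less_irrefl)
  \<comment> \<open>\<open>cs\<close> is forced by equation \<open>s\<close>. Subtracting
    \<open>cs * u b\<close> from \<open>v b\<close> compensates the contribution of the new unknown
    to the other equations, by the choice of \<open>u\<close>.\<close>
  define cs where "cs = k * (a s - (\<Sum>b\<in>S. v b * G b s))"
  define c where "c = (\<lambda>b. v b - cs * u b)(s := cs)"
  have cs: "cs \<in> C"
    unfolding cs_def using k v(1) insert.prems by (intro smooth_mult smooth_diff smooth_sum) auto
  have cS: "c b = v b - cs * u b" if "b \<in> S" for b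
    using that insert.hyps by (auto simp: c_def)
  have css: "c s = cs" by (simp add: c_def)
  have "\<forall>b\<in>insert s S. c b \<in> C"
    using cs u(1) v(1) by (auto simp: css cS)
  moreover have "\<forall>\<^sub>F q in nhds p. \<forall>d\<in>insert s S. (\<Sum>b\<in>insert s S. c b q * G b d q) = a d q"
    using u(2) v(2) k(2)
  proof eventually_elim
    case (elim q)
    have split: "(\<Sum>b\<in>insert s S. c b q * G b d q)
        = cs q * G s d q + ((\<Sum>b\<in>S. v b q * G b d q) - cs q * (\<Sum>b\<in>S. u b q * G b d q))" for d
      using insert.hyps
      by (simp add: cS css left_diff_distrib sum_subtractf sum_distrib_left mult.assoc cong: sum.cong)
    have "(\<Sum>b\<in>insert s S. c b q * G b d q) = a d q" if "d \<in> S" for d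
      unfolding split using elim that by simp
    moreover have "(\<Sum>b\<in>insert s S. c b q * G b s q) = a s q"
    proof -
      have "(\<Sum>b\<in>insert s S. c b q * G b s q) = cs q * \<sigma> q + (\<Sum>b\<in>S. v b q * G b s q)"
        unfolding split by (simp add: \<sigma>_def sum_fun_apply algebra_simps)
      also have "cs q * \<sigma> q = (k q * \<sigma> q) * (a s q - (\<Sum>b\<in>S. v b q * G b s q))"
        by (simp add: cs_def sum_fun_apply)
      finally show ?thesis using elim by simp
    qed
    ultimately show ?case by blast
  qed
  ultimately show ?case by blast
qed simp

lemma one_form_smooth: "one_form A \<omega> \<Longrightarrow> X \<in> V \<Longrightarrow> \<omega> X \<in> C"
  and one_form_add: "one_form A \<omega> \<Longrightarrow> X \<in> V \<Longrightarrow> Y \<in> V \<Longrightarrow> \<omega> (X + Y) = \<omega> X + \<omega> Y"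
  and one_form_fsmult: "one_form A \<omega> \<Longrightarrow> f \<in> C \<Longrightarrow> X \<in> V \<Longrightarrow> \<omega> (fsmult f X) = f * \<omega> X"
  unfolding one_form_def by auto

lemma one_form_zero: "one_form A \<omega> \<Longrightarrow> \<omega> 0 = 0"
  using one_form_add[of \<omega> 0 0] by simp

lemma one_form_uminus: "one_form A \<omega> \<Longrightarrow> X \<in> V \<Longrightarrow> \<omega> (- X) = - \<omega> X"
  using one_form_fsmult[of \<omega> "- 1" X] by (simp add: uminus_eq_fsmult)

lemma one_form_diff: "one_form A \<omega> \<Longrightarrow> X \<in> V \<Longrightarrow> Y \<in> V \<Longrightarrow> \<omega> (X - Y) = \<omega> X - \<omega> Y"
  using one_form_add[of \<omega> X "- Y"] one_form_uminus[of \<omega> Y] uminus_vf[of Y]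
  by (simp only: diff_conv_add_uminus)

lemma one_form_sum:
  "one_form A \<omega> \<Longrightarrow> (\<And>i. i \<in> I \<Longrightarrow> X i \<in> V) \<Longrightarrow> \<omega> (\<Sum>i\<in>I. X i) = (\<Sum>i\<in>I. \<omega> (X i))"
  by (induction I rule: infinite_finite_induct) (auto simp: one_form_zero one_form_add sum_vf)

text \<open>The difference of \<open>Z\<close> and its frame expansion vanishes near
  \<open>q\<close>, so every 1-form kills it at \<open>q\<close>. This requires the expansion on a
  neighbourhood of each such \<open>q\<close>, which \<open>eventually_eventually\<close>
  supplies.\<close>

lemma one_form_local_frame:
  assumes E: "\<And>b. E b \<in> V" and \<xi>: "\<And>b. \<xi> b \<in> C"
    and exp: "\<forall>\<^sub>F q in nhds p. \<forall>Z\<in>V. \<forall>f\<in>C. Z f q = (\<Sum>b\<in>Basis. Z (\<xi> b) q * E b f q)"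
  shows "\<forall>\<^sub>F q in nhds p. \<forall>\<omega> Z. one_form A \<omega> \<longrightarrow> Z \<in> V \<longrightarrow>
    \<omega> Z q = (\<Sum>b\<in>(Basis :: 'e set). Z (\<xi> b) q * \<omega> (E b) q)"
proof -
  have "\<forall>\<^sub>F q in nhds p. \<forall>\<^sub>F q in nhds q.
      \<forall>Z\<in>V. \<forall>f\<in>C. Z f q = (\<Sum>b\<in>(Basis :: 'e set). Z (\<xi> b) q * E b f q)"
    using exp by (simp only: eventually_eventually)
  then show ?thesis
  proof eventually_elim
    case (elim q)
    show ?case
    proof (intro allI impI)
      fix \<omega> Z assume \<omega>: "one_form A \<omega>" and Z: "Z \<in> V"
      define S where "S = (\<Sum>b\<in>(Basis :: 'e set). fsmult (Z (\<xi> b)) (E b))"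
      have fV: "fsmult (Z (\<xi> b)) (E b) \<in> V" for b
        using E \<xi> Z by simp
      have S: "S \<in> V" unfolding S_def by (intro sum_vf fV)
      have "\<forall>\<^sub>F q' in nhds q. \<forall>f\<in>C. (Z - S) f q' = 0"
        using elim by eventually_elim (simp add: Z S_def sum_fun_apply fsmult_def)
      then have "\<omega> (Z - S) q = 0"
        using Z S by (intro one_form_local[OF \<omega>]) auto
      then have "\<omega> Z q = \<omega> S q" using one_form_diff[OF \<omega> Z S] by simp
      then show "\<omega> Z q = (\<Sum>b\<in>(Basis :: 'e set). Z (\<xi> b) q * \<omega> (E b) q)"
        unfolding S_def one_form_sum[OF \<omega> fV]
        using E \<xi> Z by (simp add: one_form_fsmult[OF \<omega>] sum_fun_apply)
    qed
  qed
qed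

end

locale riemannian = manifold A
  for A :: "('a::t2_space, 'e::euclidean_space) chart set" +
  fixes g :: "'a form2"
  assumes metric: "riemannian_metric A g"
begin

lemma g_commute: "X \<in> V \<Longrightarrow> Y \<in> V \<Longrightarrow> g X Y = g Y X"
  and g_one_form: "Y \<in> V \<Longrightarrow> one_form A (\<lambda>X. g X Y)"
  and g_pos: "X \<in> V \<Longrightarrow> f \<in> C \<Longrightarrow> X f p \<noteq> 0 \<Longrightarrow> g X X p > 0"
  using metric unfolding riemannian_metric_def by blast+

lemma g_smooth [simp]: "X \<in> V \<Longrightarrow> Y \<in> V \<Longrightarrow> g X Y \<in> C"
  using one_form_smooth[OF g_one_form] by blast

lemma g_add_left: "X \<in> V \<Longrightarrow> Y \<in> V \<Longrightarrow> Z \<in> V \<Longrightarrow> g (X + Y) Z = g X Z + g Y Z"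
  using one_form_add[OF g_one_form] by blast

lemma g_fsmult_left: "f \<in> C \<Longrightarrow> X \<in> V \<Longrightarrow> Z \<in> V \<Longrightarrow> g (fsmult f X) Z = f * g X Z"
  using one_form_fsmult[OF g_one_form] by blast

lemma g_uminus_left: "X \<in> V \<Longrightarrow> Z \<in> V \<Longrightarrow> g (- X) Z = - g X Z"
  using one_form_uminus[OF g_one_form] by blast

lemma g_diff_left: "X \<in> V \<Longrightarrow> Y \<in> V \<Longrightarrow> Z \<in> V \<Longrightarrow> g (X - Y) Z = g X Z - g Y Z"
  using one_form_diff[OF g_one_form] by blast

lemma g_zero_left: "Z \<in> V \<Longrightarrow> g 0 Z = 0"
  using one_form_zero[OF g_one_form] by blast

lemma g_add_right: "X \<in> V \<Longrightarrow> Y \<in> V \<Longrightarrow> Z \<in> V \<Longrightarrow> g Z (X + Y) = g Z X + g Z Y"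
  by (simp add: g_commute[of Z] g_add_left)

lemma g_fsmult_right: "f \<in> C \<Longrightarrow> X \<in> V \<Longrightarrow> Z \<in> V \<Longrightarrow> g Z (fsmult f X) = f * g Z X"
  by (simp add: g_commute[of Z] g_fsmult_left)

lemma g_uminus_right: "X \<in> V \<Longrightarrow> Z \<in> V \<Longrightarrow> g Z (- X) = - g Z X"
  by (simp add: g_commute[of Z] g_uminus_left)

lemma g_diff_right: "X \<in> V \<Longrightarrow> Y \<in> V \<Longrightarrow> Z \<in> V \<Longrightarrow> g Z (X - Y) = g Z X - g Z Y"
  by (simp add: g_commute[of Z] g_diff_left)

lemma g_zero_right: "Z \<in> V \<Longrightarrow> g Z 0 = 0"
  by (simp add: g_commute[of Z] g_zero_left)

lemmas g_linear = g_add_left g_fsmult_left g_uminus_left g_diff_left g_zero_left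
  g_add_right g_fsmult_right g_uminus_right g_diff_right g_zero_right

lemma g_one_form_right: "X \<in> V \<Longrightarrow> one_form A (g X)"
  unfolding one_form_def by (simp add: g_linear)

text \<open>Testing with \<open>Z = X - Y\<close> gives a vector of length 0 at \<open>q\<close>,
  and positivity leaves it no function to act on there.\<close>

lemma vf_eq_at:
  assumes "X \<in> V" "Y \<in> V" "\<And>Z. Z \<in> V \<Longrightarrow> g X Z q = g Y Z q" "f \<in> C"
  shows "X f q = Y f q"
proof -
  have "g (X - Y) (X - Y) q = 0"
    using assms(1,2) assms(3)[of "X - Y"] by (simp add: g_diff_left)
  then have "(X - Y) f q = 0"
    using g_pos[of "X - Y" f q] assms by fastforce
  then show ?thesis by simp
qed

lemma vf_eqI:
  assumes "X \<in> V" "Y \<in> V" "\<And>Z. Z \<in> V \<Longrightarrow> g X Z = g Y Z"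
  shows "X = Y"
proof (intro ext)
  fix f q
  show "X f q = Y f q"
  proof (cases "f \<in> C")
    case True
    then show ?thesis
      using vf_eq_at[OF assms(1,2) fun_cong[OF assms(3)]] by blast
  next
    case False
    then show ?thesis using vf_nonsmooth assms by metis
  qed
qed

text \<open>The Gram matrix of the frame is positive definite at \<open>p\<close>: a combination
  with coefficients \<open>u\<close> sends \<open>\<xi> d\<close> to \<open>u d\<close> at
  \<open>p\<close>, hence is nonzero there if some \<open>u d\<close> is. Elimination gives smooth
  coefficients that solve the equation on the frame, and the frame expansion extends it to all
  \<open>Z\<close>.\<close>

lemma riesz_local:
  assumes \<omega>: "one_form A \<omega>"
  shows "\<exists>W\<in>V. \<forall>\<^sub>F q in nhds p. \<forall>Z\<in>V. g W Z q = \<omega> Z q"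
proof -
  obtain E :: "'e \<Rightarrow> 'a vfield" and \<xi> where E: "\<And>b. E b \<in> V" and \<xi>: "\<And>b. \<xi> b \<in> C"
    and E\<xi>: "\<And>b c. b \<in> Basis \<Longrightarrow> c \<in> Basis \<Longrightarrow> E b (\<xi> c) p = (if b = c then 1 else 0)"
    and exp: "\<forall>\<^sub>F q in nhds p. \<forall>Z\<in>V. \<forall>f\<in>C. Z f q = (\<Sum>b\<in>(Basis :: 'e set). Z (\<xi> b) q * E b f q)"
    using local_frame[of p] by blast
  have "\<exists>c. (\<forall>b\<in>(Basis :: 'e set). c b \<in> C) \<and>
      (\<forall>\<^sub>F q in nhds p. \<forall>d\<in>Basis. (\<Sum>b\<in>Basis. c b q * g (E b) (E d) q) = \<omega> (E d) q)"
  proof (rule local_linear_system)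
    fix u :: "'e \<Rightarrow> real" assume "\<exists>b\<in>Basis. u b \<noteq> 0"
    then obtain d where d: "d \<in> Basis" "u d \<noteq> 0" by blast
    define W where "W = (\<Sum>b\<in>(Basis :: 'e set). fsmult (\<lambda>_. u b) (E b))"
    have uE: "fsmult (\<lambda>_. u b) (E b) \<in> V" for b
      using E smooth_const by simp
    then have W: "W \<in> V" unfolding W_def by (intro sum_vf)
    have "W (\<xi> d) p = (\<Sum>b\<in>(Basis :: 'e set). u b * (if b = d then 1 else 0))"
      by (simp add: W_def sum_fun_apply fsmult_def E\<xi> d(1) cong: sum.cong)
    also have "\<dots> = u d" using d(1) by (simp add: if_distrib cong: if_cong)
    finally have "0 < g W W p" using g_pos[OF W \<xi>, of d p] d(2) by simp
    also have "g W W = (\<Sum>b\<in>(Basis :: 'e set). g (fsmult (\<lambda>_. u b) (E b)) W)"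
      by (subst (1) W_def) (rule one_form_sum[OF g_one_form[OF W] uE])
    also have "\<dots> = (\<Sum>b\<in>(Basis :: 'e set). \<Sum>d\<in>Basis. g (fsmult (\<lambda>_. u b) (E b)) (fsmult (\<lambda>_. u d) (E d)))"
      unfolding W_def by (intro sum.cong refl one_form_sum[OF g_one_form_right[OF uE] uE])
    also have "\<dots> p = (\<Sum>b\<in>(Basis :: 'e set). \<Sum>d\<in>Basis. u b * u d * g (E b) (E d) p)"
      using E by (simp add: sum_fun_apply g_linear smooth_const mult_ac)
    finally show "0 < (\<Sum>b\<in>(Basis :: 'e set). \<Sum>d\<in>Basis. u b * u d * g (E b) (E d) p)" .
  qed (use E one_form_smooth[OF \<omega>] in auto)
  then obtain c where c: "\<And>b. b \<in> Basis \<Longrightarrow> c b \<in> C"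
    "\<forall>\<^sub>F q in nhds p. \<forall>d\<in>Basis. (\<Sum>b\<in>(Basis :: 'e set). c b q * g (E b) (E d) q) = \<omega> (E d) q"
    by blast
  define W where "W = (\<Sum>b\<in>(Basis :: 'e set). fsmult (c b) (E b))"
  have cE: "fsmult (c b) (E b) \<in> V" if "b \<in> Basis" for b
    using E c(1)[OF that] by simp
  have W: "W \<in> V" unfolding W_def by (intro sum_vf cE)
  have WE: "g W (E d) q = (\<Sum>b\<in>(Basis :: 'e set). c b q * g (E b) (E d) q)" for d q
  proof -
    have "g W (E d) = (\<Sum>b\<in>(Basis :: 'e set). g (fsmult (c b) (E b)) (E d))"
      unfolding W_def by (rule one_form_sum[OF g_one_form[OF E] cE])
    then show ?thesis
      using E c(1) by (simp add: g_fsmult_left sum_fun_apply)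
  qed
  have "\<forall>\<^sub>F q in nhds p. \<forall>Z\<in>V. g W Z q = \<omega> Z q"
    using c(2) one_form_local_frame[OF E \<xi> exp]
  proof eventually_elim
    case (elim q)
    show ?case
    proof
      fix Z assume Z: "Z \<in> V"
      have "g W Z q = (\<Sum>b\<in>(Basis :: 'e set). Z (\<xi> b) q * g W (E b) q)"
        using elim(2) g_one_form_right[OF W] Z by blast
      also have "\<dots> = (\<Sum>b\<in>(Basis :: 'e set). Z (\<xi> b) q * \<omega> (E b) q)"
        using elim(1) by (simp add: WE)
      also have "\<dots> = \<omega> Z q" using elim(2) \<omega> Z by metis
      finally show "g W Z q = \<omega> Z q" .
    qed
  qed
  with W show ?thesis by blast
qed

lemma riesz:
  assumes \<omega>: "one_form A \<omega>"
  shows "\<exists>W\<in>V. \<forall>Z\<in>V. g W Z = \<omega> Z"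
proof -
  have "\<forall>p. \<exists>W. W \<in> V \<and> (\<forall>\<^sub>F q in nhds p. \<forall>Z\<in>V. g W Z q = \<omega> Z q)"
    using riesz_local[OF \<omega>] by blast
  from choice[OF this] obtain L
    where "\<forall>p. L p \<in> V \<and> (\<forall>\<^sub>F q in nhds p. \<forall>Z\<in>V. g (L p) Z q = \<omega> Z q)" ..
  then have L: "\<And>p. L p \<in> V" and ev: "\<And>p. \<forall>\<^sub>F q in nhds p. \<forall>Z\<in>V. g (L p) Z q = \<omega> Z q"
    by simp_all
  have same: "L q f q = L p f q" if "\<forall>Z\<in>V. g (L p) Z q = \<omega> Z q" "f \<in> C" for p q f
  proof (rule vf_eq_at[OF L L _ that(2)])
    show "g (L q) Z q = g (L p) Z q" if "Z \<in> V" for Z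
      using that \<open>\<forall>Z\<in>V. g (L p) Z q = \<omega> Z q\<close> bspec[OF eventually_nhds_x_imp_x[OF ev[of q]]] by metis
  qed
  \<comment> \<open>At \<open>q\<close> the field uses the solution attached to \<open>q\<close>
    itself. By \<open>same\<close> it agrees near \<open>p\<close> with the single field
    \<open>L p\<close>, which is how smoothness is obtained.\<close>
  define W where "W f = (if f \<in> C then (\<lambda>q. L q f q) else 0)" for f
  have local: "\<forall>\<^sub>F q in nhds p. \<forall>f\<in>C. W f q = L p f q" for p
    using ev[of p] by eventually_elim (simp add: W_def same)
  have W: "W \<in> V"
  proof (rule vector_fieldsI)
    fix f assume f: "f \<in> C"
    show "W f \<in> C"
    proof (rule smooth_local)
      fix p
      have "\<forall>\<^sub>F q in nhds p. W f q = L p f q"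
        using local[of p] by eventually_elim (use f in blast)
      then show "\<exists>h\<in>C. \<forall>\<^sub>F q in nhds p. W f q = h q"
        using vf_smooth[OF L f] by blast
    qed
    have "(\<lambda>p. c * f p) \<in> C" for c
      using smooth_mult[OF smooth_const[of c] f] by (simp add: times_fun_def)
    then show "W (\<lambda>p. c * f p) = (\<lambda>p. c * W f p)" for c
      using f by (simp add: W_def vf_scale[OF L f])
    fix h assume h: "h \<in> C"
    show "W (f + h) = W f + W h" "W (f * h) = f * W h + h * W f"
      using f h L by (simp_all add: W_def fun_eq_iff)
  qed (simp add: W_def)
  moreover have "g W Z p = \<omega> Z p" if Z: "Z \<in> V" for Z p
  proof -
    have "g (W - L p) Z p = 0"
      by (rule one_form_local[OF g_one_form[OF Z]])
        (use local[of p] W L in \<open>auto elim!: eventually_mono\<close>)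
    then show ?thesis
      using eventually_nhds_x_imp_x[OF ev[of p]] Z W L by (simp add: g_diff_left)
  qed
  ultimately show ?thesis by (intro bexI[of _ W]) (auto simp: fun_eq_iff)
qed

end

section \<open>Connections with given torsion\<close>

lemma fsmult_apply: "fsmult f X h = f * X h"
  by (simp add: fsmult_def)

lemma fsmult_zero: "fsmult f 0 = 0"
  by (simp add: fsmult_def fun_eq_iff)

lemma bracket_apply: "bracket X Y f = X (Y f) - Y (X f)"
  by (simp add: bracket_def)

context manifold
begin

section \<open>Brackets, differential forms and linear connections\<close>

lemma vf_ext:
  assumes "X \<in> V" "Y \<in> V" "\<And>f q. f \<in> C \<Longrightarrow> X f q = Y f q"
  shows "X = Y"
proof (intro ext)
  fix f q show "X f q = Y f q"
    using assms vf_nonsmooth by (cases "f \<in> C") metis+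
qed

lemma bracket_add_left:
  "X \<in> V \<Longrightarrow> X' \<in> V \<Longrightarrow> Y \<in> V \<Longrightarrow> bracket (X + X') Y = bracket X Y + bracket X' Y"
  by (rule vf_ext) (simp_all add: bracket_apply)

lemma bracket_swap: "bracket Y X = - bracket X Y"
  by (simp add: bracket_def fun_eq_iff)

lemma bracket_add_right:
  "X \<in> V \<Longrightarrow> Y \<in> V \<Longrightarrow> Y' \<in> V \<Longrightarrow> bracket X (Y + Y') = bracket X Y + bracket X Y'"
  by (rule vf_ext) (simp_all add: bracket_apply)

lemma bracket_fsmult_left:
  "f \<in> C \<Longrightarrow> X \<in> V \<Longrightarrow> Y \<in> V \<Longrightarrow>
    bracket (fsmult f X) Y = fsmult f (bracket X Y) - fsmult (Y f) X"
  by (rule vf_ext) (simp_all add: bracket_apply fsmult_apply right_diff_distrib mult.commute)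

lemma bracket_fsmult_right:
  "f \<in> C \<Longrightarrow> X \<in> V \<Longrightarrow> Y \<in> V \<Longrightarrow>
    bracket X (fsmult f Y) = fsmult f (bracket X Y) + fsmult (X f) Y"
  by (rule vf_ext) (simp_all add: bracket_apply fsmult_apply right_diff_distrib mult.commute)

lemmas bracket_linear = bracket_add_left bracket_add_right bracket_fsmult_left bracket_fsmult_right

lemma one_form_cong:
  assumes "\<And>X. X \<in> V \<Longrightarrow> \<alpha> X = \<beta> X" "one_form A \<alpha>" shows "one_form A \<beta>"
  using assms(2) unfolding one_form_def by (simp add: assms(1)[symmetric])

lemma one_formI:
  assumes "\<And>X. X \<in> V \<Longrightarrow> \<omega> X \<in> C"
    and "\<And>X Y. X \<in> V \<Longrightarrow> Y \<in> V \<Longrightarrow> \<omega> (X + Y) = \<omega> X + \<omega> Y"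
    and "\<And>f X. f \<in> C \<Longrightarrow> X \<in> V \<Longrightarrow> \<omega> (fsmult f X) = f * \<omega> X"
  shows "one_form A \<omega>"
  unfolding one_form_def by (intro conjI ballI assms)

text \<open>Linearity is asked only in the last argument; the two transpositions carry it to the
  others.\<close>

lemma three_formI:
  assumes one: "\<And>X Y. X \<in> V \<Longrightarrow> Y \<in> V \<Longrightarrow> one_form A (\<omega> X Y)"
    and skew: "\<And>X Y Z. X \<in> V \<Longrightarrow> Y \<in> V \<Longrightarrow> Z \<in> V \<Longrightarrow> \<omega> Y X Z = - \<omega> X Y Z"
      "\<And>X Y Z. X \<in> V \<Longrightarrow> Y \<in> V \<Longrightarrow> Z \<in> V \<Longrightarrow> \<omega> X Z Y = - \<omega> X Y Z"
  shows "three_form A \<omega>"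
proof -
  have neg: "one_form A (\<lambda>Z. - \<omega> X Y Z)" if "X \<in> V" "Y \<in> V" for X Y
    using one[OF that] unfolding one_form_def by (simp add: algebra_simps)
  have "one_form A (\<lambda>Z. \<omega> X Z Y)" if "X \<in> V" "Y \<in> V" for X Y
    by (rule one_form_cong[OF _ neg[OF that]]) (simp add: skew(2)[OF that])
  moreover have "one_form A (\<lambda>Z. \<omega> Z X Y)" if "X \<in> V" "Y \<in> V" for X Y
  proof (rule one_form_cong[OF _ one[OF that]])
    fix Z assume "Z \<in> V"
    then show "\<omega> X Y Z = \<omega> Z X Y"
      using skew(1)[OF \<open>Z \<in> V\<close> \<open>X \<in> V\<close> \<open>Y \<in> V\<close>] skew(2)[OF \<open>X \<in> V\<close> \<open>Y \<in> V\<close> \<open>Z \<in> V\<close>] by simp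
  qed
  ultimately show ?thesis
    unfolding three_form_def by (intro conjI ballI one skew)
qed

lemma three_form_one_form:
  "three_form A \<omega> \<Longrightarrow> X \<in> V \<Longrightarrow> Y \<in> V \<Longrightarrow> one_form A (\<lambda>Z. \<omega> Z X Y)"
  "three_form A \<omega> \<Longrightarrow> X \<in> V \<Longrightarrow> Y \<in> V \<Longrightarrow> one_form A (\<lambda>Z. \<omega> X Z Y)"
  "three_form A \<omega> \<Longrightarrow> X \<in> V \<Longrightarrow> Y \<in> V \<Longrightarrow> one_form A (\<lambda>Z. \<omega> X Y Z)"
  unfolding three_form_def by blast+

lemma three_form_skew:
  "three_form A \<omega> \<Longrightarrow> X \<in> V \<Longrightarrow> Y \<in> V \<Longrightarrow> Z \<in> V \<Longrightarrow> \<omega> Y X Z = - \<omega> X Y Z"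
  "three_form A \<omega> \<Longrightarrow> X \<in> V \<Longrightarrow> Y \<in> V \<Longrightarrow> Z \<in> V \<Longrightarrow> \<omega> X Z Y = - \<omega> X Y Z"
  unfolding three_form_def by blast+

lemma three_form_cong:
  assumes eq: "\<And>X Y Z. X \<in> V \<Longrightarrow> Y \<in> V \<Longrightarrow> Z \<in> V \<Longrightarrow> \<alpha> X Y Z = \<beta> X Y Z"
    and \<alpha>: "three_form A \<alpha>"
  shows "three_form A \<beta>"
proof (rule three_formI)
  fix X Y assume XY: "X \<in> V" "Y \<in> V"
  show "one_form A (\<beta> X Y)"
    by (rule one_form_cong[OF eq[OF XY] three_form_one_form(3)[OF \<alpha> XY]])
  fix Z assume Z: "Z \<in> V"
  show "\<beta> Y X Z = - \<beta> X Y Z" "\<beta> X Z Y = - \<beta> X Y Z"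
    using three_form_skew[OF \<alpha> XY Z] eq XY Z by simp_all
qed

lemma three_form_linear:
  assumes "three_form A \<omega>" "X \<in> V" "Y \<in> V"
  shows "Z \<in> V \<Longrightarrow> \<omega> X Y Z \<in> C"
    and "Z \<in> V \<Longrightarrow> Z' \<in> V \<Longrightarrow> \<omega> (Z + Z') X Y = \<omega> Z X Y + \<omega> Z' X Y"
    and "Z \<in> V \<Longrightarrow> Z' \<in> V \<Longrightarrow> \<omega> X (Z + Z') Y = \<omega> X Z Y + \<omega> X Z' Y"
    and "Z \<in> V \<Longrightarrow> Z' \<in> V \<Longrightarrow> \<omega> X Y (Z + Z') = \<omega> X Y Z + \<omega> X Y Z'"
    and "Z \<in> V \<Longrightarrow> f \<in> C \<Longrightarrow> \<omega> (fsmult f Z) X Y = f * \<omega> Z X Y"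
    and "Z \<in> V \<Longrightarrow> f \<in> C \<Longrightarrow> \<omega> X (fsmult f Z) Y = f * \<omega> X Z Y"
    and "Z \<in> V \<Longrightarrow> f \<in> C \<Longrightarrow> \<omega> X Y (fsmult f Z) = f * \<omega> X Y Z"
    and "\<omega> 0 X Y = 0" "\<omega> X 0 Y = 0" "\<omega> X Y 0 = 0"
  using one_form_smooth[OF three_form_one_form(3)[OF assms]]
    one_form_add[OF three_form_one_form(1)[OF assms]] one_form_add[OF three_form_one_form(2)[OF assms]]
    one_form_add[OF three_form_one_form(3)[OF assms]] one_form_fsmult[OF three_form_one_form(1)[OF assms]]
    one_form_fsmult[OF three_form_one_form(2)[OF assms]] one_form_fsmult[OF three_form_one_form(3)[OF assms]]
    one_form_zero[OF three_form_one_form(1)[OF assms]] one_form_zero[OF three_form_one_form(2)[OF assms]]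
    one_form_zero[OF three_form_one_form(3)[OF assms]] by blast+

lemma three_form_zero: "three_form A (\<lambda>X Y Z. 0)"
  by (rule three_formI) (auto intro!: one_formI)

lemma three_form_add:
  assumes "three_form A \<alpha>" "three_form A \<beta>"
  shows "three_form A (\<lambda>X Y Z. \<alpha> X Y Z + \<beta> X Y Z)"
proof (rule three_formI)
  fix X Y assume XY: "X \<in> V" "Y \<in> V"
  show "one_form A (\<lambda>Z. \<alpha> X Y Z + \<beta> X Y Z)"
    by (rule one_formI)
      (simp_all add: XY three_form_linear[OF assms(1)] three_form_linear[OF assms(2)] fun_eq_iff algebra_simps)
  fix Z assume Z: "Z \<in> V"
  show "\<alpha> Y X Z + \<beta> Y X Z = - (\<alpha> X Y Z + \<beta> X Y Z)" "\<alpha> X Z Y + \<beta> X Z Y = - (\<alpha> X Y Z + \<beta> X Y Z)"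
    using three_form_skew[OF assms(1) XY Z] three_form_skew[OF assms(2) XY Z] by simp_all
qed

lemma three_form_uminus:
  assumes "three_form A \<alpha>"
  shows "three_form A (\<lambda>X Y Z. - \<alpha> X Y Z)"
proof (rule three_formI)
  fix X Y assume XY: "X \<in> V" "Y \<in> V"
  show "one_form A (\<lambda>Z. - \<alpha> X Y Z)"
    by (rule one_formI) (simp_all add: XY three_form_linear[OF assms(1)] fun_eq_iff)
  fix Z assume Z: "Z \<in> V"
  show "- \<alpha> Y X Z = - (- \<alpha> X Y Z)" "- \<alpha> X Z Y = - (- \<alpha> X Y Z)"
    using three_form_skew[OF assms XY Z] by simp_all
qed

text \<open>When \<open>Z\<close> is multiplied by \<open>f\<close>, the derivatives
  \<open>X f\<close> and \<open>Y f\<close> come once from differentiating \<open>\<omega>\<close>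
  and once from the brackets. By skewness of \<open>\<omega>\<close> they cancel.\<close>

lemma three_form_d_two_form:
  assumes one: "\<And>X. X \<in> V \<Longrightarrow> one_form A (\<omega> X)"
    and skew: "\<And>X Y. X \<in> V \<Longrightarrow> Y \<in> V \<Longrightarrow> \<omega> Y X = - \<omega> X Y"
  shows "three_form A (d_two_form \<omega>)"
proof (rule three_formI)
  note lin = one_form_smooth[OF one] one_form_add[OF one] one_form_fsmult[OF one]
  have add: "\<omega> (X + X') Y = \<omega> X Y + \<omega> X' Y" if "X \<in> V" "X' \<in> V" "Y \<in> V" for X X' Y
    using that skew[of Y "X + X'"] skew[of Y X] skew[of Y X'] by (simp add: lin fun_eq_iff)
  have fsm: "\<omega> (fsmult f X) Y = f * \<omega> X Y" if "f \<in> C" "X \<in> V" "Y \<in> V" for f X Y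
    using that skew[of Y "fsmult f X"] skew[of Y X] by (simp add: lin fun_eq_iff)
  fix X Y assume XY: "X \<in> V" "Y \<in> V"
  show "one_form A (d_two_form \<omega> X Y)"
  proof (rule one_formI)
    fix Z assume Z: "Z \<in> V"
    show "d_two_form \<omega> X Y Z \<in> C"
      by (simp add: d_two_form_def XY Z lin)
    fix Z' assume Z': "Z' \<in> V"
    show "d_two_form \<omega> X Y (Z + Z') = d_two_form \<omega> X Y Z + d_two_form \<omega> X Y Z'"
      by (rule ext) (simp add: d_two_form_def XY Z Z' lin add bracket_linear)
  next
    fix f Z assume f: "f \<in> C" and Z: "Z \<in> V"
    show "d_two_form \<omega> X Y (fsmult f Z) = f * d_two_form \<omega> X Y Z"
      using skew[OF XY(1) Z] skew[OF XY(2) Z]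
      by (intro ext) (simp add: d_two_form_def XY Z f lin add fsm bracket_linear fsmult_apply algebra_simps)
  qed
  fix Z assume Z: "Z \<in> V"
  have swap: "\<omega> (bracket U W) T = - \<omega> (bracket W U) T" if "U \<in> V" "W \<in> V" "T \<in> V" for U W T
    using fsm[of "- 1" "bracket W U" T] that by (simp add: bracket_swap[of U W] uminus_eq_fsmult)
  show "d_two_form \<omega> Y X Z = - d_two_form \<omega> X Y Z"
    using skew[OF XY] swap[OF XY Z]
    by (intro ext) (simp add: d_two_form_def XY Z lin)
  show "d_two_form \<omega> X Z Y = - d_two_form \<omega> X Y Z"
    using skew[OF XY(2) Z] swap[OF XY(2) Z XY(1)]
    by (intro ext) (simp add: d_two_form_def XY Z lin)
qed

lemma three_form_wedge:
  assumes \<alpha>: "one_form A \<alpha>" and one: "\<And>X. X \<in> V \<Longrightarrow> one_form A (\<beta> X)"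
    and skew: "\<And>X Y. X \<in> V \<Longrightarrow> Y \<in> V \<Longrightarrow> \<beta> Y X = - \<beta> X Y"
  shows "three_form A (wedge_one_two \<alpha> \<beta>)"
proof (rule three_formI)
  note lin = one_form_smooth[OF one] one_form_add[OF one] one_form_fsmult[OF one]
    one_form_smooth[OF \<alpha>] one_form_add[OF \<alpha>] one_form_fsmult[OF \<alpha>]
  fix X Y assume XY: "X \<in> V" "Y \<in> V"
  show "one_form A (wedge_one_two \<alpha> \<beta> X Y)"
  proof (rule one_formI)
    fix Z assume Z: "Z \<in> V"
    show "wedge_one_two \<alpha> \<beta> X Y Z \<in> C"
      by (simp add: wedge_one_two_def XY Z lin)
    fix Z' assume Z': "Z' \<in> V"
    show "wedge_one_two \<alpha> \<beta> X Y (Z + Z') = wedge_one_two \<alpha> \<beta> X Y Z + wedge_one_two \<alpha> \<beta> X Y Z'"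
      by (rule ext)
        (simp add: wedge_one_two_def XY Z Z' lin skew[of X "Z + Z'"] skew[of X Z] skew[of X Z'],
          simp add: algebra_simps)
  next
    fix f Z assume f: "f \<in> C" and Z: "Z \<in> V"
    show "wedge_one_two \<alpha> \<beta> X Y (fsmult f Z) = f * wedge_one_two \<alpha> \<beta> X Y Z"
      by (rule ext)
        (simp add: wedge_one_two_def XY Z f lin skew[of X "fsmult f Z"] skew[of X Z],
          simp add: algebra_simps)
  qed
  fix Z assume Z: "Z \<in> V"
  show "wedge_one_two \<alpha> \<beta> Y X Z = - wedge_one_two \<alpha> \<beta> X Y Z"
    by (rule ext) (simp add: wedge_one_two_def skew[OF XY] skew[OF XY(1) Z] skew[OF XY(2) Z])
  show "wedge_one_two \<alpha> \<beta> X Z Y = - wedge_one_two \<alpha> \<beta> X Y Z"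
    by (rule ext) (simp add: wedge_one_two_def skew[OF XY] skew[OF XY(1) Z] skew[OF XY(2) Z])
qed

lemma linear_connectionD:
  assumes "linear_connection A D"
  shows "X \<in> V \<Longrightarrow> Y \<in> V \<Longrightarrow> D X Y \<in> V"
    and "X \<in> V \<Longrightarrow> X' \<in> V \<Longrightarrow> Y \<in> V \<Longrightarrow> D (X + X') Y = D X Y + D X' Y"
    and "f \<in> C \<Longrightarrow> X \<in> V \<Longrightarrow> Y \<in> V \<Longrightarrow> D (fsmult f X) Y = fsmult f (D X Y)"
    and "X \<in> V \<Longrightarrow> Y \<in> V \<Longrightarrow> Y' \<in> V \<Longrightarrow> D X (Y + Y') = D X Y + D X Y'"
    and "f \<in> C \<Longrightarrow> X \<in> V \<Longrightarrow> Y \<in> V \<Longrightarrow> D X (fsmult f Y) = fsmult (X f) Y + fsmult f (D X Y)"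
    and "X \<notin> V \<or> Y \<notin> V \<Longrightarrow> D X Y = 0"
  using assms unfolding linear_connection_def by blast+

lemma torsion_vf: "linear_connection A D \<Longrightarrow> X \<in> V \<Longrightarrow> Y \<in> V \<Longrightarrow> torsion D X Y \<in> V"
  by (simp add: torsion_def linear_connectionD(1))

end

section \<open>The Koszul formula and metric connections\<close>

context riemannian
begin

definition koszul :: "'a form3 \<Rightarrow> 'a form3" where
  "koszul T X Y Z = X (g Y Z) + Y (g X Z) - Z (g X Y)
     + g (bracket X Y) Z - g (bracket X Z) Y - g (bracket Y Z) X + T X Y Z"

text \<open>Both sides are doubled, since function types carry no division.\<close>

lemma koszul_formula:
  assumes D: "linear_connection A D" "parallel_metric A D g" and T: "three_form A T"
    and tor: "\<And>X Y Z. X \<in> V \<Longrightarrow> Y \<in> V \<Longrightarrow> Z \<in> V \<Longrightarrow> torsion3 g D X Y Z = T X Y Z"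
    and XYZ: "X \<in> V" "Y \<in> V" "Z \<in> V"
  shows "2 * g (D X Y) Z = koszul T X Y Z"
proof (rule ext)
  fix p
  have par: "U (g W S) p = g (D U W) S p + g (D U S) W p" if UWS: "U \<in> V" "W \<in> V" "S \<in> V" for U W S
  proof -
    have "U (g W S) - g (D U W) S - g W (D U S) = 0"
      using D(2) UWS unfolding parallel_metric_def by blast
    from fun_cong[OF this, of p] show ?thesis
      using g_commute[OF UWS(2) linear_connectionD(1)[OF D(1) UWS(1,3)]] by simp
  qed
  have br: "g (bracket U W) S p = g (D U W) S p - g (D W U) S p - T U W S p"
    if "U \<in> V" "W \<in> V" "S \<in> V" for U W S
    using fun_cong[OF tor[OF that], of p] that linear_connectionD(1)[OF D(1)]
    unfolding torsion3_def torsion_def by (simp add: g_linear)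
  \<comment> \<open>The three brackets contribute \<open>- T X Y Z + T X Z Y + T Y Z X\<close>,
    which skewness reduces to \<open>- T X Y Z\<close>; the last summand of \<open>koszul\<close>
    cancels it.\<close>
  have "T X Z Y p = - T X Y Z p" "T Y Z X p = T X Y Z p"
    using three_form_skew(2)[OF T XYZ] three_form_skew(1)[OF T XYZ]
      three_form_skew(2)[OF T XYZ(2,1,3)] by simp_all
  then show "(2 * g (D X Y) Z) p = koszul T X Y Z p"
    using XYZ par[of X Y Z] par[of Y X Z] par[of Z X Y] br[of X Y Z] br[of X Z Y] br[of Y Z X]
    by (simp add: koszul_def)
qed

text \<open>The Koszul formula fixes all inner products of \<open>D X Y\<close>. Outside the vector
  fields both connections are 0 by convention, so they are equal as functions.\<close>

lemma connection_unique:
  assumes "linear_connection A D" "parallel_metric A D g"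
    and "linear_connection A D'" "parallel_metric A D' g" and T: "three_form A T"
    and "\<And>X Y Z. X \<in> V \<Longrightarrow> Y \<in> V \<Longrightarrow> Z \<in> V \<Longrightarrow> torsion3 g D X Y Z = T X Y Z"
    and "\<And>X Y Z. X \<in> V \<Longrightarrow> Y \<in> V \<Longrightarrow> Z \<in> V \<Longrightarrow> torsion3 g D' X Y Z = T X Y Z"
  shows "D = D'"
proof (intro ext[of D D'] ext)
  fix X Y
  have "D X Y = D' X Y"
  proof (cases "X \<in> V \<and> Y \<in> V")
    case True
    show ?thesis
    proof (rule vf_eqI)
      fix Z assume "Z \<in> V"
      then have "2 * g (D X Y) Z = 2 * g (D' X Y) Z"
        using koszul_formula[OF assms(1,2) T assms(6)] koszul_formula[OF assms(3,4) T assms(7)] True by simp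
      then show "g (D X Y) Z = g (D' X Y) Z" by (simp add: fun_eq_iff)
    qed (use True linear_connectionD(1) assms in auto)
  qed (metis linear_connectionD(6) assms(1,3))
  then show "D X Y f p = D' X Y f p" for f p by simp
qed

text \<open>Half of \<open>koszul T X Y\<close> is a 1-form in the last argument, so Riesz
  represents it by a field. The connection axioms hold because they hold after pairing with every
  field.\<close>

lemma connection_exists:
  assumes T: "three_form A T"
  shows "\<exists>D. linear_connection A D \<and> parallel_metric A D g \<and>
    (\<forall>X\<in>V. \<forall>Y\<in>V. \<forall>Z\<in>V. torsion3 g D X Y Z = T X Y Z)"
proof -
  note Tl = three_form_linear[OF T]
  note rules = g_linear bracket_linear fsmult_apply Tl
  have one: "one_form A (\<lambda>Z. (\<lambda>_. 1/2) * koszul T X Y Z)" if XY: "X \<in> V" "Y \<in> V" for X Y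
  proof (rule one_formI)
    fix Z assume Z: "Z \<in> V"
    show "(\<lambda>_. 1/2) * koszul T X Y Z \<in> C"
      using XY Z smooth_const by (simp add: koszul_def Tl)
    fix Z' assume Z': "Z' \<in> V"
    show "(\<lambda>_. 1/2) * koszul T X Y (Z + Z') = (\<lambda>_. 1/2) * koszul T X Y Z + (\<lambda>_. 1/2) * koszul T X Y Z'"
      by (rule ext) (simp add: koszul_def XY Z Z' rules algebra_simps)
  next
    fix f Z assume f: "f \<in> C" and Z: "Z \<in> V"
    show "(\<lambda>_. 1/2) * koszul T X Y (fsmult f Z) = f * ((\<lambda>_. 1/2) * koszul T X Y Z)"
      by (rule ext) (simp add: koszul_def XY Z f rules algebra_simps g_commute)
  qed
  define D where "D X Y = (if X \<in> V \<and> Y \<in> V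
    then (SOME W. W \<in> V \<and> (\<forall>Z\<in>V. g W Z = (\<lambda>_. 1/2) * koszul T X Y Z)) else 0)" for X Y
  have D: "D X Y \<in> V \<and> (\<forall>Z\<in>V. g (D X Y) Z = (\<lambda>_. 1/2) * koszul T X Y Z)" if "X \<in> V" "Y \<in> V" for X Y
  proof -
    have "\<exists>W. W \<in> V \<and> (\<forall>Z\<in>V. g W Z = (\<lambda>_. 1/2) * koszul T X Y Z)"
      using riesz[OF one[OF that]] by blast
    from someI_ex[OF this] show ?thesis using that by (simp add: D_def)
  qed
  then have DV [simp]: "D X Y \<in> V" if "X \<in> V" "Y \<in> V" for X Y
    using that by blast
  have gD: "g (D X Y) Z p = koszul T X Y Z p / 2" if "X \<in> V" "Y \<in> V" "Z \<in> V" for X Y Z p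
    using D[OF that(1,2)] that(3) by simp
  have "linear_connection A D"
    unfolding linear_connection_def
  proof (intro conjI ballI allI impI)
    fix X Y assume XY: "X \<in> V" "Y \<in> V"
    show "D X Y \<in> V" using XY by simp
    fix W assume W: "W \<in> V"
    show "D (X + Y) W = D X W + D Y W"
      by (rule vf_eqI) (simp_all add: XY W, rule ext,
        simp add: XY W gD g_linear, simp add: koszul_def XY W rules field_simps)
    show "D X (Y + W) = D X Y + D X W"
      by (rule vf_eqI) (simp_all add: XY W, rule ext,
        simp add: XY W gD g_linear, simp add: koszul_def XY W rules field_simps)
  next
    fix f X Y assume f: "f \<in> C" and XY: "X \<in> V" "Y \<in> V"
    show "D (fsmult f X) Y = fsmult f (D X Y)"
      by (rule vf_eqI) (simp_all add: XY f, rule ext,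
        simp add: XY f gD g_linear, simp add: koszul_def XY f rules field_simps g_commute)
    show "D X (fsmult f Y) = fsmult (X f) Y + fsmult f (D X Y)"
      by (rule vf_eqI) (simp_all add: XY f, rule ext,
        simp add: XY f gD g_linear, simp add: koszul_def XY f rules field_simps g_commute)
  qed (auto simp: D_def)
  moreover have "parallel_metric A D g"
    unfolding parallel_metric_def
  proof (intro ballI ext)
    fix X Y Z p assume XYZ: "X \<in> V" "Y \<in> V" "Z \<in> V"
    have "bracket Z Y = - bracket Y Z" by (rule bracket_swap)
    then show "(X (g Y Z) - g (D X Y) Z - g Y (D X Z)) p = 0 p"
      using XYZ three_form_skew(2)[OF T XYZ] g_commute[of Z Y] g_commute[of Y "D X Z"]
      by (simp add: gD koszul_def g_uminus_left field_simps)
  qed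
  moreover have "torsion3 g D X Y Z = T X Y Z" if XYZ: "X \<in> V" "Y \<in> V" "Z \<in> V" for X Y Z
  proof (rule ext)
    fix p
    have "bracket Y X = - bracket X Y" by (rule bracket_swap)
    then show "torsion3 g D X Y Z p = T X Y Z p"
      using XYZ three_form_skew(1)[OF T XYZ] g_commute[of Y X]
      by (simp add: torsion3_def torsion_def g_linear gD koszul_def field_simps)
  qed
  ultimately show ?thesis by blast
qed

text \<open>Justifies the definite description in \<open>levi_civita\<close>: existence and
  uniqueness for the torsion form 0, which by nondegeneracy is the same as a vanishing torsion
  field.\<close>

lemma levi_civita_properties:
  shows "linear_connection A (levi_civita A g)" "parallel_metric A (levi_civita A g) g"
    and "X \<in> V \<Longrightarrow> Y \<in> V \<Longrightarrow> Z \<in> V \<Longrightarrow> torsion3 g (levi_civita A g) X Y Z = 0"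
proof -
  let ?P = "\<lambda>D. linear_connection A D \<and> parallel_metric A D g \<and> (\<forall>X\<in>V. \<forall>Y\<in>V. torsion D X Y = 0)"
  have t3: "torsion3 g D X Y Z = 0" if "?P D" "X \<in> V" "Y \<in> V" "Z \<in> V" for D X Y Z
    using that g_zero_left unfolding torsion3_def by metis
  obtain D where D: "linear_connection A D" "parallel_metric A D g"
    "\<forall>X\<in>V. \<forall>Y\<in>V. \<forall>Z\<in>V. torsion3 g D X Y Z = 0"
    using connection_exists[OF three_form_zero] by blast
  have "torsion D X Y = 0" if "X \<in> V" "Y \<in> V" for X Y
    using D(3) that by (intro vf_eqI) (auto simp: torsion_vf[OF D(1)] torsion3_def g_zero_left)
  with D have P: "?P D" by blast
  have "?P (levi_civita A g)"
    unfolding levi_civita_def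
  proof (rule theI[of ?P D])
    show "?P D" by (fact P)
  next
    fix D' assume "?P D'"
    then show "D' = D"
      using P by (intro connection_unique[OF _ _ _ _ three_form_zero]) (auto simp: t3)
  qed
  then show "linear_connection A (levi_civita A g)" "parallel_metric A (levi_civita A g) g"
    "X \<in> V \<Longrightarrow> Y \<in> V \<Longrightarrow> Z \<in> V \<Longrightarrow> torsion3 g (levi_civita A g) X Y Z = 0"
    using t3 by blast+
qed

text \<open>The two Koszul expressions differ only in the summand \<open>T\<close>, which enters
  twice the connection.\<close>

lemma levi_civita_plus_half_torsion:
  assumes D: "linear_connection A D" "parallel_metric A D g" "three_form A (torsion3 g D)"
    and XYZ: "X \<in> V" "Y \<in> V" "Z \<in> V"
  shows "g (D X Y) Z p = g (levi_civita A g X Y) Z p + 1/2 * torsion3 g D X Y Z p"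
proof -
  have 1: "2 * g (D X Y) Z = koszul (torsion3 g D) X Y Z"
    by (rule koszul_formula[OF D refl XYZ])
  have 2: "2 * g (levi_civita A g X Y) Z = koszul (\<lambda>X Y Z. 0) X Y Z"
    by (rule koszul_formula[OF levi_civita_properties(1,2) three_form_zero levi_civita_properties(3) XYZ])
  show ?thesis
    using fun_cong[OF 1, of p] fun_cong[OF 2, of p] by (simp add: koszul_def)
qed

end

section \<open>Almost contact metric manifolds\<close>

locale almost_contact = manifold A
  for A :: "('a::t2_space, 'e::euclidean_space) chart set" +
  fixes g :: "'a form2" and \<xi> :: "'a vfield" and \<eta> :: "'a form1" and \<phi> :: "'a vfield \<Rightarrow> 'a vfield"
  assumes contact: "almost_contact_metric A g \<xi> \<eta> \<phi>"

sublocale almost_contact \<subseteq> riemannian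
  using contact by unfold_locales (simp add: almost_contact_metric_def)

context almost_contact
begin

lemma \<xi>_vf [simp]: "\<xi> \<in> V"
  and \<eta>_one_form: "one_form A \<eta>"
  and \<eta>_eq: "X \<in> V \<Longrightarrow> \<eta> X = g \<xi> X"
  and \<eta>_\<xi>: "\<eta> \<xi> = 1"
  and \<phi>_\<phi>': "X \<in> V \<Longrightarrow> \<phi> (\<phi> X) = - X + fsmult (\<eta> X) \<xi>"
  and g_\<phi>_\<phi>: "X \<in> V \<Longrightarrow> Y \<in> V \<Longrightarrow> g (\<phi> X) (\<phi> Y) = g X Y - \<eta> X * \<eta> Y"
  and \<phi>_\<xi>: "\<phi> \<xi> = 0"
  using contact unfolding almost_contact_metric_def by blast+

lemma \<phi>_vf [simp]: "X \<in> V \<Longrightarrow> \<phi> X \<in> V"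
  and \<phi>_add: "X \<in> V \<Longrightarrow> Y \<in> V \<Longrightarrow> \<phi> (X + Y) = \<phi> X + \<phi> Y"
  and \<phi>_fsmult: "f \<in> C \<Longrightarrow> X \<in> V \<Longrightarrow> \<phi> (fsmult f X) = fsmult f (\<phi> X)"
  using contact unfolding almost_contact_metric_def endomorphism_field_def by blast+

lemma \<phi>_zero: "\<phi> 0 = 0"
  using \<phi>_add[of 0 0] by simp

lemma \<phi>_uminus: "X \<in> V \<Longrightarrow> \<phi> (- X) = - \<phi> X"
  using \<phi>_fsmult[of "- 1" X] by (simp add: uminus_eq_fsmult)

lemma \<phi>_diff: "X \<in> V \<Longrightarrow> Y \<in> V \<Longrightarrow> \<phi> (X - Y) = \<phi> X - \<phi> Y"
  using \<phi>_add[of X "- Y"] \<phi>_uminus[of Y] uminus_vf[of Y] by (simp only: diff_conv_add_uminus)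

lemma \<phi>_\<phi>: "X \<in> V \<Longrightarrow> \<phi> (\<phi> X) = fsmult (\<eta> X) \<xi> - X"
  by (simp add: \<phi>_\<phi>')

lemma g_\<xi>: "X \<in> V \<Longrightarrow> g \<xi> X = \<eta> X" "X \<in> V \<Longrightarrow> g X \<xi> = \<eta> X"
  by (simp_all add: \<eta>_eq g_commute)

lemma \<eta>_smooth [simp]: "X \<in> V \<Longrightarrow> \<eta> X \<in> C"
  by (rule one_form_smooth[OF \<eta>_one_form])

text \<open>Evaluate the cube of \<open>\<phi>\<close> in two ways: squaring at
  \<open>\<phi> X\<close> gives \<open>\<eta> (\<phi> X)\<close> times \<open>\<xi>\<close> minus
  \<open>\<phi> X\<close>, while applying \<open>\<phi>\<close> to the square at \<open>X\<close>
  gives \<open>- \<phi> X\<close>.\<close>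

lemma \<eta>_\<phi>: assumes X: "X \<in> V" shows "\<eta> (\<phi> X) = 0"
proof -
  have "fsmult (\<eta> (\<phi> X)) \<xi> - \<phi> X = \<phi> (fsmult (\<eta> X) \<xi> - X)"
    unfolding \<phi>_\<phi>[OF X, symmetric] \<phi>_\<phi>[OF \<phi>_vf[OF X], symmetric] ..
  also have "\<dots> = 0 - \<phi> X"
    using X by (simp add: \<phi>_diff \<phi>_fsmult \<phi>_\<xi> fsmult_zero)
  finally have "fsmult (\<eta> (\<phi> X)) \<xi> = 0" by (metis diff_add_cancel)
  then have "\<eta> (fsmult (\<eta> (\<phi> X)) \<xi>) = 0" by (simp only: one_form_zero[OF \<eta>_one_form])
  then show ?thesis using X by (simp add: one_form_fsmult[OF \<eta>_one_form] \<eta>_\<xi>)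
qed

text \<open>Put \<open>\<phi> Y\<close> for \<open>Y\<close> in the compatibility of
  \<open>g\<close> and \<open>\<phi>\<close>; the \<eta>-terms drop out because
  \<open>\<eta>\<close> vanishes on the image of \<open>\<phi>\<close>.\<close>

lemma g_\<phi>_left: assumes "X \<in> V" "Y \<in> V" shows "g (\<phi> X) Y = - g X (\<phi> Y)"
proof -
  have "g (\<phi> X) (\<phi> (\<phi> Y)) = g X (\<phi> Y)"
    using assms by (simp add: g_\<phi>_\<phi>[of X "\<phi> Y"] \<eta>_\<phi>)
  moreover have "g (\<phi> X) (\<phi> (\<phi> Y)) = \<eta> Y * g (\<phi> X) \<xi> - g (\<phi> X) Y"
    using assms by (simp add: \<phi>_\<phi>[of Y] g_linear g_\<xi>)
  moreover have "g (\<phi> X) \<xi> = 0"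
    using assms \<eta>_\<phi>[of X] by (simp add: g_\<xi>)
  ultimately have "- g (\<phi> X) Y = g X (\<phi> Y)" by simp
  then show ?thesis by (metis add.inverse_inverse)
qed

lemma d_\<eta>_skew: "d_one_form \<eta> Y X = - d_one_form \<eta> X Y" if "X \<in> V" "Y \<in> V"
  using that one_form_uminus[OF \<eta>_one_form, of "bracket X Y"]
  by (simp add: d_one_form_def bracket_swap[of Y X])

lemma d_\<eta>_one_form: assumes X: "X \<in> V" shows "one_form A (d_one_form \<eta> X)"
proof (rule one_formI)
  note lin = one_form_add[OF \<eta>_one_form] one_form_fsmult[OF \<eta>_one_form]
  fix Y assume Y: "Y \<in> V"
  show "d_one_form \<eta> X Y \<in> C"
    using X Y by (simp add: d_one_form_def)
  show "d_one_form \<eta> X (Y + Z) = d_one_form \<eta> X Y + d_one_form \<eta> X Z" if "Z \<in> V" for Z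
    by (rule ext) (simp add: d_one_form_def X Y that lin bracket_linear)
  show "d_one_form \<eta> X (fsmult f Y) = f * d_one_form \<eta> X Y" if "f \<in> C" for f
    by (rule ext) (simp add: d_one_form_def X Y that lin bracket_linear fsmult_apply algebra_simps)
qed

lemma F_skew: "X \<in> V \<Longrightarrow> Y \<in> V \<Longrightarrow> fundamental_form g \<phi> Y X = - fundamental_form g \<phi> X Y"
  unfolding fundamental_form_def using g_\<phi>_left[of X Y] g_commute[of Y "\<phi> X"] by simp

lemma F_one_form: "X \<in> V \<Longrightarrow> one_form A (fundamental_form g \<phi> X)"
  unfolding fundamental_form_def by (rule one_formI) (simp_all add: \<phi>_add \<phi>_fsmult g_linear)

lemma three_form_d_\<phi>_F: "three_form A (d_phi_F g \<phi>)"
proof (rule three_formI)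
  let ?dF = "d_two_form (fundamental_form g \<phi>)"
  have dF: "three_form A ?dF"
    by (rule three_form_d_two_form[OF F_one_form F_skew])
  fix X Y assume XY: "X \<in> V" "Y \<in> V"
  show "one_form A (d_phi_F g \<phi> X Y)"
  proof (rule one_formI)
    fix Z assume Z: "Z \<in> V"
    show "d_phi_F g \<phi> X Y Z \<in> C"
      using XY Z by (simp add: d_phi_F_def three_form_linear[OF dF])
    show "d_phi_F g \<phi> X Y (Z + Z') = d_phi_F g \<phi> X Y Z + d_phi_F g \<phi> X Y Z'" if "Z' \<in> V" for Z'
      by (rule ext) (simp add: XY Z that d_phi_F_def three_form_linear[OF dF] \<phi>_add)
    show "d_phi_F g \<phi> X Y (fsmult f Z) = f * d_phi_F g \<phi> X Y Z" if "f \<in> C" for f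
      by (rule ext) (simp add: XY Z that d_phi_F_def three_form_linear[OF dF] \<phi>_fsmult)
  qed
  fix Z assume Z: "Z \<in> V"
  show "d_phi_F g \<phi> Y X Z = - d_phi_F g \<phi> X Y Z" "d_phi_F g \<phi> X Z Y = - d_phi_F g \<phi> X Y Z"
    unfolding d_phi_F_def using three_form_skew[OF dF, of "\<phi> X" "\<phi> Y" "\<phi> Z"] XY Z by simp_all
qed

lemma three_form_canonical_torsion:
  assumes N: "three_form A (nijenhuis3 g \<xi> \<eta> \<phi>)"
  shows "three_form A (canonical_torsion g \<xi> \<eta> \<phi>)"
proof -
  have "three_form A (wedge_one_two \<eta> (d_one_form \<eta>))"
    by (rule three_form_wedge[OF \<eta>_one_form d_\<eta>_one_form d_\<eta>_skew])
  moreover have "three_form A (wedge_one_two \<eta> (interior_product \<xi> (nijenhuis3 g \<xi> \<eta> \<phi>)))"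
  proof (rule three_form_wedge[OF \<eta>_one_form])
    show "one_form A (interior_product \<xi> (nijenhuis3 g \<xi> \<eta> \<phi>) X)" if "X \<in> V" for X
      unfolding interior_product_def[abs_def] by (rule three_form_one_form(3)[OF N \<xi>_vf that])
    show "interior_product \<xi> (nijenhuis3 g \<xi> \<eta> \<phi>) Y X = - interior_product \<xi> (nijenhuis3 g \<xi> \<eta> \<phi>) X Y"
      if "X \<in> V" "Y \<in> V" for X Y
      unfolding interior_product_def by (rule three_form_skew(2)[OF N \<xi>_vf that])
  qed
  ultimately show ?thesis
    unfolding canonical_torsion_def[abs_def] diff_conv_add_uminus
    by (intro three_form_add three_form_uminus three_form_d_\<phi>_F N)
qed

end

section \<open>Metric connections with skew torsion and parallel \<eta>\<close>

text \<open>Parallelism of \<open>\<phi>\<close> is left open, so that the same identities apply to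
  a given almost contact connection and to the candidate for which it has yet to be proved.\<close>

locale almost_contact_skew = almost_contact A g \<xi> \<eta> \<phi>
  for A :: "('a::t2_space, 'e::euclidean_space) chart set"
    and g :: "'a form2" and \<xi> :: "'a vfield" and \<eta> :: "'a form1" and \<phi> :: "'a vfield \<Rightarrow> 'a vfield" +
  fixes D :: "'a connection"
  assumes D_connection: "linear_connection A D" and D_g: "parallel_metric A D g"
    and D_\<eta>: "parallel_one_form A D \<eta>" and torsion_form: "three_form A (torsion3 g D)"
begin

abbreviation "T \<equiv> torsion3 g D"

definition P :: "'a form3" where
  "P X Y Z = g (D X (\<phi> Y) - \<phi> (D X Y)) Z"

lemmas D_simps = linear_connectionD[OF D_connection]
lemmas T_simps = three_form_linear[OF torsion_form]

lemma D_vf [simp]: "X \<in> V \<Longrightarrow> Y \<in> V \<Longrightarrow> D X Y \<in> V"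
  by (rule D_simps(1))

lemma D_uminus_left: "X \<in> V \<Longrightarrow> Y \<in> V \<Longrightarrow> D (- X) Y = - D X Y"
  by (simp add: uminus_eq_fsmult D_simps(3))

lemma D_zero_right: "X \<in> V \<Longrightarrow> D X 0 = 0"
  using D_simps(4)[of X 0 0] by simp

lemma D_zero_left: "Y \<in> V \<Longrightarrow> D 0 Y = 0"
  using D_simps(2)[of 0 0 Y] by simp

lemma D_uminus_right: "X \<in> V \<Longrightarrow> Y \<in> V \<Longrightarrow> D X (- Y) = - D X Y"
  using D_simps(4)[of X Y "- Y"] D_zero_right[of X]
  by (simp add: eq_neg_iff_add_eq_0 add.commute)

lemma D_diff_left: "X \<in> V \<Longrightarrow> X' \<in> V \<Longrightarrow> Y \<in> V \<Longrightarrow> D (X - X') Y = D X Y - D X' Y"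
  using D_simps(2)[of X "- X'" Y] D_uminus_left[of X' Y] uminus_vf[of X'] by (simp only: diff_conv_add_uminus)

lemma D_diff_right: "X \<in> V \<Longrightarrow> Y \<in> V \<Longrightarrow> Y' \<in> V \<Longrightarrow> D X (Y - Y') = D X Y - D X Y'"
  using D_simps(4)[of X Y "- Y'"] D_uminus_right[of X Y'] uminus_vf[of Y'] by (simp only: diff_conv_add_uminus)

lemma \<eta>_D: "X \<in> V \<Longrightarrow> Y \<in> V \<Longrightarrow> \<eta> (D X Y) = X (\<eta> Y)"
  using D_\<eta> unfolding parallel_one_form_def by (metis eq_iff_diff_eq_0)

lemma g_D:
  assumes "X \<in> V" "Y \<in> V" "Z \<in> V"
  shows "X (g Y Z) p = g (D X Y) Z p + g Y (D X Z) p"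
proof -
  have "X (g Y Z) - g (D X Y) Z - g Y (D X Z) = 0"
    using D_g assms unfolding parallel_metric_def by blast
  from fun_cong[OF this, of p] show ?thesis by simp
qed

lemma D_\<xi>: assumes X: "X \<in> V" shows "D X \<xi> = 0"
proof (rule vf_eqI)
  fix Y assume Y: "Y \<in> V"
  have "g (D X \<xi>) Y p = 0" for p
    using g_D[OF X \<xi>_vf Y, of p] \<eta>_D[OF X Y] X Y by (simp add: g_\<xi>)
  then show "g (D X \<xi>) Y = g 0 Y"
    using Y by (simp add: g_zero_left fun_eq_iff)
qed (use X in simp_all)

lemma g_bracket:
  assumes "X \<in> V" "Y \<in> V" "Z \<in> V"
  shows "g (bracket X Y) Z p = g (D X Y) Z p - g (D Y X) Z p - T X Y Z p"
  using assms by (simp add: torsion3_def torsion_def g_linear)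

lemma P_eq:
  assumes "X \<in> V" "Y \<in> V" "Z \<in> V"
  shows "P X Y Z p = g (D X (\<phi> Y)) Z p + g (D X Y) (\<phi> Z) p"
  using assms by (simp add: P_def g_linear g_\<phi>_left)

text \<open>\<open>\<phi>\<close> is skew for a parallel metric, so its covariant derivative is
  skew: differentiate \<open>g (\<phi> Y) Z = - g Y (\<phi> Z)\<close>.\<close>

lemma P_skew:
  assumes "X \<in> V" "Y \<in> V" "Z \<in> V"
  shows "P X Z Y p = - P X Y Z p"
proof -
  have "X (g (\<phi> Y) Z) = X (- g Y (\<phi> Z))"
    using assms by (simp only: g_\<phi>_left)
  then have "X (g (\<phi> Y) Z) p = - X (g Y (\<phi> Z)) p"
    using assms by simp
  then show ?thesis
    using assms g_D[of X "\<phi> Y" Z p] g_D[of X Y "\<phi> Z" p] g_\<phi>_left[of Y "D X Z"]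
      g_commute[of "D X (\<phi> Z)" Y] g_commute[of "D X Z" "\<phi> Y"]
    by (simp add: P_eq)
qed

text \<open>The square of \<open>\<phi>\<close> is built from parallel tensors, so the derivative of
  \<open>\<phi>\<close> anticommutes with \<open>\<phi>\<close>. Moving \<open>\<phi>\<close> across
  \<open>g\<close> absorbs the sign.\<close>

lemma P_\<phi>:
  assumes "X \<in> V" "Y \<in> V" "Z \<in> V"
  shows "P X (\<phi> Y) Z p = P X Y (\<phi> Z) p"
proof -
  have "D X (\<phi> (\<phi> Y)) = fsmult (X (\<eta> Y)) \<xi> - D X Y"
    using assms by (simp add: \<phi>_\<phi> D_diff_right D_simps(5) D_\<xi> fsmult_zero)
  then show ?thesis
    using assms by (simp add: P_eq \<phi>_\<phi>[of Z] g_linear g_\<xi> \<eta>_D mult.commute)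
qed

lemma P_\<xi>:
  assumes "X \<in> V" "Y \<in> V"
  shows "P X \<xi> Y p = 0" "P X Y \<xi> p = 0"
proof -
  show "P X \<xi> Y p = 0"
    using assms by (simp add: P_def \<phi>_\<xi> D_\<xi> D_zero_right \<phi>_zero g_zero_left)
  then show "P X Y \<xi> p = 0" using P_skew[OF assms(1) \<xi>_vf assms(2), of p] by simp
qed

lemma P_\<phi>_\<phi>_right:
  assumes "X \<in> V" "Y \<in> V" "Z \<in> V"
  shows "P X Y (\<phi> (\<phi> Z)) p = - P X Y Z p"
proof -
  have "P X Y (fsmult (\<eta> Z) \<xi> - Z) p = \<eta> Z p * P X Y \<xi> p - P X Y Z p"
    using assms by (simp add: P_def g_linear)
  then show ?thesis using assms by (simp add: \<phi>_\<phi> P_\<xi>)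
qed

text \<open>Unlike in the other two slots, \<open>\<xi>\<close> in the first slot does not give 0
  for a general \<open>D\<close> of this kind, so its term stays.\<close>

lemma P_\<phi>_\<phi>_left:
  assumes "X \<in> V" "Y \<in> V" "Z \<in> V"
  shows "P (\<phi> (\<phi> X)) Y Z p = - P X Y Z p + \<eta> X p * P \<xi> Y Z p"
  using assms by (simp add: \<phi>_\<phi>[of X] P_eq D_diff_left D_simps(3) g_linear algebra_simps)

lemma P_zero_right: "X \<in> V \<Longrightarrow> Y \<in> V \<Longrightarrow> P X Y 0 p = 0"
  by (simp add: P_def g_zero_right)

lemma P_zero_left: "Y \<in> V \<Longrightarrow> Z \<in> V \<Longrightarrow> P 0 Y Z p = 0"
  by (simp add: P_def D_zero_left \<phi>_zero g_zero_left)

lemma T_skew: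
  assumes "X \<in> V" "Y \<in> V" "Z \<in> V"
  shows "T Y X Z p = - T X Y Z p" "T X Z Y p = - T X Y Z p"
  using three_form_skew[OF torsion_form assms] by simp_all

lemma T_\<xi>: "X \<in> V \<Longrightarrow> Y \<in> V \<Longrightarrow> T \<xi> X Y p = T X Y \<xi> p"
  using T_skew(1)[of X \<xi> Y p] T_skew(2)[of X Y \<xi> p] by simp

lemma T_\<phi>_\<phi>:
  assumes "X \<in> V" "Y \<in> V" "Z \<in> V"
  shows "T X Y (\<phi> (\<phi> Z)) p = - T X Y Z p + \<eta> Z p * T X Y \<xi> p"
proof -
  have "T X Y (fsmult (\<eta> Z) \<xi> - Z) = \<eta> Z * T X Y \<xi> - T X Y Z"
    using assms one_form_diff[OF three_form_one_form(3)[OF torsion_form assms(1,2)], of "fsmult (\<eta> Z) \<xi>" Z]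
    by (simp add: T_simps)
  then show ?thesis
    using assms by (simp add: \<phi>_\<phi>[of Z])
qed

lemma d_\<eta>_eq:
  assumes "X \<in> V" "Y \<in> V"
  shows "d_one_form \<eta> X Y p = T X Y \<xi> p"
proof -
  have "\<eta> (bracket X Y) p = \<eta> (D X Y) p - \<eta> (D Y X) p - T X Y \<xi> p"
    using g_bracket[OF assms \<xi>_vf, of p] assms by (simp add: g_\<xi>)
  then show ?thesis
    using assms by (simp add: d_one_form_def \<eta>_D)
qed

lemma nijenhuis_eq:
  assumes "X \<in> V" "Y \<in> V" "Z \<in> V"
  shows "nijenhuis3 g \<xi> \<eta> \<phi> X Y Z p =
    T X Y Z p - T (\<phi> X) (\<phi> Y) Z p - T (\<phi> X) Y (\<phi> Z) p - T X (\<phi> Y) (\<phi> Z) p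
    + P (\<phi> X) Y Z p - P (\<phi> Y) X Z p + P X Y (\<phi> Z) p - P Y X (\<phi> Z) p"
proof -
  have dC: "d_one_form \<eta> X Y \<in> C"
    using assms one_form_smooth[OF d_\<eta>_one_form] by blast
  have \<phi>\<phi>: "g U (\<phi> (\<phi> Z)) p = - g U Z p + \<eta> Z p * \<eta> U p" if "U \<in> V" for U
    using that assms by (simp add: \<phi>_\<phi>[of Z] g_linear g_\<xi>)
  have "\<eta> (bracket X Y) p = \<eta> (D X Y) p - \<eta> (D Y X) p - T X Y \<xi> p"
    using g_bracket[OF assms(1,2) \<xi>_vf, of p] assms by (simp add: g_\<xi>)
  then have \<eta>b: "\<eta> (bracket X Y) p * \<eta> Z p
      = \<eta> (D X Y) p * \<eta> Z p - \<eta> (D Y X) p * \<eta> Z p - T X Y \<xi> p * \<eta> Z p"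
    by (simp add: left_diff_distrib)
  have "nijenhuis3 g \<xi> \<eta> \<phi> X Y Z p = g (bracket (\<phi> X) (\<phi> Y)) Z p + g (\<phi> (\<phi> (bracket X Y))) Z p
      - g (\<phi> (bracket (\<phi> X) Y)) Z p - g (\<phi> (bracket X (\<phi> Y))) Z p + T X Y \<xi> p * \<eta> Z p"
    using assms dC by (simp add: nijenhuis3_def nijenhuis_def g_linear d_\<eta>_eq g_\<xi>)
  also have "g (\<phi> (\<phi> (bracket X Y))) Z p = g (bracket X Y) (\<phi> (\<phi> Z)) p"
    using assms by (simp add: g_\<phi>_left)
  also have "\<dots> = - g (bracket X Y) Z p + \<eta> (bracket X Y) p * \<eta> Z p"
    using assms by (simp add: \<phi>\<phi>)
  \<comment> \<open>The torsion part of \<open>\<eta> (bracket X Y)\<close> has cancelled the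
    \<open>d_one_form\<close> term. The remaining products with \<open>\<eta> Z\<close> complete
    \<open>- g (D X Y) Z\<close> to \<open>g (D X Y) (\<phi> (\<phi> Z))\<close>, as it occurs in
    \<open>P X Y (\<phi> Z)\<close>.\<close>
  finally have N: "nijenhuis3 g \<xi> \<eta> \<phi> X Y Z p = g (bracket (\<phi> X) (\<phi> Y)) Z p - g (bracket X Y) Z p
      + (\<eta> (D X Y) p * \<eta> Z p - \<eta> (D Y X) p * \<eta> Z p)
      + g (bracket (\<phi> X) Y) (\<phi> Z) p + g (bracket X (\<phi> Y)) (\<phi> Z) p"
    using assms \<eta>b by (simp add: g_\<phi>_left)
  show ?thesis
    using assms N
    by (simp add: g_bracket P_eq \<phi>\<phi> mult.commute)
qed

lemma d_F_eq:
  assumes "X \<in> V" "Y \<in> V" "Z \<in> V"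
  shows "d_two_form (fundamental_form g \<phi>) X Y Z p =
    - P X Y Z p - P Y Z X p - P Z X Y p + T X Y (\<phi> Z) p + T Y Z (\<phi> X) p + T Z X (\<phi> Y) p"
proof -
  \<comment> \<open>Differentiating \<open>\<phi> S\<close> gives a \<open>P\<close> term and a term
    with \<open>D U S\<close>. In the alternating sum all terms with \<open>D\<close> cancel against
    those from the brackets.\<close>
  have gP: "U (g W (\<phi> S)) p = g (D U W) (\<phi> S) p + g (D U S) (\<phi> W) p * - 1 - P U W S p"
    if "U \<in> V" "W \<in> V" "S \<in> V" for U W S
    using that g_D[of U W "\<phi> S" p] P_eq[of U S W p] P_skew[of U W S p]
    by (simp add: g_commute)
  have sw: "T X Z (\<phi> Y) p = - T Z X (\<phi> Y) p"
    using T_skew(1)[of Z X "\<phi> Y" p] assms by simp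
  have "P Y X Z p = - P Y Z X p"
    using P_skew[of Y Z X p] assms by simp
  then show ?thesis
    using assms sw gP[of X Y Z] gP[of Y X Z] gP[of Z X Y]
    by (simp add: d_two_form_def fundamental_form_def g_bracket)
qed

lemma canonical_torsion_eq:
  assumes XYZ: "X \<in> V" "Y \<in> V" "Z \<in> V"
  shows "canonical_torsion g \<xi> \<eta> \<phi> X Y Z p = T X Y Z p
    - P (\<phi> Z) X Y p + P X Y (\<phi> Z) p - P Y X (\<phi> Z) p
    - (\<eta> X p * P \<xi> Y (\<phi> Z) p + \<eta> Y p * P \<xi> Z (\<phi> X) p + \<eta> Z p * P \<xi> X (\<phi> Y) p)"
proof -
  have N\<xi>: "nijenhuis3 g \<xi> \<eta> \<phi> \<xi> U W p = T U W \<xi> p - T (\<phi> U) (\<phi> W) \<xi> p + P \<xi> U (\<phi> W) p"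
    if "U \<in> V" "W \<in> V" for U W
    using that by (simp add: nijenhuis_eq \<phi>_\<xi> T_simps T_\<xi> P_zero_left P_\<xi>)
  have dF: "d_phi_F g \<phi> X Y Z p =
      - P (\<phi> X) Y Z p - P (\<phi> Y) Z X p - P (\<phi> Z) X Y p
      + T (\<phi> X) (\<phi> Y) Z p + T (\<phi> Y) (\<phi> Z) X p + T (\<phi> Z) (\<phi> X) Y p
      - \<eta> Z p * T (\<phi> X) (\<phi> Y) \<xi> p - \<eta> X p * T (\<phi> Y) (\<phi> Z) \<xi> p - \<eta> Y p * T (\<phi> Z) (\<phi> X) \<xi> p"
    using XYZ by (simp add: d_phi_F_def d_F_eq T_\<phi>_\<phi> P_\<phi> P_\<phi>_\<phi>_right)
  have c1: "T (\<phi> Y) (\<phi> Z) X p = T X (\<phi> Y) (\<phi> Z) p"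
    using T_skew(2)[of "\<phi> Y" X "\<phi> Z" p] T_skew(1)[of X "\<phi> Y" "\<phi> Z" p] XYZ by simp
  have c2: "T (\<phi> Z) (\<phi> X) Y p = T (\<phi> X) Y (\<phi> Z) p"
    using T_skew(1)[of "\<phi> X" "\<phi> Z" Y p] T_skew(2)[of "\<phi> X" Y "\<phi> Z" p] XYZ by simp
  have c3: "P (\<phi> Y) X Z p = - P (\<phi> Y) Z X p"
    using XYZ P_skew[of "\<phi> Y" Z X p] by simp
  show ?thesis
    using XYZ
    by (simp add: canonical_torsion_def wedge_one_two_def interior_product_def d_\<eta>_eq N\<xi> dF
        nijenhuis_eq[OF XYZ] c1 c2 c3 T_\<xi>,
      simp add: algebra_simps)
qed

lemma P_zero:
  assumes "parallel_endomorphism A D \<phi>" "X \<in> V" "Y \<in> V" "Z \<in> V"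
  shows "P X Y Z p = 0"
proof -
  have "D X (\<phi> Y) - \<phi> (D X Y) = 0"
    using assms unfolding parallel_endomorphism_def by blast
  then show ?thesis using assms by (simp only: P_def g_zero_left zero_fun_apply)
qed

text \<open>With \<open>P = 0\<close>, the terms of \<open>N\<close> with two \<phi>'s run over all
  pairs of slots, so a transposition of the arguments permutes them up to the sign of
  \<open>T\<close>.\<close>

lemma nijenhuis_three_form:
  assumes "parallel_endomorphism A D \<phi>"
  shows "three_form A (nijenhuis3 g \<xi> \<eta> \<phi>)"
proof (rule three_formI)
  have N: "nijenhuis3 g \<xi> \<eta> \<phi> X Y Z p =
      T X Y Z p - T (\<phi> X) (\<phi> Y) Z p - T (\<phi> X) Y (\<phi> Z) p - T X (\<phi> Y) (\<phi> Z) p"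
    if "X \<in> V" "Y \<in> V" "Z \<in> V" for X Y Z p
    using that by (simp add: nijenhuis_eq P_zero[OF assms])
  fix X Y assume XY: "X \<in> V" "Y \<in> V"
  have "nijenhuis \<xi> \<eta> \<phi> X Y \<in> V"
    using XY one_form_smooth[OF d_\<eta>_one_form] by (simp add: nijenhuis_def)
  then show "one_form A (nijenhuis3 g \<xi> \<eta> \<phi> X Y)"
    unfolding nijenhuis3_def[abs_def] by (rule g_one_form_right)
  fix Z assume Z: "Z \<in> V"
  note V = XY Z \<phi>_vf[OF XY(1)] \<phi>_vf[OF XY(2)] \<phi>_vf[OF Z]
  show "nijenhuis3 g \<xi> \<eta> \<phi> Y X Z = - nijenhuis3 g \<xi> \<eta> \<phi> X Y Z"
  proof (rule ext)
    fix p
    show "nijenhuis3 g \<xi> \<eta> \<phi> Y X Z p = (- nijenhuis3 g \<xi> \<eta> \<phi> X Y Z) p"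
      using T_skew(1)[OF V(1,2,3), of p] T_skew(1)[OF V(4,5,3), of p]
        T_skew(1)[OF V(1,5,6), of p] T_skew(1)[OF V(4,2,6), of p]
      by (simp add: N V)
  qed
  show "nijenhuis3 g \<xi> \<eta> \<phi> X Z Y = - nijenhuis3 g \<xi> \<eta> \<phi> X Y Z"
  proof (rule ext)
    fix p
    show "nijenhuis3 g \<xi> \<eta> \<phi> X Z Y p = (- nijenhuis3 g \<xi> \<eta> \<phi> X Y Z) p"
      using T_skew(2)[OF V(1,2,3), of p] T_skew(2)[OF V(4,5,3), of p]
        T_skew(2)[OF V(1,5,6), of p] T_skew(2)[OF V(4,2,6), of p]
      by (simp add: N V)
  qed
qed

text \<open>As \<open>\<xi>\<close> and \<open>g\<close> are parallel, the Lie derivative of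
  \<open>g\<close> along \<open>\<xi>\<close> reduces to
  \<open>T \<xi> X Y + T \<xi> Y X\<close>.\<close>

lemma \<xi>_killing: "killing_field A g \<xi>"
  unfolding killing_field_def
proof (intro conjI ballI ext)
  fix X Y p assume XY: "X \<in> V" "Y \<in> V"
  have "g X (bracket \<xi> Y) p = g (bracket \<xi> Y) X p"
    using XY by (simp add: g_commute)
  moreover have "g (D X \<xi>) Y p = 0" "g (D Y \<xi>) X p = 0"
    using XY by (simp_all add: D_\<xi> g_zero_left)
  moreover have "g X (D \<xi> Y) p = g (D \<xi> Y) X p"
    using XY by (simp add: g_commute)
  ultimately show "(\<xi> (g X Y) - g (bracket \<xi> X) Y - g X (bracket \<xi> Y)) p = 0 p"
    using XY g_D[of \<xi> X Y p] T_skew(2)[of \<xi> X Y p] by (simp add: g_bracket)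
qed simp

lemma parallel_\<phi>I:
  assumes can: "\<And>X Y Z. X \<in> V \<Longrightarrow> Y \<in> V \<Longrightarrow> Z \<in> V \<Longrightarrow> T X Y Z = canonical_torsion g \<xi> \<eta> \<phi> X Y Z"
  shows "parallel_endomorphism A D \<phi>"
proof -
  have E: "P (\<phi> Z) X Y p = P X Y (\<phi> Z) p - P Y X (\<phi> Z) p
      - (\<eta> X p * P \<xi> Y (\<phi> Z) p + \<eta> Y p * P \<xi> Z (\<phi> X) p + \<eta> Z p * P \<xi> X (\<phi> Y) p)"
    if "X \<in> V" "Y \<in> V" "Z \<in> V" for X Y Z p
    using canonical_torsion_eq[OF that, of p] can[OF that] by simp
  \<comment> \<open>Take \<open>Z = \<xi>\<close> in \<open>E\<close>: all terms containing
    \<open>\<phi> \<xi>\<close> or \<open>P \<xi> \<xi>\<close> vanish, and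
    \<open>\<eta> \<xi> = 1\<close> isolates the claim.\<close>
  have \<xi>1: "P \<xi> X (\<phi> Y) p = 0" if "X \<in> V" "Y \<in> V" for X Y p
    using E[OF that \<xi>_vf, of p] that
      P_\<phi>[of X Y \<xi> p] P_\<phi>[of Y X \<xi> p] P_\<phi>[of \<xi> \<xi> X p]
    by (simp add: \<phi>_\<xi> P_zero_left P_zero_right P_\<xi> \<eta>_\<xi>)
  have \<xi>2: "P \<xi> X Y p = 0" if "X \<in> V" "Y \<in> V" for X Y p
    using \<xi>1[of X "\<phi> Y" p] that by (simp add: P_\<phi>_\<phi>_right)
  \<comment> \<open>Put \<open>\<phi> Z\<close> for \<open>Z\<close> in \<open>E\<close>; each
    double \<open>\<phi>\<close> now gives only a sign, since the \<open>P \<xi>\<close> terms are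
    gone.\<close>
  have cyc: "P Z X Y p = P X Y Z p + P Y Z X p" if XYZ: "X \<in> V" "Y \<in> V" "Z \<in> V" for X Y Z p
    using E[OF XYZ(1,2) \<phi>_vf[OF XYZ(3)], of p] XYZ P_skew[of Y Z X p]
    by (simp add: \<xi>2 P_\<phi>_\<phi>_left P_\<phi>_\<phi>_right)
  \<comment> \<open>Adding the three cyclic relations shows that the cyclic sum equals twice itself,
    so it is 0; each relation then says that a term is its own negative.\<close>
  have zero: "P X Y Z p = 0" if "X \<in> V" "Y \<in> V" "Z \<in> V" for X Y Z p
    using cyc[OF that, of p] cyc[OF that(2,3,1), of p] cyc[OF that(3,1,2), of p] by linarith
  show ?thesis
    unfolding parallel_endomorphism_def
  proof (intro ballI, rule vf_eqI)
    fix X Y Z assume "X \<in> V" "Y \<in> V" "Z \<in> V"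
    then show "g (D X (\<phi> Y) - \<phi> (D X Y)) Z = g 0 Z"
      using zero[of X Y Z] by (simp add: P_def g_zero_left fun_eq_iff)
  qed auto
qed

end

section \<open>The two implications and uniqueness\<close>

context almost_contact
begin

lemma torsion_canonical:
  assumes D: "almost_contact_connection A g \<eta> \<phi> D" "three_form A (torsion3 g D)"
    and XYZ: "X \<in> V" "Y \<in> V" "Z \<in> V"
  shows "torsion3 g D X Y Z = canonical_torsion g \<xi> \<eta> \<phi> X Y Z"
proof -
  interpret D: almost_contact_skew A g \<xi> \<eta> \<phi> D
    using D by unfold_locales (auto simp: almost_contact_connection_def)
  have "parallel_endomorphism A D \<phi>"
    using D(1) by (simp add: almost_contact_connection_def)
  then have P0: "D.P X Y Z p = 0" if "X \<in> V" "Y \<in> V" "Z \<in> V" for X Y Z p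
    using D.P_zero that by blast
  show ?thesis
    using XYZ by (intro ext) (simp add: D.canonical_torsion_eq P0)
qed

text \<open>For a Killing field of constant length, \<open>d\<eta>(\<xi>, X) = 2 g(\<nabla>\<^sub>\<xi>\<xi>, X) = - X |\<xi>|\<^sup>2 = 0\<close>.\<close>

lemma killing_d_\<eta>_\<xi>:
  assumes K: "killing_field A g \<xi>" and X: "X \<in> V"
  shows "d_one_form \<eta> \<xi> X = 0"
proof -
  have "\<xi> (g \<xi> X) - g (bracket \<xi> \<xi>) X - g \<xi> (bracket \<xi> X) = 0"
    using K X \<xi>_vf unfolding killing_field_def by blast
  moreover have "bracket \<xi> \<xi> = 0" by (simp add: bracket_def fun_eq_iff)
  ultimately have "\<xi> (\<eta> X) - \<eta> (bracket \<xi> X) = 0"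
    using X by (simp only: g_zero_left g_\<xi> bracket_vf \<xi>_vf diff_0_right)
  then show ?thesis
    using X by (simp only: d_one_form_def \<eta>_\<xi> vf_one diff_0_right)
qed

text \<open>The bilinear form \<open>g (D X \<xi>) Y\<close> is shown to vanish part by part: the
  Killing equation kills its symmetric part, as \<open>T\<close> is skew, and the identity of
  \<open>T \<xi> X Y\<close> with \<open>d_one_form \<eta> X Y\<close> kills its skew part.\<close>

lemma killing_parallel_\<eta>:
  assumes K: "killing_field A g \<xi>" and N: "three_form A (nijenhuis3 g \<xi> \<eta> \<phi>)"
    and D: "linear_connection A D" "parallel_metric A D g"
    and tor: "\<And>X Y Z. X \<in> V \<Longrightarrow> Y \<in> V \<Longrightarrow> Z \<in> V \<Longrightarrow>
      torsion3 g D X Y Z = canonical_torsion g \<xi> \<eta> \<phi> X Y Z"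
  shows "parallel_one_form A D \<eta>"
  unfolding parallel_one_form_def
proof (intro ballI ext)
  fix X Y p assume XY: "X \<in> V" "Y \<in> V"
  have DV [simp]: "D U W \<in> V" if "U \<in> V" "W \<in> V" for U W
    using linear_connectionD(1)[OF D(1)] that by blast
  have par: "U (g W S) p = g (D U W) S p + g W (D U S) p" if "U \<in> V" "W \<in> V" "S \<in> V" for U W S
  proof -
    have "U (g W S) - g (D U W) S - g W (D U S) = 0"
      using D(2) that unfolding parallel_metric_def by blast
    from fun_cong[OF this, of p] show ?thesis by simp
  qed
  have br: "g (bracket U W) S p = g (D U W) S p - g (D W U) S p - torsion3 g D U W S p"
    if "U \<in> V" "W \<in> V" "S \<in> V" for U W S
    using that by (simp add: torsion3_def torsion_def g_linear)
  have can: "three_form A (canonical_torsion g \<xi> \<eta> \<phi>)"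
    by (rule three_form_canonical_torsion[OF N])
  have sk: "torsion3 g D W U S p = - torsion3 g D U W S p" "torsion3 g D U S W p = - torsion3 g D U W S p"
    if "U \<in> V" "W \<in> V" "S \<in> V" for U W S
    using three_form_skew[OF can that] tor that by simp_all
  have N\<xi>: "nijenhuis3 g \<xi> \<eta> \<phi> \<xi> U \<xi> p = 0" "nijenhuis3 g \<xi> \<eta> \<phi> \<xi> \<xi> U p = 0" if "U \<in> V" for U
  proof -
    show "nijenhuis3 g \<xi> \<eta> \<phi> \<xi> \<xi> U p = 0"
      using fun_cong[OF three_form_skew(1)[OF N \<xi>_vf \<xi>_vf that], of p] by simp
    then show "nijenhuis3 g \<xi> \<eta> \<phi> \<xi> U \<xi> p = 0"
      using fun_cong[OF three_form_skew(2)[OF N \<xi>_vf \<xi>_vf that], of p] by simp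
  qed
  have dF: "three_form A (d_two_form (fundamental_form g \<phi>))"
    by (rule three_form_d_two_form[OF F_one_form F_skew])
  have d\<eta>: "d_one_form \<eta> \<xi> X p = 0" "d_one_form \<eta> \<xi> Y p = 0" "d_one_form \<eta> Y \<xi> p = 0"
    using killing_d_\<eta>_\<xi>[OF K XY(1)] killing_d_\<eta>_\<xi>[OF K XY(2)] d_\<eta>_skew[OF \<xi>_vf XY(2)] by simp_all
  \<comment> \<open>With \<open>\<xi>\<close> inserted, \<open>d_phi_F\<close> vanishes because
    \<open>\<phi> \<xi> = 0\<close>, the two terms with \<open>N\<close> cancel, and
    \<open>d_one_form \<eta> \<xi>\<close> is 0 by the Killing property.\<close>
  have T\<xi>: "torsion3 g D \<xi> X Y p = d_one_form \<eta> X Y p"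
    using XY tor[OF \<xi>_vf XY]
    by (simp add: canonical_torsion_def wedge_one_two_def interior_product_def d_phi_F_def
        \<phi>_\<xi> three_form_linear[OF dF] \<eta>_\<xi> N\<xi> d\<eta>)
  have "\<xi> (g X Y) - g (bracket \<xi> X) Y - g X (bracket \<xi> Y) = 0"
    using K XY unfolding killing_field_def by blast
  from fun_cong[OF this, of p]
  have kil: "\<xi> (g X Y) p - g (bracket \<xi> X) Y p - g (bracket \<xi> Y) X p = 0"
    using XY by (simp add: g_commute[of X])
  have skew: "g (D X \<xi>) Y p + g (D Y \<xi>) X p = 0"
    using kil par[OF \<xi>_vf XY] br[OF \<xi>_vf XY] br[OF \<xi>_vf XY(2,1)] sk(2)[OF \<xi>_vf XY] XY
    by (simp add: g_commute[of X "D \<xi> Y"])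
  have "d_one_form \<eta> X Y p = X (g \<xi> Y) p - Y (g \<xi> X) p - g \<xi> (bracket X Y) p"
    using XY by (simp add: d_one_form_def g_\<xi>)
  also have "g \<xi> (bracket X Y) p = g (D X Y) \<xi> p - g (D Y X) \<xi> p - torsion3 g D \<xi> X Y p"
    using br[OF XY \<xi>_vf] sk(1)[OF XY(1) \<xi>_vf XY(2)] sk(2)[OF XY \<xi>_vf] XY
    by (simp add: g_commute[of \<xi>])
  also have "X (g \<xi> Y) p = g (D X \<xi>) Y p + g (D X Y) \<xi> p"
    using par[OF XY(1) \<xi>_vf XY(2)] XY by (simp add: g_commute[of \<xi>])
  also have "Y (g \<xi> X) p = g (D Y \<xi>) X p + g (D Y X) \<xi> p"
    using par[OF XY(2) \<xi>_vf XY(1)] XY by (simp add: g_commute[of \<xi>])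
  finally have "g (D X \<xi>) Y p = 0"
    using T\<xi> skew by simp
  then show "(X (\<eta> Y) - \<eta> (D X Y)) p = 0 p"
    using par[OF XY(1) \<xi>_vf XY(2)] XY by (simp add: g_\<xi>)
qed

lemma killing_connection_exists:
  assumes K: "killing_field A g \<xi>" and N: "three_form A (nijenhuis3 g \<xi> \<eta> \<phi>)"
  shows "\<exists>D. almost_contact_connection A g \<eta> \<phi> D \<and> three_form A (torsion3 g D)"
proof -
  have can: "three_form A (canonical_torsion g \<xi> \<eta> \<phi>)"
    by (rule three_form_canonical_torsion[OF N])
  obtain D where D: "linear_connection A D" "parallel_metric A D g"
    and tor: "\<And>X Y Z. X \<in> V \<Longrightarrow> Y \<in> V \<Longrightarrow> Z \<in> V \<Longrightarrow>
      torsion3 g D X Y Z = canonical_torsion g \<xi> \<eta> \<phi> X Y Z"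
    using connection_exists[OF can] by blast
  have T: "three_form A (torsion3 g D)"
    using can by (rule three_form_cong[rotated]) (simp add: tor)
  have \<eta>: "parallel_one_form A D \<eta>"
    by (rule killing_parallel_\<eta>[OF K N D tor])
  interpret D: almost_contact_skew A g \<xi> \<eta> \<phi> D
    by unfold_locales (fact D \<eta> T)+
  have "parallel_endomorphism A D \<phi>"
    by (rule D.parallel_\<phi>I[OF tor])
  with D \<eta> T show ?thesis
    unfolding almost_contact_connection_def by blast
qed

lemma connection_imp_killing:
  assumes D: "almost_contact_connection A g \<eta> \<phi> D" "three_form A (torsion3 g D)"
  shows "three_form A (nijenhuis3 g \<xi> \<eta> \<phi>) \<and> killing_field A g \<xi>"
proof -
  interpret D: almost_contact_skew A g \<xi> \<eta> \<phi> D
    using D by unfold_locales (auto simp: almost_contact_connection_def)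
  show ?thesis
    using D(1) D.nijenhuis_three_form D.\<xi>_killing by (simp add: almost_contact_connection_def)
qed

text \<open>Both torsions equal \<open>canonical_torsion\<close>, which depends only on the
  structure, and a metric connection is determined by its torsion.\<close>

lemma almost_contact_connection_unique:
  assumes D: "almost_contact_connection A g \<eta> \<phi> D" "three_form A (torsion3 g D)"
    and D': "almost_contact_connection A g \<eta> \<phi> D'" "three_form A (torsion3 g D')"
  shows "D = D'"
proof (rule connection_unique)
  show "three_form A (canonical_torsion g \<xi> \<eta> \<phi>)"
    using three_form_canonical_torsion connection_imp_killing[OF D] by blast
qed (use torsion_canonical[OF D] torsion_canonical[OF D'] D D' in
    \<open>simp_all add: almost_contact_connection_def\<close>)

end

theorem theorem8p2:
  fixes A :: "('a::{t2_space,second_countable_topology}, 'e::euclidean_space) chart set"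
    and k :: nat
    and g :: "'a form2" and \<xi> :: "'a vfield" and \<eta> :: "'a form1"
    and \<phi> :: "'a vfield \<Rightarrow> 'a vfield"
  assumes manifold: "smooth_atlas A"
    and dim: "DIM('e) = 2 * k + 1"
    and contact: "almost_contact_metric A g \<xi> \<eta> \<phi>"
  shows
    "((three_form A (nijenhuis3 g \<xi> \<eta> \<phi>) \<and> killing_field A g \<xi>) \<longleftrightarrow>
      (\<exists>D. almost_contact_connection A g \<eta> \<phi> D \<and> three_form A (torsion3 g D)))
     \<and>
     ((\<exists>D. almost_contact_connection A g \<eta> \<phi> D \<and> three_form A (torsion3 g D)) \<longrightarrow>
      (\<exists>!D. almost_contact_connection A g \<eta> \<phi> D \<and> three_form A (torsion3 g D)))
     \<and>
     (\<forall>D. almost_contact_connection A g \<eta> \<phi> D \<and> three_form A (torsion3 g D) \<longrightarrow>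
        (\<forall>X\<in>vector_fields A. \<forall>Y\<in>vector_fields A. \<forall>Z\<in>vector_fields A.
           (\<forall>p. g (D X Y) Z p = g (levi_civita A g X Y) Z p + 1/2 * torsion3 g D X Y Z p) \<and>
           torsion3 g D X Y Z = canonical_torsion g \<xi> \<eta> \<phi> X Y Z))"
proof -
  interpret almost_contact A g \<xi> \<eta> \<phi>
    by unfold_locales (fact manifold contact)+
  let ?Q = "\<lambda>D. almost_contact_connection A g \<eta> \<phi> D \<and> three_form A (torsion3 g D)"
  have "(three_form A (nijenhuis3 g \<xi> \<eta> \<phi>) \<and> killing_field A g \<xi>) \<longleftrightarrow> (\<exists>D. ?Q D)"
    using killing_connection_exists connection_imp_killing by blast
  moreover have "(\<exists>D. ?Q D) \<longrightarrow> (\<exists>!D. ?Q D)"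
    using almost_contact_connection_unique by blast
  moreover have "g (D X Y) Z p = g (levi_civita A g X Y) Z p + 1/2 * torsion3 g D X Y Z p"
    if "?Q D" "X \<in> V" "Y \<in> V" "Z \<in> V" for D X Y Z p
    using that by (intro levi_civita_plus_half_torsion) (simp_all add: almost_contact_connection_def)
  moreover have "torsion3 g D X Y Z = canonical_torsion g \<xi> \<eta> \<phi> X Y Z"
    if "?Q D" "X \<in> V" "Y \<in> V" "Z \<in> V" for D X Y Z
    using that torsion_canonical by blast
  ultimately show ?thesis by blast
qed

end
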